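(* Fix a prime $p$, and assume $G$ is a group all of whose $p$-subgroups are locally finite. Then for each $\mathbb{Z}G$-module $M$, the natural homomorphism $\Lambda^*(G;M)\to\Lambda^*_f(G;M)$ is an isomorphism.
   Context: A $p$-group is a group each of whose elements has (finite) $p$-power order. A group is locally finite if each of its finitely generated subgroups is finite. Higher limits: for a small category $\mathcal{C}$, a $\mathcal{C}$-module is a functor $\mathcal{C}^{\mathrm{op}}\to\mathrm{Ab}$, and $\varprojlim^i_{\mathcal{C}}(\Phi)$ denotes the $i$-th right derived functor of the inverse limit functor on the category of $\mathcal{C}$-modules. Orbit categories: for a group $G$, $\mathcal{O}(G)$ is the category whose objects are the subgroups of $G$, with $\mathrm{Mor}_{\mathcal{O}(G)}(H,K)=\{Kg \mid g\in G,\ gHg^{-1}\le K\}$ and composition $Lx\circ Kg=Lxg$; write $[g]=Kg$. $\mathcal{O}_p^f(G)\subseteq\mathcal{O}_p(G)\subseteq\mathcal{O}(G)$ are the full subcategories whose objects are the finite $p$-subgroups, respectively all $p$-subgroups, of $G$. For a $\mathbb{Z}G$-module $M$, $F_M\colon\mathcal{O}_p(G)^{\mathrm{op}}\to\mathrm{Ab}$ is the functor with $F_M(P)=M$ if $P=1$ and $F_M(P)=0$ if $P\ne1$, where $\mathrm{Aut}_{\mathcal{O}_p(G)}(1)\cong G$ acts on $F_M(1)=M$ through the given action ($F_M([g])$ is multiplication by $g^{-1}$). Set $\Lambda^*(G;M)=\varprojlim^*_{\mathcal{O}_p(G)}(F_M)$ and $\Lambda^*_f(G;M)=\varprojlim^*_{\mathcal{O}_p^f(G)}(F_M|_{\mathcal{O}_p^f(G)})$.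 The natural homomorphism is the one induced by restriction along the inclusion $\mathcal{O}_p^f(G)\subseteq\mathcal{O}_p(G)$. *)

theory Defs
  imports "HOL-Algebra.Algebra" "HOL-Computational_Algebra.Primes"
begin

text \<open>
  Abelian groups are commutative groups of \<open>HOL-Algebra\<close>, hence written multiplicatively:
  \<open>\<one>\<close> plays the role of the zero element, and zero maps are constantly \<open>\<one>\<close>.
\<close>


section \<open>Small categories and their modules\<close>

text \<open>
  \<open>cmp C a b c g f\<close> is the composite of \<open>f : a \<rightarrow> b\<close> and \<open>g : b \<rightarrow> c\<close>. Hom-sets of different pairs of
  objects need not be disjoint, so source and target are passed explicitly.
\<close>

record ('o, 'r) cat =
  obj :: "'o set"
  mor :: "'o \<Rightarrow> 'o \<Rightarrow> 'r set"
  idt :: "'o \<Rightarrow> 'r"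
  cmp :: "'o \<Rightarrow> 'o \<Rightarrow> 'o \<Rightarrow> 'r \<Rightarrow> 'r \<Rightarrow> 'r"

definition small_category :: "('o, 'r) cat \<Rightarrow> bool" where
  "small_category C \<longleftrightarrow>
     (\<forall>a\<in>obj C. idt C a \<in> mor C a a) \<and>
     (\<forall>a\<in>obj C. \<forall>b\<in>obj C. \<forall>c\<in>obj C. \<forall>f\<in>mor C a b. \<forall>g\<in>mor C b c.
        cmp C a b c g f \<in> mor C a c) \<and>
     (\<forall>a\<in>obj C. \<forall>b\<in>obj C. \<forall>f\<in>mor C a b.
        cmp C a a b f (idt C a) = f \<and> cmp C a b b (idt C b) f = f) \<and>
     (\<forall>a\<in>obj C. \<forall>b\<in>obj C. \<forall>c\<in>obj C. \<forall>d\<in>obj C.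
        \<forall>f\<in>mor C a b. \<forall>g\<in>mor C b c. \<forall>h\<in>mor C c d.
        cmp C a b d (cmp C b c d h g) f = cmp C a c d h (cmp C a b c g f))"

definition full_subcat :: "('o, 'r) cat \<Rightarrow> 'o set \<Rightarrow> ('o, 'r) cat" where
  "full_subcat C S = C\<lparr>obj := S\<rparr>"

text \<open>
  Contravariant functors to abelian groups: \<open>arr \<Phi> a b f\<close>, for \<open>f : a \<rightarrow> b\<close>, maps \<open>val \<Phi> b\<close> to \<open>val \<Phi> a\<close>.
  Only the values on objects of \<open>C\<close> are constrained, so the restriction of \<open>\<Phi>\<close> to a
  full subcategory is given by the same record.
\<close>

record ('o, 'r, 'a) cmod =
  val :: "'o \<Rightarrow> 'a monoid"
  arr :: "'o \<Rightarrow> 'o \<Rightarrow> 'r \<Rightarrow> 'a \<Rightarrow> 'a"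

definition cmodule :: "('o, 'r) cat \<Rightarrow> ('o, 'r, 'a) cmod \<Rightarrow> bool" where
  "cmodule C \<Phi> \<longleftrightarrow>
     (\<forall>a\<in>obj C. comm_group (val \<Phi> a)) \<and>
     (\<forall>a\<in>obj C. \<forall>b\<in>obj C. \<forall>f\<in>mor C a b. arr \<Phi> a b f \<in> hom (val \<Phi> b) (val \<Phi> a)) \<and>
     (\<forall>a\<in>obj C. \<forall>x\<in>carrier (val \<Phi> a). arr \<Phi> a a (idt C a) x = x) \<and>
     (\<forall>a\<in>obj C. \<forall>b\<in>obj C. \<forall>c\<in>obj C. \<forall>f\<in>mor C a b. \<forall>g\<in>mor C b c. \<forall>x\<in>carrier (val \<Phi> c).
        arr \<Phi> a c (cmp C a b c g f) x = arr \<Phi> a b f (arr \<Phi> b c g x))"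

definition cmod_hom ::
  "('o, 'r) cat \<Rightarrow> ('o, 'r, 'a) cmod \<Rightarrow> ('o, 'r, 'b) cmod \<Rightarrow> ('o \<Rightarrow> 'a \<Rightarrow> 'b) set" where
  "cmod_hom C \<Phi> \<Psi> = {\<eta>.
     (\<forall>a\<in>obj C. \<eta> a \<in> hom (val \<Phi> a) (val \<Psi> a)) \<and>
     (\<forall>a\<in>obj C. \<forall>b\<in>obj C. \<forall>f\<in>mor C a b. \<forall>x\<in>carrier (val \<Phi> b).
        \<eta> a (arr \<Phi> a b f x) = arr \<Psi> a b f (\<eta> b x))}"


section \<open>Inverse limits and their derived functors\<close>

text \<open>The inverse limit, as the group of compatible families.\<close>

definition cat_lim :: "('o, 'r) cat \<Rightarrow> ('o, 'r, 'a) cmod \<Rightarrow> ('o \<Rightarrow> 'a) monoid" where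
  "cat_lim C \<Phi> = (product_group (obj C) (val \<Phi>))
     \<lparr>carrier := {x \<in> (\<Pi>\<^sub>E a\<in>obj C. carrier (val \<Phi> a)).
        \<forall>a\<in>obj C. \<forall>b\<in>obj C. \<forall>f\<in>mor C a b. arr \<Phi> a b f (x b) = x a}\<rparr>"

definition lim_map :: "('o, 'r) cat \<Rightarrow> ('o \<Rightarrow> 'a \<Rightarrow> 'b) \<Rightarrow> ('o \<Rightarrow> 'a) \<Rightarrow> ('o \<Rightarrow> 'b)" where
  "lim_map C \<eta> x = (\<lambda>a\<in>obj C. \<eta> a (x a))"

text \<open>For a subcategory \<open>D\<close> of \<open>C\<close>, the canonical map from the limit over \<open>C\<close> to the limit over \<open>D\<close>.\<close>

definition lim_restrict :: "('o, 'r) cat \<Rightarrow> ('o \<Rightarrow> 'a) \<Rightarrow> ('o \<Rightarrow> 'a)" where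
  "lim_restrict D x = restrict x (obj D)"

definition injective_cmodule :: "('o, 'r) cat \<Rightarrow> ('o, 'r, 'u) cmod \<Rightarrow> bool" where
  "injective_cmodule C I \<longleftrightarrow> cmodule C I \<and>
     (\<forall>(A :: ('o, 'r, 'u) cmod) (B :: ('o, 'r, 'u) cmod) \<iota> \<phi>.
        cmodule C A \<and> cmodule C B \<and> \<iota> \<in> cmod_hom C A B \<and>
        (\<forall>a\<in>obj C. inj_on (\<iota> a) (carrier (val A a))) \<and> \<phi> \<in> cmod_hom C A I \<longrightarrow>
        (\<exists>\<psi>\<in>cmod_hom C B I. \<forall>a\<in>obj C. \<forall>x\<in>carrier (val A a). \<psi> a (\<iota> a x) = \<phi> a x))"

text \<open>
  In HOL the category of modules has to be cut down to abelian groups whose carriers live in some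
  type. The type \<open>('o, 'r, 'a) univ\<close> below is a universe in which this makes no difference when
  taking derived functors of a module with values in \<open>'a\<close>. Apart from the trivial case that \<open>'a\<close>
  has only one element (all modules then vanish), its cardinality \<open>u\<close> is infinite
  and satisfies \<open>u = u ^ (aleph_0 * card 'o * card 'r)\<close>. Hence:

  \<^item> all submodules of the free modules on representable functors occur in it, up to isomorphism,
    so by Baer's criterion the modules in \<^term>\<open>injective_cmodule\<close> are injective with respect to all
    monomorphisms, in whatever type;
  \<^item> every \<open>C\<close>-module with values in it (or in \<open>'a\<close>) embeds in an injective one of the form
    \<open>a \<mapsto> (\<Prod>c\<in>obj C. \<Prod>f\<in>mor C c a. D c)\<close> with \<open>D c\<close> divisible, which again has values in it;
    so every module has an injective resolution in this universe.
\<close>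

type_synonym ('o, 'r, 'a) univ = "nat \<times> 'o \<times> 'r \<Rightarrow> 'a"

record ('o, 'r, 'a) resolution =
  term_at :: "nat \<Rightarrow> ('o, 'r, ('o, 'r, 'a) univ) cmod"
  diff_at :: "nat \<Rightarrow> 'o \<Rightarrow> ('o, 'r, 'a) univ \<Rightarrow> ('o, 'r, 'a) univ"
  augm :: "'o \<Rightarrow> 'a \<Rightarrow> ('o, 'r, 'a) univ"

text \<open>An exact sequence \<open>0 \<rightarrow> \<Phi> \<rightarrow> I\<^sub>0 \<rightarrow> I\<^sub>1 \<rightarrow> \<dots>\<close> with all \<open>I\<^sub>n\<close> injective.\<close>

definition injective_resolution ::
  "('o, 'r) cat \<Rightarrow> ('o, 'r, 'a) cmod \<Rightarrow> ('o, 'r, 'a) resolution \<Rightarrow> bool" where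
  "injective_resolution C \<Phi> R \<longleftrightarrow>
     (\<forall>n. injective_cmodule C (term_at R n)) \<and>
     augm R \<in> cmod_hom C \<Phi> (term_at R 0) \<and>
     (\<forall>n. diff_at R n \<in> cmod_hom C (term_at R n) (term_at R (Suc n))) \<and>
     (\<forall>a\<in>obj C.
        inj_on (augm R a) (carrier (val \<Phi> a)) \<and>
        augm R a ` carrier (val \<Phi> a) =
          kernel (val (term_at R 0) a) (val (term_at R 1) a) (diff_at R 0 a) \<and>
        (\<forall>n. diff_at R n a ` carrier (val (term_at R n) a) =
          kernel (val (term_at R (Suc n)) a) (val (term_at R (Suc (Suc n))) a) (diff_at R (Suc n) a)))"

definition cocycles :: "(nat \<Rightarrow> 'x monoid) \<Rightarrow> (nat \<Rightarrow> 'x \<Rightarrow> 'x) \<Rightarrow> nat \<Rightarrow> 'x set" where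
  "cocycles K d n = kernel (K n) (K (Suc n)) (d n)"

definition coboundaries :: "(nat \<Rightarrow> 'x monoid) \<Rightarrow> (nat \<Rightarrow> 'x \<Rightarrow> 'x) \<Rightarrow> nat \<Rightarrow> 'x set" where
  "coboundaries K d n = (case n of 0 \<Rightarrow> {\<one>\<^bsub>K 0\<^esub>} | Suc m \<Rightarrow> d m ` carrier (K m))"

definition cohomology :: "(nat \<Rightarrow> 'x monoid) \<Rightarrow> (nat \<Rightarrow> 'x \<Rightarrow> 'x) \<Rightarrow> nat \<Rightarrow> 'x set monoid" where
  "cohomology K d n = (K n)\<lparr>carrier := cocycles K d n\<rparr> Mod coboundaries K d n"

text \<open>
  The map induced by a cochain map \<open>f\<close> into \<open>(L, e)\<close>: the class \<open>c\<close> of a cocycle \<open>x\<close> goes to the class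
  of \<open>f n x\<close>. All members of the union coincide.
\<close>

definition cohomology_map ::
  "(nat \<Rightarrow> 'y monoid) \<Rightarrow> (nat \<Rightarrow> 'y \<Rightarrow> 'y) \<Rightarrow> (nat \<Rightarrow> 'x \<Rightarrow> 'y) \<Rightarrow> nat \<Rightarrow> 'x set \<Rightarrow> 'y set" where
  "cohomology_map L e f n c = (\<Union>x\<in>c. coboundaries L e n #>\<^bsub>L n\<^esub> f n x)"

text \<open>
  The \<open>n\<close>-th right derived functor of the inverse limit over \<open>C\<close>, computed from the injective
  resolution \<open>R\<close>.
\<close>

abbreviation lim_terms ::
  "('o, 'r) cat \<Rightarrow> ('o, 'r, 'a) resolution \<Rightarrow> nat \<Rightarrow> ('o \<Rightarrow> ('o, 'r, 'a) univ) monoid" where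
  "lim_terms C R \<equiv> \<lambda>n. cat_lim C (term_at R n)"

abbreviation lim_diffs ::
  "('o, 'r) cat \<Rightarrow> ('o, 'r, 'a) resolution \<Rightarrow> nat \<Rightarrow> ('o \<Rightarrow> ('o, 'r, 'a) univ) \<Rightarrow> ('o \<Rightarrow> ('o, 'r, 'a) univ)" where
  "lim_diffs C R \<equiv> \<lambda>n. lim_map C (diff_at R n)"

definition higher_lim ::
  "('o, 'r) cat \<Rightarrow> ('o, 'r, 'a) resolution \<Rightarrow> nat \<Rightarrow> ('o \<Rightarrow> ('o, 'r, 'a) univ) set monoid" where
  "higher_lim C R n = cohomology (lim_terms C R) (lim_diffs C R) n"

text \<open>
  Let \<open>D\<close> be a full subcategory of \<open>C\<close>, let \<open>R\<close> and \<open>S\<close> be resolutions of \<open>\<Phi>\<close> over \<open>C\<close> and of its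
  restriction over \<open>D\<close>. A comparison is a cochain map over \<open>D\<close> from the restriction of
  \<open>R\<close> to \<open>S\<close> that lifts the identity of \<open>\<Phi>\<close>. It exists when \<open>S\<close> is injective, and is
  unique up to homotopy.
\<close>

definition comparison ::
  "('o, 'r) cat \<Rightarrow> ('o, 'r, 'a) cmod \<Rightarrow> ('o, 'r, 'a) resolution \<Rightarrow> ('o, 'r, 'a) resolution \<Rightarrow>
   (nat \<Rightarrow> 'o \<Rightarrow> ('o, 'r, 'a) univ \<Rightarrow> ('o, 'r, 'a) univ) \<Rightarrow> bool" where
  "comparison D \<Phi> R S \<theta> \<longleftrightarrow>
     (\<forall>n. \<theta> n \<in> cmod_hom D (term_at R n) (term_at S n)) \<and>
     (\<forall>a\<in>obj D. \<forall>x\<in>carrier (val \<Phi> a). \<theta> 0 a (augm R a x) = augm S a x) \<and>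
     (\<forall>n. \<forall>a\<in>obj D. \<forall>x\<in>carrier (val (term_at R n) a).
        \<theta> (Suc n) a (diff_at R n a x) = diff_at S n a (\<theta> n a x))"

text \<open>
  The homomorphism of higher limits induced by restriction to \<open>D\<close>: on cochains, it is the composite
  of the restriction from the limit over \<open>C\<close> to the limit over \<open>D\<close> of the \<open>n\<close>-th term
  of \<open>R\<close> and the limit of \<open>\<theta> n\<close>. On cohomology it does not depend on \<open>\<theta>\<close>.
\<close>

definition restriction_hom ::
  "('o, 'r) cat \<Rightarrow> ('o, 'r, 'a) resolution \<Rightarrow>
   (nat \<Rightarrow> 'o \<Rightarrow> ('o, 'r, 'a) univ \<Rightarrow> ('o, 'r, 'a) univ) \<Rightarrow>
   nat \<Rightarrow> ('o \<Rightarrow> ('o, 'r, 'a) univ) set \<Rightarrow> ('o \<Rightarrow> ('o, 'r, 'a) univ) set" where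
  "restriction_hom D S \<theta> n =
     cohomology_map (lim_terms D S) (lim_diffs D S) (\<lambda>n. lim_map D (\<theta> n) \<circ> lim_restrict D) n"


section \<open>Subgroups\<close>

definition locally_finite :: "('g, 'b) monoid_scheme \<Rightarrow> bool" where
  "locally_finite G \<longleftrightarrow> (\<forall>S\<subseteq>carrier G. finite S \<longrightarrow> finite (generate G S))"

definition p_group :: "nat \<Rightarrow> ('g, 'b) monoid_scheme \<Rightarrow> bool" where
  "p_group p G \<longleftrightarrow> group G \<and> (\<forall>x\<in>carrier G. \<exists>k. group.ord G x = p ^ k)"

definition p_subgroups :: "nat \<Rightarrow> ('g, 'b) monoid_scheme \<Rightarrow> 'g set set" where
  "p_subgroups p G = {P. subgroup P G \<and> p_group p (G\<lparr>carrier := P\<rparr>)}"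

definition finite_p_subgroups :: "nat \<Rightarrow> ('g, 'b) monoid_scheme \<Rightarrow> 'g set set" where
  "finite_p_subgroups p G = {P \<in> p_subgroups p G. finite P}"


section \<open>Orbit categories\<close>

text \<open>
  The composite of \<open>K g : H \<rightarrow> K\<close> and \<open>L x : K \<rightarrow> L\<close> is the product of the two cosets, which is \<open>L x g\<close>,
  see lemma \<open>orbit_comp\<close>.
\<close>

definition orbit_cat :: "('g, 'b) monoid_scheme \<Rightarrow> ('g set, 'g set) cat" where
  "orbit_cat G = \<lparr>
     obj = {H. subgroup H G},
     mor = (\<lambda>H K. {K #>\<^bsub>G\<^esub> g | g. g \<in> carrier G \<and> (\<lambda>h. g \<otimes>\<^bsub>G\<^esub> h \<otimes>\<^bsub>G\<^esub> inv\<^bsub>G\<^esub> g) ` H \<subseteq> K}),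
     idt = (\<lambda>H. H #>\<^bsub>G\<^esub> \<one>\<^bsub>G\<^esub>),
     cmp = (\<lambda>H K L \<beta> \<alpha>. \<beta> <#>\<^bsub>G\<^esub> \<alpha>)\<rparr>"

definition orbit_cat_p :: "nat \<Rightarrow> ('g, 'b) monoid_scheme \<Rightarrow> ('g set, 'g set) cat" where
  "orbit_cat_p p G = full_subcat (orbit_cat G) (p_subgroups p G)"

definition orbit_cat_pf :: "nat \<Rightarrow> ('g, 'b) monoid_scheme \<Rightarrow> ('g set, 'g set) cat" where
  "orbit_cat_pf p G = full_subcat (orbit_cat G) (finite_p_subgroups p G)"

locale ZG_module = group G + M: comm_group M
  for G :: "('g, 'b) monoid_scheme" (structure) and M :: "'m monoid" +
  fixes act :: "'g \<Rightarrow> 'm \<Rightarrow> 'm"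
  assumes act_hom: "g \<in> carrier G \<Longrightarrow> act g \<in> hom M M"
    and act_one: "x \<in> carrier M \<Longrightarrow> act \<one> x = x"
    and act_mult: "\<lbrakk>g \<in> carrier G; h \<in> carrier G; x \<in> carrier M\<rbrakk> \<Longrightarrow> act (g \<otimes> h) x = act g (act h x)"

text \<open>An automorphism of the trivial subgroup is a coset \<open>{g}\<close>, whence \<^const>\<open>the_elem\<close>.\<close>

definition atomic_functor ::
  "('g, 'b) monoid_scheme \<Rightarrow> 'm monoid \<Rightarrow> ('g \<Rightarrow> 'm \<Rightarrow> 'm) \<Rightarrow> ('g set, 'g set, 'm) cmod" where
  "atomic_functor G M act = \<lparr>
     val = (\<lambda>P. if P = {\<one>\<^bsub>G\<^esub>} then M else M\<lparr>carrier := {\<one>\<^bsub>M\<^esub>}\<rparr>),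
     arr = (\<lambda>P Q \<alpha>. if P = {\<one>\<^bsub>G\<^esub>} \<and> Q = {\<one>\<^bsub>G\<^esub>} then act (inv\<^bsub>G\<^esub> (the_elem \<alpha>)) else (\<lambda>_. \<one>\<^bsub>M\<^esub>))\<rparr>"


section \<open>Well-definedness\<close>

lemma (in group) orbit_comp:
  assumes K: "subgroup K G" and L: "subgroup L G"
    and x: "x \<in> carrier G" "(\<lambda>k. x \<otimes> k \<otimes> inv x) ` K \<subseteq> L" and g: "g \<in> carrier G"
  shows "(L #> x) <#> (K #> g) = L #> (x \<otimes> g)"
proof (rule equalityI; rule subsetI)
  note Kc = subgroup.mem_carrier[OF K] and Lc = subgroup.mem_carrier[OF L]
  fix z assume "z \<in> (L #> x) <#> (K #> g)"
  then obtain l k where lk: "l \<in> L" "k \<in> K" "z = (l \<otimes> x) \<otimes> (k \<otimes> g)"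
    by (auto simp: set_mult_def r_coset_def)
  have "inv x \<otimes> (x \<otimes> g) = g" using x(1) g by (simp add: m_assoc[symmetric])
  then have "z = (l \<otimes> (x \<otimes> k \<otimes> inv x)) \<otimes> (x \<otimes> g)"
    using lk x(1) g Kc[OF lk(2)] Lc[OF lk(1)] by (simp add: m_assoc)
  moreover have "l \<otimes> (x \<otimes> k \<otimes> inv x) \<in> L"
    by (rule subgroup.m_closed[OF L lk(1)]) (use x(2) lk(2) in blast)
  ultimately show "z \<in> L #> (x \<otimes> g)" by (auto simp: r_coset_def)
next
  note Lc = subgroup.mem_carrier[OF L]
  fix z assume "z \<in> L #> (x \<otimes> g)"
  then obtain l where l: "l \<in> L" "z = l \<otimes> (x \<otimes> g)" by (auto simp: r_coset_def)
  have "z = (l \<otimes> x) \<otimes> (\<one> \<otimes> g)" using l x(1) g Lc[OF l(1)] by (simp add: m_assoc)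
  then show "z \<in> (L #> x) <#> (K #> g)"
    using l(1) subgroup.one_closed[OF K] unfolding set_mult_def r_coset_def by blast
qed

lemma (in group) orbit_conj_mult:
  assumes H: "subgroup H G" and x: "x \<in> carrier G" "(\<lambda>k. x \<otimes> k \<otimes> inv x) ` K \<subseteq> L"
    and g: "g \<in> carrier G" "(\<lambda>h. g \<otimes> h \<otimes> inv g) ` H \<subseteq> K"
  shows "(\<lambda>h. (x \<otimes> g) \<otimes> h \<otimes> inv (x \<otimes> g)) ` H \<subseteq> L"
proof
  fix y assume "y \<in> (\<lambda>h. (x \<otimes> g) \<otimes> h \<otimes> inv (x \<otimes> g)) ` H"
  then obtain h where h: "h \<in> H" "y = (x \<otimes> g) \<otimes> h \<otimes> inv (x \<otimes> g)" by auto
  have "y = x \<otimes> (g \<otimes> h \<otimes> inv g) \<otimes> inv x"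
    using h x(1) g(1) subgroup.mem_carrier[OF H h(1)] by (simp add: m_assoc inv_mult_group)
  then show "y \<in> L" using h(1) x(2) g(2) by auto
qed

lemma (in group) small_category_orbit:
  assumes S: "\<And>H. H \<in> S \<Longrightarrow> subgroup H G"
  shows "small_category (full_subcat (orbit_cat G) S)"
proof -
  let ?C = "full_subcat (orbit_cat G) S"
  have ob: "obj ?C = S" and cm: "\<And>H K L \<beta> \<alpha>. cmp ?C H K L \<beta> \<alpha> = \<beta> <#> \<alpha>"
    and idn: "\<And>H. idt ?C H = H #> \<one>"
    and mr: "\<And>H K. mor ?C H K =
      {K #> g | g. g \<in> carrier G \<and> (\<lambda>h. g \<otimes> h \<otimes> inv g) ` H \<subseteq> K}"
    by (simp_all add: full_subcat_def orbit_cat_def)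
  have morE: "\<exists>g. \<alpha> = K #> g \<and> g \<in> carrier G \<and> (\<lambda>h. g \<otimes> h \<otimes> inv g) ` H \<subseteq> K"
    if hyp: "\<alpha> \<in> mor ?C H K" for H K \<alpha>
    using hyp unfolding mr by blast
  have triv: "(\<lambda>h. \<one> \<otimes> h \<otimes> inv \<one>) ` H \<subseteq> H" if hyp: "H \<in> S" for H
    using subgroup.mem_carrier[OF S[OF hyp]] by auto
  have 1: "idt ?C H \<in> mor ?C H H" if hyp: "H \<in> S" for H
    unfolding idn mr using triv[OF hyp] one_closed by blast
  have 2: "cmp ?C H K L \<beta> \<alpha> \<in> mor ?C H L"
    if hyp: "H \<in> S" "K \<in> S" "L \<in> S" "\<alpha> \<in> mor ?C H K" "\<beta> \<in> mor ?C K L" for H K L \<alpha> \<beta>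
  proof -
    obtain g where g: "\<alpha> = K #> g" "g \<in> carrier G" "(\<lambda>h. g \<otimes> h \<otimes> inv g) ` H \<subseteq> K"
      using morE[OF hyp(4)] by blast
    obtain x where x: "\<beta> = L #> x" "x \<in> carrier G" "(\<lambda>h. x \<otimes> h \<otimes> inv x) ` K \<subseteq> L"
      using morE[OF hyp(5)] by blast
    have "\<beta> <#> \<alpha> = L #> (x \<otimes> g)"
      unfolding g(1) x(1) by (rule orbit_comp[OF S[OF hyp(2)] S[OF hyp(3)] x(2,3) g(2)])
    then show ?thesis
      unfolding cm mr using orbit_conj_mult[OF S[OF hyp(1)] x(2,3) g(2,3)] m_closed[OF x(2) g(2)]
      by blast
  qed
  have 3: "cmp ?C H H K \<alpha> (idt ?C H) = \<alpha> \<and> cmp ?C H K K (idt ?C K) \<alpha> = \<alpha>"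
    if hyp: "H \<in> S" "K \<in> S" "\<alpha> \<in> mor ?C H K" for H K \<alpha>
  proof -
    obtain g where g: "\<alpha> = K #> g" "g \<in> carrier G" "(\<lambda>h. g \<otimes> h \<otimes> inv g) ` H \<subseteq> K"
      using morE[OF hyp(3)] by blast
    have "(K #> g) <#> (H #> \<one>) = K #> (g \<otimes> \<one>)"
      by (rule orbit_comp[OF S[OF hyp(1)] S[OF hyp(2)] g(2,3) one_closed])
    moreover have "(K #> \<one>) <#> (K #> g) = K #> (\<one> \<otimes> g)"
      by (rule orbit_comp[OF S[OF hyp(2)] S[OF hyp(2)] one_closed triv[OF hyp(2)] g(2)])
    ultimately show ?thesis unfolding cm idn g(1) using g(2) by simp
  qed
  have sub: "\<alpha> \<subseteq> carrier G" if hyp: "K \<in> S" "\<alpha> \<in> mor ?C H K" for H K \<alpha>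
  proof -
    obtain g where "\<alpha> = K #> g" "g \<in> carrier G" using morE[OF hyp(2)] by blast
    then show ?thesis using r_coset_subset_G[OF subgroup.subset[OF S[OF hyp(1)]]] by simp
  qed
  have 4: "cmp ?C H K N (cmp ?C K L N \<gamma> \<beta>) \<alpha> = cmp ?C H L N \<gamma> (cmp ?C H K L \<beta> \<alpha>)"
    if hyp: "K \<in> S" "L \<in> S" "N \<in> S" "\<alpha> \<in> mor ?C H K" "\<beta> \<in> mor ?C K L" "\<gamma> \<in> mor ?C L N"
    for H K L N \<alpha> \<beta> \<gamma>
    unfolding cm by (rule set_mult_assoc[OF sub[OF hyp(3,6)] sub[OF hyp(2,5)] sub[OF hyp(1,4)]])
  show ?thesis unfolding small_category_def ob
    by (intro conjI ballI) (rule 1 2 3[THEN conjunct1] 3[THEN conjunct2] 4; assumption)+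
qed

lemma (in group) p_subgroup_D:
  "P \<in> p_subgroups p G \<Longrightarrow> subgroup P G" "P \<in> finite_p_subgroups p G \<Longrightarrow> subgroup P G"
  by (simp_all add: p_subgroups_def finite_p_subgroups_def)

lemma (in group) small_category_orbit_p: "small_category (orbit_cat_p p G)"
  and small_category_orbit_pf: "small_category (orbit_cat_pf p G)"
  unfolding orbit_cat_p_def orbit_cat_pf_def
  by (rule small_category_orbit, erule p_subgroup_D)+

lemma (in ZG_module) cmodule_atomic_functor:
  assumes S: "\<And>H. H \<in> S \<Longrightarrow> subgroup H G"
  shows "cmodule (full_subcat (orbit_cat G) S) (atomic_functor G M act)"
proof -
  let ?C = "full_subcat (orbit_cat G) S" and ?F = "atomic_functor G M act" and ?T = "{\<one>}"
  have ob: "obj ?C = S" and cm: "\<And>H K L \<beta> \<alpha>. cmp ?C H K L \<beta> \<alpha> = \<beta> <#> \<alpha>"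
    and idn: "\<And>H. idt ?C H = H #> \<one>"
    by (simp_all add: full_subcat_def orbit_cat_def)
  have morE: "\<exists>g. \<alpha> = K #> g \<and> g \<in> carrier G \<and> (\<lambda>h. g \<otimes> h \<otimes> inv g) ` H \<subseteq> K"
    if hyp: "\<alpha> \<in> mor ?C H K" for H K \<alpha>
    using hyp unfolding full_subcat_def orbit_cat_def by simp
  have T: "?T #> g = {g}" if "g \<in> carrier G" for g
    using that by (simp add: r_coset_def)
  have dom: "H = ?T" if hyp: "H \<in> S" "\<alpha> \<in> mor ?C H ?T" for H \<alpha>
  proof -
    obtain g where g: "g \<in> carrier G" "(\<lambda>h. g \<otimes> h \<otimes> inv g) ` H \<subseteq> ?T"
      using morE[OF hyp(2)] by blast
    have "h = \<one>" if h: "h \<in> H" for h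
    proof -
      have hc: "h \<in> carrier G" using h by (rule subgroup.mem_carrier[OF S[OF hyp(1)]])
      have "g \<otimes> h \<otimes> inv g = \<one>" using g(2) h by blast
      then have "g \<otimes> h = g" using g(1) hc by (simp add: inv_solve_right')
      then show ?thesis using g(1) hc by simp
    qed
    then show ?thesis using subgroup.one_closed[OF S[OF hyp(1)]] by blast
  qed
  have aut: "\<exists>g\<in>carrier G. \<alpha> = {g}" if "\<alpha> \<in> mor ?C H ?T" for H \<alpha>
    using morE[OF that] T by blast
  have triv: "comm_group (M\<lparr>carrier := {\<one>\<^bsub>M\<^esub>}\<rparr>)"
    by (rule comm_groupI) auto
  have 1: "comm_group (val ?F H)" for H
    using triv M.comm_group_axioms by (simp add: atomic_functor_def)
  have 2: "arr ?F H K \<alpha> \<in> hom (val ?F K) (val ?F H)" if "\<alpha> \<in> mor ?C H K" for H K \<alpha>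
  proof (cases "H = ?T \<and> K = ?T")
    case True
    then obtain g where "g \<in> carrier G" "\<alpha> = {g}" using aut \<open>\<alpha> \<in> mor ?C H K\<close> by blast
    then show ?thesis using True act_hom[OF inv_closed] by (simp add: atomic_functor_def)
  next
    case False
    then show ?thesis by (auto simp: atomic_functor_def hom_def)
  qed
  have 3: "arr ?F H H (idt ?C H) x = x" if "x \<in> carrier (val ?F H)" for H x
    using that act_one T[of "\<one>"] unfolding idn
    by (auto simp: atomic_functor_def split: if_splits)
  have 4: "arr ?F H L (cmp ?C H K L \<beta> \<alpha>) x = arr ?F H K \<alpha> (arr ?F K L \<beta> x)"
    if hyp: "H \<in> S" "K \<in> S" "L \<in> S" "\<alpha> \<in> mor ?C H K" "\<beta> \<in> mor ?C K L"
      "x \<in> carrier (val ?F L)" for H K L \<alpha> \<beta> x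
  proof (cases "L = ?T")
    case True
    have K: "K = ?T" using dom hyp(2,5) True by blast
    have H: "H = ?T" using dom hyp(1,4) K by blast
    obtain g where g: "g \<in> carrier G" "\<alpha> = {g}" using aut hyp(4) K by blast
    obtain h where h: "h \<in> carrier G" "\<beta> = {h}" using aut hyp(5) True by blast
    have "\<beta> <#> \<alpha> = {h \<otimes> g}" by (simp add: g h set_mult_def)
    moreover have "x \<in> carrier M" using hyp(6) True by (simp add: atomic_functor_def)
    ultimately show ?thesis using g h
      by (simp add: cm H K True atomic_functor_def inv_mult_group act_mult)
  next
    case False
    have "arr ?F H K \<alpha> \<one>\<^bsub>M\<^esub> = \<one>\<^bsub>M\<^esub>"
      using aut[of \<alpha> H] hyp(4) hom_one[OF act_hom[OF inv_closed] M.is_group M.is_group]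
      by (auto simp: atomic_functor_def)
    then show ?thesis using False by (simp add: atomic_functor_def)
  qed
  show ?thesis unfolding cmodule_def ob
    by (intro conjI ballI) (rule 1 2 3 4; assumption)+
qed

corollary (in ZG_module) cmodule_atomic_functor_p:
    "cmodule (orbit_cat_p p G) (atomic_functor G M act)"
  and cmodule_atomic_functor_pf:
    "cmodule (orbit_cat_pf p G) (atomic_functor G M act)"
  unfolding orbit_cat_p_def orbit_cat_pf_def
  by (rule cmodule_atomic_functor, erule p_subgroup_D)+

end

theory Submission
  imports Defs "HOL-Library.Sublist"
begin

text \<open>
  Write \<open>D \<subseteq> C\<close> for the orbit categories on the finite and on all \<open>p\<close>-subgroups. A subgroup conjugate
  into a finite one is finite, so \<open>D\<close> is a sieve in \<open>C\<close>; hence extension by zero is an exact left adjoint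
  of restriction, and an injective resolution \<open>R\<close> of \<open>F\<^sub>M\<close> restricts to one over \<open>D\<close>. It remains to see
  that the kernel of the surjection \<open>lim\<^sub>C R \<rightarrow> lim\<^sub>D R\<close> is exact. This kernel is the limit of the modules
  \<open>K\<^sub>n(P) = {x \<in> R\<^sub>n(P). x restricts to 0 on all finite subgroups}\<close>, and as a map into \<open>R\<^sub>n\<close> from a
  module vanishing on \<open>D\<close> has values in \<open>K\<^sub>n\<close>, it suffices that \<open>K(P)\<close> is exact for each infinite \<open>P\<close>.

  By local finiteness \<open>P\<close> is the directed union of its nontrivial finite subgroups \<open>Q\<close>, and \<open>K(P)\<close> is the
  kernel of the surjection from \<open>R(P)\<close>, which is exact, onto \<open>lim\<^sub>Q R(Q)\<close>. Each \<open>R(Q)\<close> is exact because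
  \<open>F\<^sub>M(Q) = 0\<close>. So is their limit, as one sees from the double complex of cochains on chains of
  such subgroups: its other direction is exact because every injective module is a
  retract of a product of modules \<open>a \<mapsto> Map(Mor(c, a), B)\<close>, for which the assertion is that the
  nerve of a directed preorder is acyclic.
\<close>

section \<open>Alternating sums over chains in a directed preorder\<close>

text \<open>What helps is that the diagram of the groups \<open>R\<^sub>n(Q)\<close> comes from an
  injective module on the whole category, which makes it acyclic for the limit. For a single
  \<open>c\<close> the relevant preorder consists of the pairs of a subgroup \<open>Q\<close> and an
  arrow from \<open>c\<close> to \<open>Q\<close>. It is only a disjoint union of directed pieces,
  because two arrows from \<open>c\<close> need not become equal further up. So the rows are exact
  from two vertices on, and the kernel at one vertex is the limit. Surjectivity of the map from
  \<open>R(P)\<close> to the limit rests on a second finiteness property: two arrows into subgroups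
  \<open>Q\<close> that agree in \<open>P\<close> already agree in some finite subgroup. The trivial
  subgroup is left out because \<open>F\<^sub>M\<close> has the value \<open>M\<close> there, so
  that \<open>R\<close> need not be exact in degree 0; as \<open>P\<close> is infinite, the
  remaining subgroups are still cofinal.\<close>

abbreviation m_diff :: "('a, 'b) monoid_scheme \<Rightarrow> 'a \<Rightarrow> 'a \<Rightarrow> 'a" (infixl \<open>\<div>\<index>\<close> 70) where
  "x \<div>\<^bsub>G\<^esub> y \<equiv> x \<otimes>\<^bsub>G\<^esub> inv\<^bsub>G\<^esub> y"

text \<open>
  The alternating sum over the faces of a simplex, including the empty face of a vertex. The
  vertices of a chain are listed from the largest to the smallest, so that \<open>e # \<sigma>\<close> is a cone.
\<close>

primrec alt :: "('a, 'b) monoid_scheme \<Rightarrow> ('e list \<Rightarrow> 'a) \<Rightarrow> 'e list \<Rightarrow> 'a" where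
  "alt B x [] = \<one>\<^bsub>B\<^esub>"
| "alt B x (e # \<sigma>) = x \<sigma> \<div>\<^bsub>B\<^esub> alt B (\<lambda>\<tau>. x (e # \<tau>)) \<sigma>"

text \<open>These are the lists at which \<open>alt\<close> evaluates its argument. The relation
  serves to state hypotheses; the signs come from the recursion of \<open>alt\<close>. Vertices may
  repeat.\<close>

definition face :: "'e list \<Rightarrow> 'e list \<Rightarrow> bool" where
  "face \<tau> \<sigma> \<longleftrightarrow> subseq \<tau> \<sigma> \<and> length \<sigma> = Suc (length \<tau>)"

lemma face_Nil [simp]: "\<not> face \<tau> []"
  by (simp add: face_def)

lemma face_tl: "face \<sigma> (e # \<sigma>)"
  by (auto simp: face_def)

lemma face_Cons: "face \<tau> \<sigma> \<Longrightarrow> face (e # \<tau>) (e # \<sigma>)"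
  by (auto simp: face_def)

lemma alt_cong: "(\<And>\<tau>. face \<tau> \<sigma> \<Longrightarrow> x \<tau> = y \<tau>) \<Longrightarrow> alt B x \<sigma> = alt B y \<sigma>"
proof (induction \<sigma> arbitrary: x y)
  case (Cons e \<sigma>)
  have "alt B (\<lambda>\<tau>. x (e # \<tau>)) \<sigma> = alt B (\<lambda>\<tau>. y (e # \<tau>)) \<sigma>"
    by (rule Cons.IH) (rule Cons.prems[OF face_Cons])
  then show ?case using Cons.prems[OF face_tl] by simp
qed simp

lemma alt_map: "alt B (\<lambda>\<tau>. y (map g \<tau>)) \<sigma> = alt B y (map g \<sigma>)"
proof (induction \<sigma> arbitrary: y)
  case (Cons e \<sigma>)
  show ?case using Cons[of "\<lambda>\<tau>. y (g e # \<tau>)"] by simp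
qed simp

context comm_group begin

lemma alt_closed [simp]: "(\<And>\<tau>. face \<tau> \<sigma> \<Longrightarrow> x \<tau> \<in> carrier G) \<Longrightarrow> alt G x \<sigma> \<in> carrier G"
proof (induction \<sigma> arbitrary: x)
  case (Cons e \<sigma>)
  have "alt G (\<lambda>\<tau>. x (e # \<tau>)) \<sigma> \<in> carrier G"
    by (rule Cons.IH) (rule Cons.prems[OF face_Cons])
  then show ?case using Cons.prems[OF face_tl] by simp
qed simp

lemma alt_one: "(\<And>\<tau>. face \<tau> \<sigma> \<Longrightarrow> x \<tau> = \<one>) \<Longrightarrow> alt G x \<sigma> = \<one>"
proof (induction \<sigma> arbitrary: x)
  case (Cons e \<sigma>)
  have "alt G (\<lambda>\<tau>. x (e # \<tau>)) \<sigma> = \<one>"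
    by (rule Cons.IH) (rule Cons.prems[OF face_Cons])
  then show ?case using Cons.prems[OF face_tl] by simp
qed simp

lemma m_inv_diff:
  assumes "a \<in> carrier G" "b \<in> carrier G" "c \<in> carrier G" "d \<in> carrier G"
  shows "(a \<otimes> inv b) \<otimes> inv (c \<otimes> inv d) = (a \<otimes> inv c) \<otimes> inv (b \<otimes> inv d)"
  using assms by (simp add: inv_mult m_ac)

lemma alt_diff:
  assumes "\<And>\<tau>. face \<tau> \<sigma> \<Longrightarrow> x \<tau> \<in> carrier G" "\<And>\<tau>. face \<tau> \<sigma> \<Longrightarrow> y \<tau> \<in> carrier G"
  shows "alt G (\<lambda>\<tau>. x \<tau> \<otimes> inv y \<tau>) \<sigma> = alt G x \<sigma> \<otimes> inv alt G y \<sigma>"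
  using assms
proof (induction \<sigma> arbitrary: x y)
  case (Cons e \<sigma>)
  have IH: "alt G (\<lambda>\<tau>. x (e # \<tau>) \<otimes> inv y (e # \<tau>)) \<sigma>
      = alt G (\<lambda>\<tau>. x (e # \<tau>)) \<sigma> \<otimes> inv alt G (\<lambda>\<tau>. y (e # \<tau>)) \<sigma>"
    by (rule Cons.IH) (rule Cons.prems[OF face_Cons], assumption)+
  have "alt G (\<lambda>\<tau>. x (e # \<tau>)) \<sigma> \<in> carrier G" "alt G (\<lambda>\<tau>. y (e # \<tau>)) \<sigma> \<in> carrier G"
    by (rule alt_closed, rule Cons.prems[OF face_Cons], assumption)+
  then show ?case unfolding alt.simps IH by (intro m_inv_diff Cons.prems face_tl)
qed simp

lemma alt_hom:
  assumes "h \<in> hom G H" "comm_group H" "\<And>\<tau>. face \<tau> \<sigma> \<Longrightarrow> x \<tau> \<in> carrier G"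
  shows "h (alt G x \<sigma>) = alt H (\<lambda>\<tau>. h (x \<tau>)) \<sigma>"
proof -
  interpret H: comm_group H by fact
  interpret h: group_hom G H h
    using assms(1) by (simp add: group_hom_def group_hom_axioms_def H.is_group is_group)
  show ?thesis using assms(3)
  proof (induction \<sigma> arbitrary: x)
    case (Cons e \<sigma>)
    have "h (alt G (\<lambda>\<tau>. x (e # \<tau>)) \<sigma>) = alt H (\<lambda>\<tau>. h (x (e # \<tau>))) \<sigma>"
      by (rule Cons.IH) (rule Cons.prems[OF face_Cons])
    moreover have "alt G (\<lambda>\<tau>. x (e # \<tau>)) \<sigma> \<in> carrier G"
      by (rule alt_closed) (rule Cons.prems[OF face_Cons])
    ultimately show ?case using Cons.prems[OF face_tl] by simp
  qed simp
qed

text \<open>Induction on the first vertex \<open>e\<close>, in additive terms: with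
  \<open>y \<tau> = x (e # \<tau>)\<close>, the family \<open>alt G x\<close> has the value
  \<open>x \<tau> - alt G y \<tau>\<close> at \<open>e # \<tau>\<close>. Summed over the faces of
  \<open>\<sigma>\<close>, the second term gives a double sum for \<open>y\<close>, trivial by
  induction, and the first gives \<open>alt G x \<sigma>\<close>, which cancels against the
  contribution of the face \<open>\<sigma>\<close> itself.\<close>

lemma alt_alt:
  assumes "\<And>\<rho>. subseq \<rho> \<sigma> \<Longrightarrow> x \<rho> \<in> carrier G"
  shows "alt G (alt G x) \<sigma> = \<one>"
  using assms
proof (induction \<sigma> arbitrary: x)
  case (Cons e \<sigma>)
  let ?y = "\<lambda>\<tau>. x (e # \<tau>)"
  have cx: "x \<rho> \<in> carrier G" "?y \<rho> \<in> carrier G" if "subseq \<rho> \<sigma>" for \<rho>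
    using Cons.prems that by auto
  have IH: "alt G (alt G ?y) \<sigma> = \<one>"
    by (rule Cons.IH) (rule cx)
  have f: "alt G ?y \<tau> \<in> carrier G" if "subseq \<tau> \<sigma>" for \<tau>
    by (rule alt_closed, rule cx(2)) (use that in \<open>auto simp: face_def intro: subseq_order.trans\<close>)
  have c: "alt G x \<sigma> \<in> carrier G" by (intro alt_closed cx) (simp add: face_def)
  have "alt G (\<lambda>\<tau>. alt G x (e # \<tau>)) \<sigma> = alt G (\<lambda>\<tau>. x \<tau> \<otimes> inv alt G ?y \<tau>) \<sigma>"
    by simp
  also have "\<dots> = alt G x \<sigma> \<otimes> inv alt G (alt G ?y) \<sigma>"
    by (rule alt_diff) (use cx f in \<open>auto simp: face_def\<close>)
  also have "\<dots> = alt G x \<sigma>"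
    using c by (simp add: IH)
  finally have e: "alt G (\<lambda>\<tau>. alt G x (e # \<tau>)) \<sigma> = alt G x \<sigma>" .
  show ?case unfolding alt.simps(2)[of G "alt G x" e \<sigma>] e by (rule r_inv[OF c])
qed simp

end

text \<open>
  The dual of the contraction \<open>h\<close> of the chain complex given by \<open>h(\<sigma>) = v(\<sigma>) # (\<sigma> - h(\<partial>\<sigma>))\<close>; its first
  argument \<open>n\<close> is the length of \<open>\<sigma>\<close>. The homotopy formula below holds for every choice of \<open>v\<close>; only to
  stay inside the complex of chains, \<open>v(\<sigma>)\<close> has to bound all vertices that enter \<open>h(\<partial>\<sigma>)\<close>.
\<close>

primrec cone_op :: "('a, 'b) monoid_scheme \<Rightarrow> ('e list \<Rightarrow> 'e) \<Rightarrow> nat \<Rightarrow> ('e list \<Rightarrow> 'a) \<Rightarrow> 'e list \<Rightarrow> 'a" where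
  "cone_op B v 0 x \<sigma> = x (v \<sigma> # \<sigma>)"
| "cone_op B v (Suc n) x \<sigma> =
     x (v \<sigma> # \<sigma>) \<div>\<^bsub>B\<^esub> alt B (cone_op B v n (\<lambda>\<tau>. x (v \<sigma> # \<tau>))) \<sigma>"

context comm_group begin

lemma cone_op_closed [simp]: "(\<And>\<tau>. x \<tau> \<in> carrier G) \<Longrightarrow> cone_op G v n x \<sigma> \<in> carrier G"
  by (induction n arbitrary: x \<sigma>) simp_all

lemma cone_op_diff:
  assumes "\<And>\<tau>. x \<tau> \<in> carrier G" "\<And>\<tau>. y \<tau> \<in> carrier G"
  shows "cone_op G v n (\<lambda>\<tau>. x \<tau> \<otimes> inv y \<tau>) \<sigma> = cone_op G v n x \<sigma> \<otimes> inv cone_op G v n y \<sigma>"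
  using assms
proof (induction n arbitrary: x y \<sigma>)
  case (Suc n)
  have "cone_op G v n (\<lambda>\<tau>. x (v \<sigma> # \<tau>) \<otimes> inv y (v \<sigma> # \<tau>))
      = (\<lambda>\<tau>. cone_op G v n (\<lambda>\<tau>. x (v \<sigma> # \<tau>)) \<tau> \<otimes> inv cone_op G v n (\<lambda>\<tau>. y (v \<sigma> # \<tau>)) \<tau>)"
    by (rule ext, rule Suc.IH) (rule Suc.prems)+
  then have "alt G (cone_op G v n (\<lambda>\<tau>. x (v \<sigma> # \<tau>) \<otimes> inv y (v \<sigma> # \<tau>))) \<sigma>
      = alt G (cone_op G v n (\<lambda>\<tau>. x (v \<sigma> # \<tau>))) \<sigma> \<otimes> inv alt G (cone_op G v n (\<lambda>\<tau>. y (v \<sigma> # \<tau>))) \<sigma>"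
    using Suc.prems by (simp add: alt_diff)
  then show ?case unfolding cone_op.simps
    by (simp only:) (intro m_inv_diff alt_closed cone_op_closed Suc.prems)
qed simp

text \<open>Induction on the number of vertices. At \<open>v \<sigma> # \<tau>\<close> the family
  \<open>alt G x\<close> is, additively, \<open>x \<tau> - alt G y \<tau>\<close>, where
  \<open>y\<close> is \<open>x\<close> with the fixed apex \<open>v \<sigma>\<close> prefixed. The
  induction hypothesis for \<open>y\<close> at each face \<open>\<tau>\<close> leaves a double
  alternating sum, which is trivial, and the two remaining terms in \<open>y\<close> cancel.\<close>

lemma cone_op_homotopy:
  assumes "\<And>\<tau>. x \<tau> \<in> carrier G" "length \<sigma> = Suc n"
  shows "cone_op G v (Suc n) (alt G x) \<sigma> = x \<sigma> \<otimes> inv alt G (cone_op G v n x) \<sigma>"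
  using assms
proof (induction n arbitrary: x \<sigma>)
  case (Suc n)
  let ?v = "v \<sigma>" and ?y = "\<lambda>\<tau>. x (v \<sigma> # \<tau>)"
  note cx = Suc.prems(1)
  have "cone_op G v (Suc n) (\<lambda>\<tau>. alt G x (?v # \<tau>)) \<tau> = cone_op G v (Suc n) x \<tau> \<otimes> inv (?y \<tau> \<otimes> inv alt G
      (cone_op G v n ?y) \<tau>)"
    if "face \<tau> \<sigma>" for \<tau>
  proof -
    have "cone_op G v (Suc n) (\<lambda>\<tau>. alt G x (?v # \<tau>)) \<tau>
      = cone_op G v (Suc n) x \<tau> \<otimes> inv cone_op G v (Suc n) (alt G ?y) \<tau>"
      using cone_op_diff[of x "alt G ?y" v "Suc n" \<tau>] cx by (simp del: cone_op.simps)
    also have "cone_op G v (Suc n) (alt G ?y) \<tau> = ?y \<tau> \<otimes> inv alt G (cone_op G v n ?y) \<tau>"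
      by (rule Suc.IH) (use that Suc.prems in \<open>auto simp: face_def\<close>)
    finally show ?thesis .
  qed
  then have "alt G (cone_op G v (Suc n) (\<lambda>\<tau>. alt G x (?v # \<tau>))) \<sigma>
     = alt G (\<lambda>\<tau>. cone_op G v (Suc n) x \<tau> \<otimes> inv (?y \<tau> \<otimes> inv alt G (cone_op G v n ?y) \<tau>)) \<sigma>"
    by (rule alt_cong)
  also have "\<dots> = alt G (cone_op G v (Suc n) x) \<sigma> \<otimes>
      inv (alt G ?y \<sigma> \<otimes> inv alt G (alt G (cone_op G v n ?y)) \<sigma>)"
    using cx by (simp add: alt_diff del: cone_op.simps)
  also have "alt G (alt G (cone_op G v n ?y)) \<sigma> = \<one>"
    by (rule alt_alt) (simp add: cx)
  finally have "alt G (cone_op G v (Suc n) (\<lambda>\<tau>. alt G x (?v # \<tau>))) \<sigma>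
     = alt G (cone_op G v (Suc n) x) \<sigma> \<otimes> inv alt G ?y \<sigma>"
    using cx by (simp del: cone_op.simps)
  moreover have "cone_op G v (Suc (Suc n)) (alt G x) \<sigma> = (x \<sigma> \<otimes> inv alt G ?y \<sigma>) \<otimes>
     inv alt G (cone_op G v (Suc n) (\<lambda>\<tau>. alt G x (?v # \<tau>))) \<sigma>"
    by (subst cone_op.simps) simp
  ultimately show ?case using cx
      by (simp add: inv_mult m_ac del: cone_op.simps) (simp add: m_assoc[symmetric] del: cone_op.simps)
next
  case 0
  then obtain e where e: "\<sigma> = [e]" by (cases \<sigma>) auto
  show ?case using 0(1) by (simp add: e inv_mult m_ac)
qed

end

text \<open>Graded by the number of vertices, which is the dimension plus one; \<open>n = 0\<close>
  is the empty simplex and accounts for the augmentation.\<close>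

definition chains :: "('e \<Rightarrow> 'e \<Rightarrow> bool) \<Rightarrow> 'e set \<Rightarrow> nat \<Rightarrow> 'e list set" where
  "chains rel E n = {\<sigma>. set \<sigma> \<subseteq> E \<and> sorted_wrt (\<lambda>a b. rel b a) \<sigma> \<and> length \<sigma> = n}"

section \<open>Contracting the nerve of a directed preorder\<close>

lemma set_subseq: "subseq \<tau> \<sigma> \<Longrightarrow> set \<tau> \<subseteq> set \<sigma>"
  by (induction rule: list_emb.induct) auto

lemma sorted_wrt_subseq: "subseq \<tau> \<sigma> \<Longrightarrow> sorted_wrt P \<sigma> \<Longrightarrow> sorted_wrt P \<tau>"
proof (induction rule: list_emb.induct)
  case (list_emb_Cons2 x y xs ys)
  then show ?case using set_subseq[of xs ys] by auto
qed auto

lemma chains_face: "face \<tau> \<sigma> \<Longrightarrow> \<sigma> \<in> chains rel E (Suc n) \<Longrightarrow> \<tau> \<in> chains rel E n"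
  using set_subseq[of \<tau> \<sigma>] sorted_wrt_subseq[of \<tau> \<sigma> "\<lambda>a b. rel b a"]
  by (auto simp: face_def chains_def)

text \<open>Every list at which the contraction evaluates \<open>x\<close> arises from
  \<open>\<sigma>\<close> by dropping vertices and prefixing apices; monotonicity of
  \<open>v\<close> and transitivity make all of them chains. Triviality of \<open>x\<close> is
  demanded only on chains below \<open>v \<sigma>\<close>, because in this form it is inherited by
  \<open>x\<close> with \<open>v \<sigma>\<close> prefixed: a chain below \<open>v \<tau>\<close> is
  also below \<open>v \<sigma>\<close>, so it stays a chain under that prefix.\<close>

lemma (in comm_group) cone_op_one:
  assumes v: "\<And>\<sigma>. set \<sigma> \<subseteq> E \<Longrightarrow> v \<sigma> \<in> E" "\<And>\<sigma> e. set \<sigma> \<subseteq> E \<Longrightarrow> e \<in> set \<sigma> \<Longrightarrow> rel e (v \<sigma>)"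
    "\<And>\<sigma> \<tau>. set \<sigma> \<subseteq> E \<Longrightarrow> set \<tau> \<subseteq> set \<sigma> \<Longrightarrow> rel (v \<tau>) (v \<sigma>)"
    and trans: "\<And>a b c. \<lbrakk>a \<in> E; b \<in> E; c \<in> E; rel a b; rel b c\<rbrakk> \<Longrightarrow> rel a c"
    and refl: "\<And>a. a \<in> E \<Longrightarrow> rel a a"
    and \<sigma>: "\<sigma> \<in> chains rel E n"
    and x: "\<And>\<tau>. \<tau> \<in> chains rel E (Suc n) \<Longrightarrow> \<forall>e\<in>set \<tau>. rel e (v \<sigma>) \<Longrightarrow> x \<tau> = \<one>"
  shows "cone_op G v n x \<sigma> = \<one>"
  using \<sigma> x
proof (induction n arbitrary: x \<sigma>)
  case 0
  then have s: "\<sigma> = []" by (simp add: chains_def)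
  have "v [] \<in> E" by (rule v(1)) simp
  then have "x [v []] = \<one>" by (intro 0(2)) (simp_all add: chains_def s refl)
  then show ?case by (simp add: s)
next
  case (Suc n)
  have s: "set \<sigma> \<subseteq> E" using Suc.prems(1) by (simp add: chains_def)
  have "v \<sigma> # \<sigma> \<in> chains rel E (Suc (Suc n))"
    using Suc.prems(1) v(1)[OF s] v(2)[OF s] by (simp add: chains_def)
  then have 1: "x (v \<sigma> # \<sigma>) = \<one>"
    by (rule Suc.prems(2)) (simp add: v(1)[OF s] v(2)[OF s] refl)
  have 2: "alt G (cone_op G v n (\<lambda>\<tau>. x (v \<sigma> # \<tau>))) \<sigma> = \<one>"
  proof (rule alt_one)
    fix \<tau> assume f: "face \<tau> \<sigma>"
    have t: "\<tau> \<in> chains rel E n" by (rule chains_face[OF f Suc.prems(1)])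
    have ts: "set \<tau> \<subseteq> set \<sigma>" using f by (auto simp: face_def dest: set_subseq)
    have vt: "v \<tau> \<in> E" "rel (v \<tau>) (v \<sigma>)" using v(1)[of \<tau>] v(3)[OF s ts] ts s by simp_all
    show "cone_op G v n (\<lambda>\<tau>. x (v \<sigma> # \<tau>)) \<tau> = \<one>"
    proof (rule Suc.IH[OF t])
      fix \<rho> assume r: "\<rho> \<in> chains rel E (Suc n)" "\<forall>e\<in>set \<rho>. rel e (v \<tau>)"
      have re: "rel e (v \<sigma>)" if "e \<in> set \<rho>" for e
      proof (rule trans[of e "v \<tau>" "v \<sigma>"])
        show "e \<in> E" using that r(1) by (auto simp: chains_def)
        show "rel e (v \<tau>)" using that r(2) by blast
      qed (rule vt v(1)[OF s])+
      have "v \<sigma> # \<rho> \<in> chains rel E (Suc (Suc n))"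
        using r(1) re v(1)[OF s] by (simp add: chains_def)
      then show "x (v \<sigma> # \<rho>) = \<one>"
        by (rule Suc.prems(2)) (simp add: re v(1)[OF s] refl)
    qed
  qed
  show ?case using 1 2 by simp
qed

text \<open>Upper bounds chosen independently would not be monotone in the set. Recursion along
  strict inclusion repairs this: \<open>u F\<close> is taken above \<open>F\<close> and above the
  finitely many values \<open>u F'\<close> already chosen for \<open>F' \<subset> F\<close>.\<close>

lemma monotone_upper_bounds:
  fixes E :: "'a set"
  assumes dir: "\<And>F. finite F \<Longrightarrow> F \<subseteq> E \<Longrightarrow> \<exists>d\<in>E. \<forall>a\<in>F. rel a d" and refl: "\<And>a. a \<in> E \<Longrightarrow> rel a a"
  shows "\<exists>u. \<forall>F. finite F \<and> F \<subseteq> E \<longrightarrow> u F \<in> E \<and> (\<forall>a\<in>F. rel a (u F)) \<and> (\<forall>F'\<subseteq>F. rel (u F') (u F))"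
proof -
  let ?P = "\<lambda>(u::'a set \<Rightarrow> 'a) F r. finite F \<and> F \<subseteq> E \<longrightarrow> r \<in> E \<and> (\<forall>a\<in>F. rel a r) \<and> (\<forall>F'\<subset>F. rel (u F') r)"
  have "\<exists>u. \<forall>F. ?P u F (u F)"
  proof (rule dependent_wf_choice[OF wf_finite_psubset])
    fix f g :: "'a set \<Rightarrow> 'a" and F r assume "\<And>z. (z, F) \<in> finite_psubset \<Longrightarrow> f z = g z"
    then have "finite F \<Longrightarrow> F' \<subset> F \<Longrightarrow> f F' = g F'" for F' by (auto simp: finite_psubset_def)
    then show "?P f F r = ?P g F r" by auto
  next
    fix F and f :: "'a set \<Rightarrow> 'a" assume IH: "\<And>y. (y, F) \<in> finite_psubset \<Longrightarrow> ?P f y (f y)"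
    show "\<exists>r. ?P f F r"
    proof (cases "finite F \<and> F \<subseteq> E")
      case True
      have "f F' \<in> E" if "F' \<subset> F" for F'
        using IH[of F'] that True by (auto simp: finite_psubset_def intro: finite_subset)
      then have "\<exists>d\<in>E. \<forall>a\<in>F \<union> f ` {F'. F' \<subset> F}. rel a d"
        using True by (intro dir) (auto intro!: finite_imageI intro: finite_subset[of _ "Pow F"])
      then show ?thesis by blast
    qed auto
  qed
  then obtain u where "\<forall>F. ?P u F (u F)" ..
  then have u: "?P u F (u F)" for F by blast
  have le: "rel (u F') (u F)" if "finite F" "F \<subseteq> E" "F' \<subseteq> F" for F F'
    using u[of F] refl[of "u F"] that by (cases "F' = F") auto
  show ?thesis
  proof (intro exI allI impI)
    fix F assume F: "finite F \<and> F \<subseteq> E"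
    then have "u F \<in> E" "\<forall>a\<in>F. rel a (u F)" using u[of F] by simp_all
    then show "u F \<in> E \<and> (\<forall>a\<in>F. rel a (u F)) \<and> (\<forall>F'\<subseteq>F. rel (u F') (u F))"
      using F le by simp
  qed
qed

text \<open>This is \<open>cone_op_homotopy\<close> with the apex \<open>u (set \<sigma>)\<close>:
  the contraction of the trivial family \<open>alt G x\<close> is trivial, which leaves
  \<open>x \<sigma>\<close> as the alternating sum of the contraction of \<open>x\<close>. For
  \<open>n = 0\<close> the empty face is the only one, and the claim is that a cocycle on vertices
  is constant.\<close>

lemma (in comm_group) directed_chains_exact:
  fixes E :: "'e set"
  assumes dir: "\<And>F. finite F \<Longrightarrow> F \<subseteq> E \<Longrightarrow> \<exists>d\<in>E. \<forall>a\<in>F. rel a d"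
    and trans: "\<And>a b c. \<lbrakk>a \<in> E; b \<in> E; c \<in> E; rel a b; rel b c\<rbrakk> \<Longrightarrow> rel a c"
    and refl: "\<And>a. a \<in> E \<Longrightarrow> rel a a"
    and x: "\<And>\<sigma>. x \<sigma> \<in> carrier G" "\<And>\<sigma>. \<sigma> \<in> chains rel E (Suc (Suc n)) \<Longrightarrow> alt G x \<sigma> = \<one>"
  shows "\<exists>y. (\<forall>\<sigma>. y \<sigma> \<in> carrier G) \<and> (\<forall>\<sigma>\<in>chains rel E (Suc n). alt G y \<sigma> = x \<sigma>)"
proof -
  have "\<exists>u. \<forall>F. finite F \<and> F \<subseteq> E \<longrightarrow> u F \<in> E \<and> (\<forall>a\<in>F. rel a (u F)) \<and> (\<forall>F'\<subseteq>F. rel (u F') (u F))"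
    by (rule monotone_upper_bounds) (rule dir refl; assumption)+
  then obtain u where "\<forall>F. finite F \<and> F \<subseteq> E \<longrightarrow> u F \<in> E \<and> (\<forall>a\<in>F. rel a (u F)) \<and> (\<forall>F'\<subseteq>F. rel (u F') (u F))" ..
  note u = this[THEN spec, THEN mp, OF conjI]
  let ?v = "\<lambda>\<sigma>. u (set \<sigma>)"
  have "alt G (cone_op G ?v n x) \<sigma> = x \<sigma>" if s: "\<sigma> \<in> chains rel E (Suc n)" for \<sigma>
  proof -
    have "cone_op G ?v (Suc n) (alt G x) \<sigma> = \<one>"
    proof (rule cone_op_one[where E = E and rel = rel])
      fix \<sigma> :: "'e list" assume s: "set \<sigma> \<subseteq> E"
      note u' = u[OF finite_set s]
      show "u (set \<sigma>) \<in> E" using u' by simp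
      show "rel e (u (set \<sigma>))" if "e \<in> set \<sigma>" for e using u' that by simp
      show "rel (u (set \<tau>)) (u (set \<sigma>))" if "set \<tau> \<subseteq> set \<sigma>" for \<tau> using u' that by simp
    next
      show "rel a c" if "a \<in> E" "b \<in> E" "c \<in> E" "rel a b" "rel b c" for a b c
        using that by (rule trans)
    qed (use refl s x(2) in simp_all)
    then have "x \<sigma> \<otimes> inv alt G (cone_op G ?v n x) \<sigma> = \<one>"
      using cone_op_homotopy[of x \<sigma> n ?v] s x(1) by (simp add: chains_def)
    then show ?thesis using x(1) by (simp add: inv_solve_right')
  qed
  then show ?thesis using x(1) by (intro exI[of _ "cone_op G ?v n x"]) simp
qed

lemma chains_last_le:
  assumes "\<sigma> \<in> chains rel E n" "e \<in> set \<sigma>" "\<And>a. a \<in> E \<Longrightarrow> rel a a"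
  shows "rel (last \<sigma>) e"
  using assms by (induction \<sigma> arbitrary: n) (auto simp: chains_def split: if_splits)

text \<open>Under confluence, having a common upper bound is an equivalence relation with directed
  classes, and a chain stays inside one class; so the directed case applies class by class.
  Exactness starts at two vertices: on single vertices a cocycle is constant only on each class, and
  the one value of \<open>y\<close> at the empty list cannot produce several constants.\<close>

lemma (in comm_group) confluent_chains_exact:
  assumes trans: "\<And>a b c. \<lbrakk>a \<in> E; b \<in> E; c \<in> E; rel a b; rel b c\<rbrakk> \<Longrightarrow> rel a c"
    and refl: "\<And>a. a \<in> E \<Longrightarrow> rel a a"
    and conf: "\<And>a b c. \<lbrakk>a \<in> E; b \<in> E; c \<in> E; rel a b; rel a c\<rbrakk> \<Longrightarrow> \<exists>d\<in>E. rel b d \<and> rel c d"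
    and x: "\<And>\<sigma>. x \<sigma> \<in> carrier G"
      "\<And>\<sigma>. \<sigma> \<in> chains rel E (Suc (Suc (Suc n))) \<Longrightarrow> alt G x \<sigma> = \<one>"
  shows "\<exists>y. (\<forall>\<sigma>. y \<sigma> \<in> carrier G) \<and> (\<forall>\<sigma>\<in>chains rel E (Suc (Suc n)). alt G y \<sigma> = x \<sigma>)"
proof -
  let ?K = "\<lambda>a. {b \<in> E. \<exists>d\<in>E. rel a d \<and> rel b d}"
  have K_self: "a \<in> ?K a" if "a \<in> E" for a using refl that by blast
  have K_eq: "?K a = ?K b" if ab: "a \<in> E" "b \<in> E" "rel a b" for a b
  proof (rule Set.set_eqI)
    fix c show "c \<in> ?K a \<longleftrightarrow> c \<in> ?K b"
    proof
      assume "c \<in> ?K a"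
      then obtain d where d: "c \<in> E" "d \<in> E" "rel a d" "rel c d" by blast
      obtain e where e: "e \<in> E" "rel b e" "rel d e" using conf[OF ab(1,2) d(2) ab(3) d(3)] by blast
      have "rel c e" by (rule trans[of c d e]) (use d e in auto)
      then show "c \<in> ?K b" using d e by blast
    next
      assume "c \<in> ?K b"
      then obtain d where d: "c \<in> E" "d \<in> E" "rel b d" "rel c d" by blast
      have "rel a d" by (rule trans[of a b d]) (use ab d in auto)
      then show "c \<in> ?K a" using d by blast
    qed
  qed
  have bound: "\<exists>d\<in>?K a. \<forall>b\<in>F. rel b d" if a: "a \<in> E" and F: "finite F" "F \<subseteq> ?K a" for a F
    using F
  proof induction
    case empty
    show ?case using K_self[OF a] by blast
  next
    case (insert b F)
    then obtain d where d: "d \<in> ?K a" "\<forall>b\<in>F. rel b d" by auto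
    \<comment> \<open>Confluence applies only above a common lower bound, so the bound
      \<open>d\<close> of \<open>F\<close> and the new element \<open>b\<close> are first raised to
      \<open>d'\<close> and \<open>b'\<close>, which both lie above \<open>a\<close>.\<close>
    obtain d' where d': "d' \<in> E" "rel a d'" "rel d d'" using d(1) by blast
    obtain b' where b': "b \<in> E" "b' \<in> E" "rel a b'" "rel b b'" using insert.prems by blast
    obtain e where e: "e \<in> E" "rel d' e" "rel b' e" using conf[OF a d'(1) b'(2) d'(2) b'(3)] by blast
    have "rel a e" by (rule trans[of a d' e]) (use a d' e in auto)
    moreover have "rel b e" by (rule trans[of b b' e]) (use b' e in auto)
    moreover have "rel d e" by (rule trans[of d d' e]) (use d d' e in auto)
    moreover have "rel c e" if "c \<in> F" for c
      by (rule trans[of c d e]) (use that d insert.prems e \<open>rel d e\<close> in auto)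
    ultimately show ?case using e(1) refl[OF e(1)] by blast
  qed
  have "\<exists>y. (\<forall>\<sigma>. y \<sigma> \<in> carrier G) \<and> (\<forall>\<sigma>\<in>chains rel (?K a) (Suc (Suc n)). alt G y \<sigma> = x \<sigma>)" if "a \<in> E" for a
  proof (rule directed_chains_exact)
    show "rel b d" if "b \<in> ?K a" "c \<in> ?K a" "d \<in> ?K a" "rel b c" "rel c d" for b c d
      by (rule trans[of b c d]) (use that in blast)+
    show "alt G x \<sigma> = \<one>" if "\<sigma> \<in> chains rel (?K a) (Suc (Suc (Suc n)))" for \<sigma>
      by (rule x(2)) (use that in \<open>auto simp: chains_def\<close>)
    show "rel b b" if "b \<in> ?K a" for b using that refl by blast
  qed (rule bound[OF that] x(1); assumption)+
  then have "\<forall>S\<in>?K ` E. \<exists>y. (\<forall>\<sigma>. y \<sigma> \<in> carrier G) \<and> (\<forall>\<sigma>\<in>chains rel S (Suc (Suc n)). alt G y \<sigma> = x \<sigma>)"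
    by blast
  then obtain Y where Y: "\<forall>S\<in>?K ` E. (\<forall>\<sigma>. Y S \<sigma> \<in> carrier G) \<and>
      (\<forall>\<sigma>\<in>chains rel S (Suc (Suc n)). alt G (Y S) \<sigma> = x \<sigma>)"
    by (rule bchoice[THEN exE])
  \<comment> \<open>The class is read off the last vertex. The value of \<open>last []\<close> is
    arbitrary, which is harmless because all faces of a chain with at least two vertices are
    nonempty.\<close>
  let ?y = "\<lambda>\<sigma>. if last \<sigma> \<in> E then Y (?K (last \<sigma>)) \<sigma> else \<one>"
  have 1: "alt G ?y \<sigma> = x \<sigma>" if s: "\<sigma> \<in> chains rel E (Suc (Suc n))" for \<sigma>
  proof -
    have l: "last \<sigma> \<in> E" using s by (cases "\<sigma> = []") (auto simp: chains_def)
    have K: "?K e = ?K (last \<sigma>)" if "e \<in> set \<sigma>" for e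
    proof (rule K_eq[OF l, symmetric])
      show "e \<in> E" using s that by (auto simp: chains_def)
      show "rel (last \<sigma>) e" by (rule chains_last_le[OF s that refl])
    qed
    have "e \<in> ?K (last \<sigma>)" if "e \<in> set \<sigma>" for e
    proof -
      have "e \<in> E" using s that by (auto simp: chains_def)
      from K_self[OF this] show ?thesis unfolding K[OF that] .
    qed
    then have "set \<sigma> \<subseteq> ?K (last \<sigma>)" by blast
    then have "\<sigma> \<in> chains rel (?K (last \<sigma>)) (Suc (Suc n))" using s by (auto simp: chains_def)
    then have "alt G (Y (?K (last \<sigma>))) \<sigma> = x \<sigma>" using Y l by blast
    moreover have "alt G ?y \<sigma> = alt G (Y (?K (last \<sigma>))) \<sigma>"
    proof (rule alt_cong)
      fix \<tau> assume f: "face \<tau> \<sigma>"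
      have "\<tau> \<noteq> []" using f s by (auto simp: face_def chains_def)
      then have "last \<tau> \<in> set \<sigma>" using f set_subseq[of \<tau> \<sigma>] by (auto simp: face_def)
      then have "?K (last \<tau>) = ?K (last \<sigma>)" "last \<tau> \<in> E" using K s by (simp, auto simp: chains_def)
      then show "?y \<tau> = Y (?K (last \<sigma>)) \<tau>" by (simp only: if_True)
    qed
    ultimately show ?thesis by simp
  qed
  have 2: "?y \<sigma> \<in> carrier G" for \<sigma>
  proof (cases "last \<sigma> \<in> E")
    case True
    then have "Y (?K (last \<sigma>)) \<sigma> \<in> carrier G" using Y by blast
    then show ?thesis using True by simp
  qed simp
  show ?thesis by (intro exI[of _ ?y] conjI allI ballI 1 2)
qed

section \<open>Modules over a small category\<close>

lemma hom_one_comm: "\<lbrakk>h \<in> hom G H; comm_group G; comm_group H\<rbrakk> \<Longrightarrow> h \<one>\<^bsub>G\<^esub> = \<one>\<^bsub>H\<^esub>"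
  by (rule hom_one) (simp_all add: comm_group.axioms)

lemma hom_inv_comm:
  "\<lbrakk>h \<in> hom G H; comm_group G; comm_group H; x \<in> carrier G\<rbrakk> \<Longrightarrow> h (inv\<^bsub>G\<^esub> x) = inv\<^bsub>H\<^esub> h x"
  by (rule group_hom.hom_inv) (simp_all add: comm_group.axioms group_hom_def group_hom_axioms_def)

lemma hom_diff:
  assumes "h \<in> hom G H" "comm_group G" "comm_group H" "x \<in> carrier G" "y \<in> carrier G"
  shows "h (x \<div>\<^bsub>G\<^esub> y) = h x \<div>\<^bsub>H\<^esub> h y"
proof -
  interpret G: comm_group G by fact
  show ?thesis using assms by (simp add: hom_mult hom_inv_comm)
qed

lemma comm_group_inv_closed: "comm_group G \<Longrightarrow> x \<in> carrier G \<Longrightarrow> inv\<^bsub>G\<^esub> x \<in> carrier G"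
  by (simp add: comm_group.axioms group.inv_closed)

lemma comm_group_diff_closed:
  "\<lbrakk>comm_group G; x \<in> carrier G; y \<in> carrier G\<rbrakk> \<Longrightarrow> x \<div>\<^bsub>G\<^esub> y \<in> carrier G"
  by (simp add: comm_group_inv_closed comm_groupE(1))

lemma comm_group_diff_self: "comm_group G \<Longrightarrow> x \<in> carrier G \<Longrightarrow> x \<div>\<^bsub>G\<^esub> x = \<one>\<^bsub>G\<^esub>"
  by (simp add: comm_group.axioms group.r_inv)

lemma comm_group_diff_eq_one:
  assumes "comm_group G" "x \<in> carrier G" "y \<in> carrier G"
  shows "x \<div>\<^bsub>G\<^esub> y = \<one>\<^bsub>G\<^esub> \<longleftrightarrow> x = y"
proof -
  interpret G: comm_group G by fact
  show ?thesis using assms(2,3) by (metis G.inv_closed G.inv_equality G.inv_inv G.r_inv)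
qed

lemma comm_group_diff_one:
  assumes "comm_group G" "x \<in> carrier G"
  shows "x \<div>\<^bsub>G\<^esub> \<one>\<^bsub>G\<^esub> = x"
proof -
  interpret G: comm_group G by fact
  show ?thesis using assms(2) by simp
qed

lemma comm_group_diff_mult:
  assumes "comm_group G" "x \<in> carrier G" "y \<in> carrier G"
  shows "x \<div>\<^bsub>G\<^esub> y \<otimes>\<^bsub>G\<^esub> y = x"
proof -
  interpret G: comm_group G by fact
  show ?thesis using assms(2,3) by (simp add: G.m_assoc)
qed

lemma comm_group_subgroup:
  assumes "comm_group G" "subgroup H G"
  shows "comm_group (G\<lparr>carrier := H\<rparr>)"
proof -
  interpret G: comm_group G by fact
  interpret H: group "G\<lparr>carrier := H\<rparr>" by (rule subgroup.subgroup_is_group[OF assms(2) G.is_group])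
  show ?thesis
    by (rule H.group_comm_groupI) (use subgroup.mem_carrier[OF assms(2)] G.m_comm in auto)
qed

lemma hom_image_subgroup:
  "\<lbrakk>h \<in> hom G H; comm_group G; comm_group H\<rbrakk> \<Longrightarrow> subgroup (h ` carrier G) H"
  by (rule group_hom.img_is_subgroup) (simp_all add: comm_group.axioms group_hom_def group_hom_axioms_def)

text \<open>Injectivity is tested only on modules with values in the type of the injective module;
  other modules are copied into that type along an injection.\<close>

definition transported :: "('a \<Rightarrow> 'b) \<Rightarrow> 'a monoid \<Rightarrow> 'b monoid" where
  "transported e G = \<lparr>carrier = e ` carrier G,
     monoid.mult = (\<lambda>x y. e (inv_into UNIV e x \<otimes>\<^bsub>G\<^esub> inv_into UNIV e y)), one = e \<one>\<^bsub>G\<^esub>\<rparr>"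

lemma comm_group_transported:
  assumes "inj e" "comm_group G"
  shows "comm_group (transported e G)"
proof -
  interpret G: comm_group G by fact
  show ?thesis
  proof (rule comm_groupI)
    fix x assume "x \<in> carrier (transported e G)"
    then obtain y where "y \<in> carrier G" "x = e y" by (auto simp: transported_def)
    then show "\<exists>y\<in>carrier (transported e G). y \<otimes>\<^bsub>transported e G\<^esub> x = \<one>\<^bsub>transported e G\<^esub>"
      using assms(1) by (intro bexI[of _ "e (inv\<^bsub>G\<^esub> y)"]) (auto simp: transported_def)
  qed (use assms(1) in \<open>auto simp: transported_def G.m_ac\<close>)
qed

section \<open>Rules for modules, their maps, and extension into injective modules\<close>

lemma cmodule_comm_group: "cmodule C \<Phi> \<Longrightarrow> a \<in> obj C \<Longrightarrow> comm_group (val \<Phi> a)"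
  by (simp add: cmodule_def)

lemma cmodule_arr_hom:
  "\<lbrakk>cmodule C \<Phi>; a \<in> obj C; b \<in> obj C; f \<in> mor C a b\<rbrakk> \<Longrightarrow> arr \<Phi> a b f \<in> hom (val \<Phi> b) (val \<Phi> a)"
  by (simp add: cmodule_def)

lemma cmodule_arr_closed:
  "\<lbrakk>cmodule C \<Phi>; a \<in> obj C; b \<in> obj C; f \<in> mor C a b; x \<in> carrier (val \<Phi> b)\<rbrakk> \<Longrightarrow> arr \<Phi> a b f x \<in> carrier (val
      \<Phi> a)"
  by (rule hom_in_carrier[OF cmodule_arr_hom])

lemma cmodule_arr_id:
  "\<lbrakk>cmodule C \<Phi>; a \<in> obj C; x \<in> carrier (val \<Phi> a)\<rbrakk> \<Longrightarrow> arr \<Phi> a a (idt C a) x = x"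
  by (simp add: cmodule_def)

lemma cmodule_arr_comp:
  "\<lbrakk>cmodule C \<Phi>; a \<in> obj C; b \<in> obj C; c \<in> obj C; f \<in> mor C a b; g \<in> mor C b c; x \<in> carrier (val \<Phi> c)\<rbrakk> \<Longrightarrow>
      arr \<Phi> a b f (arr \<Phi> b c g x) = arr \<Phi> a c (cmp C a b c g f) x"
  by (simp add: cmodule_def)

lemma cmod_hom_hom: "\<eta> \<in> cmod_hom C \<Phi> \<Psi> \<Longrightarrow> a \<in> obj C \<Longrightarrow> \<eta> a \<in> hom (val \<Phi> a) (val \<Psi> a)"
  by (simp add: cmod_hom_def)

lemma cmod_hom_closed:
  "\<lbrakk>\<eta> \<in> cmod_hom C \<Phi> \<Psi>; a \<in> obj C; x \<in> carrier (val \<Phi> a)\<rbrakk> \<Longrightarrow> \<eta> a x \<in> carrier (val \<Psi> a)"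
  by (rule hom_in_carrier[OF cmod_hom_hom])

lemma cmod_hom_natural:
  "\<lbrakk>\<eta> \<in> cmod_hom C \<Phi> \<Psi>; a \<in> obj C; b \<in> obj C; f \<in> mor C a b; x \<in> carrier (val \<Phi> b)\<rbrakk> \<Longrightarrow> \<eta> a (arr \<Phi> a b f x) =
      arr \<Psi> a b f (\<eta> b x)"
  by (simp add: cmod_hom_def)

lemma cmod_homI:
  "(\<And>a. a \<in> obj C \<Longrightarrow> \<eta> a \<in> hom (val \<Phi> a) (val \<Psi> a)) \<Longrightarrow>
   (\<And>a b f x. a \<in> obj C \<Longrightarrow> b \<in> obj C \<Longrightarrow> f \<in> mor C a b \<Longrightarrow> x \<in> carrier (val \<Phi> b) \<Longrightarrow>
     \<eta> a (arr \<Phi> a b f x) = arr \<Psi> a b f (\<eta> b x)) \<Longrightarrow> \<eta> \<in> cmod_hom C \<Phi> \<Psi>"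
  by (simp add: cmod_hom_def)

lemma cmoduleI:
  "(\<And>a. a \<in> obj C \<Longrightarrow> comm_group (val \<Phi> a)) \<Longrightarrow>
   (\<And>a b f. a \<in> obj C \<Longrightarrow> b \<in> obj C \<Longrightarrow> f \<in> mor C a b \<Longrightarrow> arr \<Phi> a b f \<in> hom (val \<Phi> b) (val \<Phi> a)) \<Longrightarrow>
   (\<And>a x. a \<in> obj C \<Longrightarrow> x \<in> carrier (val \<Phi> a) \<Longrightarrow> arr \<Phi> a a (idt C a) x = x) \<Longrightarrow>
   (\<And>a b c f g x. a \<in> obj C \<Longrightarrow> b \<in> obj C \<Longrightarrow> c \<in> obj C \<Longrightarrow> f \<in> mor C a b \<Longrightarrow> g \<in> mor C b c \<Longrightarrow>
     x \<in> carrier (val \<Phi> c) \<Longrightarrow> arr \<Phi> a c (cmp C a b c g f) x = arr \<Phi> a b f (arr \<Phi> b c g x)) \<Longrightarrow>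
   cmodule C \<Phi>"
  by (simp add: cmodule_def)

lemma cmod_hom_one:
  "\<lbrakk>\<eta> \<in> cmod_hom C \<Phi> \<Psi>; cmodule C \<Phi>; cmodule C \<Psi>; a \<in> obj C\<rbrakk> \<Longrightarrow> \<eta> a \<one>\<^bsub>val \<Phi> a\<^esub> = \<one>\<^bsub>val \<Psi> a\<^esub>"
  by (rule hom_one_comm) (simp_all add: cmod_hom_hom cmodule_comm_group)

lemma cmodule_arr_one:
  "\<lbrakk>cmodule C \<Phi>; a \<in> obj C; b \<in> obj C; f \<in> mor C a b\<rbrakk> \<Longrightarrow> arr \<Phi> a b f \<one>\<^bsub>val \<Phi> b\<^esub> = \<one>\<^bsub>val \<Phi> a\<^esub>"
  by (rule hom_one_comm) (simp_all add: cmodule_arr_hom cmodule_comm_group)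

lemma cmod_hom_comp:
  assumes "\<eta> \<in> cmod_hom C \<Phi> \<Psi>" "\<zeta> \<in> cmod_hom C \<Psi> \<Omega>"
  shows "(\<lambda>a x. \<zeta> a (\<eta> a x)) \<in> cmod_hom C \<Phi> \<Omega>"
proof (rule cmod_homI)
  show "(\<lambda>x. \<zeta> a (\<eta> a x)) \<in> hom (val \<Phi> a) (val \<Omega> a)" if "a \<in> obj C" for a
    using cmod_hom_hom[OF assms(1) that] cmod_hom_hom[OF assms(2) that] by (simp add: hom_def Pi_iff)
next
  fix a b f x assume h: "a \<in> obj C" "b \<in> obj C" "f \<in> mor C a b" "x \<in> carrier (val \<Phi> b)"
  show "\<zeta> a (\<eta> a (arr \<Phi> a b f x)) = arr \<Omega> a b f (\<zeta> b (\<eta> b x))"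
    using cmod_hom_natural[OF assms(1) h] cmod_hom_natural[OF assms(2) h(1-3)] cmod_hom_closed[OF assms(1)
        h(2,4)]
    by simp
qed

lemma cmod_hom_diff:
  assumes "\<eta> \<in> cmod_hom C \<Phi> \<Psi>" "\<zeta> \<in> cmod_hom C \<Phi> \<Psi>" "cmodule C \<Psi>"
  shows "(\<lambda>a x. \<eta> a x \<div>\<^bsub>val \<Psi> a\<^esub> \<zeta> a x) \<in> cmod_hom C \<Phi> \<Psi>"
proof (rule cmod_homI)
  fix a assume a: "a \<in> obj C"
  interpret comm_group "val \<Psi> a" by (rule cmodule_comm_group[OF assms(3) a])
  note h = cmod_hom_hom[OF assms(1) a] cmod_hom_hom[OF assms(2) a]
  have c: "\<eta> a x \<in> carrier (val \<Psi> a)" "\<zeta> a x \<in> carrier (val \<Psi> a)" if "x \<in> carrier (val \<Phi> a)" for x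
    using that by (simp_all add: h[THEN hom_in_carrier])
  show "(\<lambda>x. \<eta> a x \<div>\<^bsub>val \<Psi> a\<^esub> \<zeta> a x) \<in> hom (val \<Phi> a) (val \<Psi> a)"
  proof (rule homI)
    fix x y assume xy: "x \<in> carrier (val \<Phi> a)" "y \<in> carrier (val \<Phi> a)"
    then show "\<eta> a (x \<otimes>\<^bsub>val \<Phi> a\<^esub> y) \<div>\<^bsub>val \<Psi> a\<^esub> \<zeta> a (x \<otimes>\<^bsub>val \<Phi> a\<^esub> y)
      = \<eta> a x \<div>\<^bsub>val \<Psi> a\<^esub> \<zeta> a x \<otimes>\<^bsub>val \<Psi> a\<^esub> (\<eta> a y \<div>\<^bsub>val \<Psi> a\<^esub> \<zeta> a y)"
      using c by (simp add: h[THEN hom_mult] inv_mult m_ac)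
  qed (use c in auto)
next
  fix a b f x assume h: "a \<in> obj C" "b \<in> obj C" "f \<in> mor C a b" "x \<in> carrier (val \<Phi> b)"
  show "\<eta> a (arr \<Phi> a b f x) \<div>\<^bsub>val \<Psi> a\<^esub> \<zeta> a (arr \<Phi> a b f x)
    = arr \<Psi> a b f (\<eta> b x \<div>\<^bsub>val \<Psi> b\<^esub> \<zeta> b x)"
    using cmod_hom_natural[OF assms(1) h] cmod_hom_natural[OF assms(2) h]
      hom_diff[OF cmodule_arr_hom[OF assms(3) h(1-3)] _ _ cmod_hom_closed[OF assms(1) h(2,4)]
          cmod_hom_closed[OF assms(2) h(2,4)]]
    by (simp add: cmodule_comm_group[OF assms(3)] h(1,2))
qed

lemma injective_cmodule_cmodule: "injective_cmodule C I \<Longrightarrow> cmodule C I"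
  by (simp add: injective_cmodule_def)

text \<open>Strengthens the defining property in two directions. The map \<open>\<alpha>\<close> is
  replaced by the inclusion of its image, through which \<open>\<gamma>\<close> factors because it
  kills the kernel of \<open>\<alpha>\<close>; and \<open>B\<close> may have values in another type
  that injects into that of \<open>I\<close>. The type of \<open>A\<close> is arbitrary, since only
  its image in \<open>B\<close> is copied.\<close>

lemma injective_cmodule_extend:
  fixes A :: "('o, 'r, 'x) cmod" and B :: "('o, 'r, 'v) cmod" and I :: "('o, 'r, 'u) cmod" and e :: "'v \<Rightarrow>
      'u"
  assumes I: "injective_cmodule C I" and e: "inj e" and A: "cmodule C A" and B: "cmodule C B"
    and \<alpha>: "\<alpha> \<in> cmod_hom C A B" and \<gamma>: "\<gamma> \<in> cmod_hom C A I"
    and ker: "\<And>a x. \<lbrakk>a \<in> obj C; x \<in> carrier (val A a); \<alpha> a x = \<one>\<^bsub>val B a\<^esub>\<rbrakk> \<Longrightarrow> \<gamma> a x = \<one>\<^bsub>val I a\<^esub>"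
  shows "\<exists>\<psi>\<in>cmod_hom C B I. \<forall>a\<in>obj C. \<forall>x\<in>carrier (val A a). \<psi> a (\<alpha> a x) = \<gamma> a x"
proof -
  let ?im = "\<lambda>a. (val B a)\<lparr>carrier := \<alpha> a ` carrier (val A a)\<rparr>"
  let ?ar = "\<lambda>a b f x. e (arr B a b f (inv_into UNIV e x))"
  define B' :: "('o, 'r, 'u) cmod" where "B' = \<lparr>val = \<lambda>a. transported e (val B a), arr = ?ar\<rparr>"
  define A' :: "('o, 'r, 'u) cmod" where "A' = \<lparr>val = \<lambda>a. transported e (?im a), arr = ?ar\<rparr>"
  have valB: "carrier (val B' a) = e ` carrier (val B a)" "\<one>\<^bsub>val B' a\<^esub> = e \<one>\<^bsub>val B a\<^esub>"
    "e x \<otimes>\<^bsub>val B' a\<^esub> e y = e (x \<otimes>\<^bsub>val B a\<^esub> y)" "arr B' a b f (e x) = e (arr B a b f x)" for a b f x y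
    using e by (simp_all add: B'_def transported_def)
  have valA: "carrier (val A' a) = e ` \<alpha> a ` carrier (val A a)"
    "e x \<otimes>\<^bsub>val A' a\<^esub> e y = e (x \<otimes>\<^bsub>val B a\<^esub> y)" "arr A' a b f (e x) = e (arr B a b f x)" for a b f x y
    using e by (simp_all add: A'_def transported_def)
  note cg = cmodule_comm_group[OF A] cmodule_comm_group[OF B]
    cmodule_comm_group[OF injective_cmodule_cmodule[OF I]]
  have im: "subgroup (\<alpha> a ` carrier (val A a)) (val B a)" if "a \<in> obj C" for a
    by (rule hom_image_subgroup) (use that cmod_hom_hom[OF \<alpha>] cg in auto)
  have sub: "\<alpha> a ` carrier (val A a) \<subseteq> carrier (val B a)" if "a \<in> obj C" for a
    by (rule subgroup.subset[OF im[OF that]])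
  have cB: "cmodule C B'"
  proof (rule cmoduleI)
    show "comm_group (val B' a)" if "a \<in> obj C" for a
      using comm_group_transported[OF e] cg(2)[OF that] by (simp add: B'_def)
  next
    fix a b f assume h: "a \<in> obj C" "b \<in> obj C" "f \<in> mor C a b"
    show "arr B' a b f \<in> hom (val B' b) (val B' a)"
      using cmodule_arr_hom[OF B h] by (auto simp: hom_def valB)
  qed (auto simp: valB cmodule_arr_id[OF B] cmodule_arr_comp[OF B] cmodule_arr_closed[OF B])
  have cA: "cmodule C A'"
  proof (rule cmoduleI)
    show "comm_group (val A' a)" if "a \<in> obj C" for a
      using comm_group_transported[OF e comm_group_subgroup[OF cg(2) im]] that by (simp add: A'_def)
  next
    fix a b f assume h: "a \<in> obj C" "b \<in> obj C" "f \<in> mor C a b"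
    have "arr B a b f (\<alpha> b x) \<in> \<alpha> a ` carrier (val A a)" if "x \<in> carrier (val A b)" for x
      using cmod_hom_natural[OF \<alpha> h that, symmetric] cmodule_arr_closed[OF A h that] by (rule image_eqI)
    then show "arr A' a b f \<in> hom (val A' b) (val A' a)"
      using cmodule_arr_hom[OF B h] sub[OF h(2)] by (auto simp: hom_def valA image_subset_iff)
  next
    fix a x assume "a \<in> obj C" "x \<in> carrier (val A' a)"
    then show "arr A' a a (idt C a) x = x"
      using cmodule_arr_id[OF B] sub by (auto simp: valA image_subset_iff)
  next
    fix a b c f g x assume h: "a \<in> obj C" "b \<in> obj C" "c \<in> obj C" "f \<in> mor C a b" "g \<in> mor C b c"
      and x: "x \<in> carrier (val A' c)"
    then show "arr A' a c (cmp C a b c g f) x = arr A' a b f (arr A' b c g x)"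
      using cmodule_arr_comp[OF B h] sub[of c] by (auto simp: valA image_subset_iff)
  qed
  \<comment> \<open>The factorisation of \<open>\<gamma>\<close> through the copied image of
    \<open>\<alpha>\<close>. Any preimage may be chosen, as two of them differ by an element of the
    kernel of \<open>\<alpha>\<close>.\<close>
  define \<phi> where "\<phi> a y = \<gamma> a (SOME x. x \<in> carrier (val A a) \<and> e (\<alpha> a x) = y)" for a y
  have \<phi>: "\<phi> a (e (\<alpha> a x)) = \<gamma> a x" if h: "a \<in> obj C" "x \<in> carrier (val A a)" for a x
  proof -
    let ?z = "SOME z. z \<in> carrier (val A a) \<and> e (\<alpha> a z) = e (\<alpha> a x)"
    have "?z \<in> carrier (val A a) \<and> e (\<alpha> a ?z) = e (\<alpha> a x)"
      by (rule someI[of _ x]) (simp add: h)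
    then have z: "?z \<in> carrier (val A a)" "\<alpha> a ?z = \<alpha> a x" using e by (simp_all add: inj_eq)
    have "\<alpha> a (?z \<div>\<^bsub>val A a\<^esub> x) = \<one>\<^bsub>val B a\<^esub>"
      using hom_diff[OF cmod_hom_hom[OF \<alpha> h(1)] cg(1,2)[OF h(1)] z(1) h(2)] z(2)
        comm_group_diff_self[OF cg(2)[OF h(1)] cmod_hom_closed[OF \<alpha> h]] by simp
    then have "\<gamma> a (?z \<div>\<^bsub>val A a\<^esub> x) = \<one>\<^bsub>val I a\<^esub>"
      by (intro ker h comm_group_diff_closed cg z)
    then have "\<gamma> a ?z = \<gamma> a x"
      using hom_diff[OF cmod_hom_hom[OF \<gamma> h(1)] cg(1,3)[OF h(1)] z(1) h(2)]
        comm_group_diff_eq_one[OF cg(3)[OF h(1)] cmod_hom_closed[OF \<gamma> h(1) z(1)] cmod_hom_closed[OF \<gamma> h]]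
            by simp
    then show ?thesis by (simp add: \<phi>_def)
  qed
  have \<phi>_hom: "\<phi> \<in> cmod_hom C A' I"
  proof (rule cmod_homI)
    fix a assume a: "a \<in> obj C"
    show "\<phi> a \<in> hom (val A' a) (val I a)"
    proof (rule homI)
      fix x assume "x \<in> carrier (val A' a)"
      then show "\<phi> a x \<in> carrier (val I a)"
        using \<phi>[OF a] cmod_hom_closed[OF \<gamma> a] by (auto simp: valA)
    next
      fix x y assume "x \<in> carrier (val A' a)" "y \<in> carrier (val A' a)"
      then obtain x' y' where xy: "x = e (\<alpha> a x')" "x' \<in> carrier (val A a)" "y = e (\<alpha> a y')" "y' \<in> carrier
          (val A a)"
        by (auto simp: valA)
      have c: "x' \<otimes>\<^bsub>val A a\<^esub> y' \<in> carrier (val A a)" using xy comm_groupE(1)[OF cg(1)[OF a]] by blast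
      have "x \<otimes>\<^bsub>val A' a\<^esub> y = e (\<alpha> a (x' \<otimes>\<^bsub>val A a\<^esub> y'))"
        using hom_mult[OF cmod_hom_hom[OF \<alpha> a] xy(2,4)] by (simp add: xy valA)
      then show "\<phi> a (x \<otimes>\<^bsub>val A' a\<^esub> y) = \<phi> a x \<otimes>\<^bsub>val I a\<^esub> \<phi> a y"
        using hom_mult[OF cmod_hom_hom[OF \<gamma> a] xy(2,4)] \<phi>[OF a] xy c by simp
    qed
  next
    fix a b f y assume h: "a \<in> obj C" "b \<in> obj C" "f \<in> mor C a b" "y \<in> carrier (val A' b)"
    then obtain x where x: "y = e (\<alpha> b x)" "x \<in> carrier (val A b)" by (auto simp: valA)
    have "arr A' a b f y = e (\<alpha> a (arr A a b f x))"
      using cmod_hom_natural[OF \<alpha> h(1-3) x(2)] by (simp add: x valA)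
    then show "\<phi> a (arr A' a b f y) = arr I a b f (\<phi> b y)"
      using \<phi>[OF h(1) cmodule_arr_closed[OF A h(1-3) x(2)]] \<phi>[OF h(2) x(2)]
        cmod_hom_natural[OF \<gamma> h(1-3) x(2)] by (simp add: x)
  qed
  have inc: "(\<lambda>a x. x) \<in> cmod_hom C A' B'"
    by (rule cmod_homI, rule homI) (use sub in \<open>fastforce simp: valA valB\<close>)+
  have "\<exists>\<psi>\<in>cmod_hom C B' I. \<forall>a\<in>obj C. \<forall>x\<in>carrier (val A' a). \<psi> a ((\<lambda>a x. x) a x) = \<phi> a x"
    by (rule I[unfolded injective_cmodule_def, THEN conjunct2, THEN spec, THEN spec, THEN spec, THEN spec,
        THEN mp])
      (intro conjI cA cB inc \<phi>_hom, simp)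
  then obtain \<psi> where \<psi>: "\<psi> \<in> cmod_hom C B' I" "\<forall>a\<in>obj C. \<forall>x\<in>carrier (val A' a). \<psi> a x = \<phi> a x"
    by blast
  have "(\<lambda>a x. e x) \<in> cmod_hom C B B'"
    by (rule cmod_homI, rule homI) (auto simp: valB)
  then have 1: "(\<lambda>a x. \<psi> a (e x)) \<in> cmod_hom C B I" by (rule cmod_hom_comp[OF _ \<psi>(1)])
  have 2: "\<psi> a (e (\<alpha> a x)) = \<gamma> a x" if "a \<in> obj C" "x \<in> carrier (val A a)" for a x
    using \<psi>(2) \<phi>[OF that] that by (auto simp: valA)
  show ?thesis by (rule bexI[OF _ 1]) (intro ballI 2)
qed

section \<open>Homotopies and cohomology\<close>

text \<open>The map \<open>f (Suc n) - dY n (h n)\<close>, written additively, extends along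
  \<open>dW (Suc n)\<close> to the next \<open>h\<close> once it vanishes on the kernel, which by
  exactness is the image of \<open>dW n\<close>. Exactness is asked of the source and injectivity of
  the target, so the lemma covers both maps between resolutions and the inclusion of an exact
  subcomplex into a complex of injectives.\<close>

lemma null_homotopy_exists:
  fixes W :: "nat \<Rightarrow> ('o, 'r, 'u) cmod" and Y :: "nat \<Rightarrow> ('o, 'r, 'u) cmod"
  assumes W: "\<And>n. cmodule C (W n)" and Y: "\<And>n. injective_cmodule C (Y n)"
    and dW: "\<And>n. dW n \<in> cmod_hom C (W n) (W (Suc n))" and dY: "\<And>n. dY n \<in> cmod_hom C (Y n) (Y (Suc n))"
    and f: "\<And>n. f n \<in> cmod_hom C (W n) (Y n)"
    and chain: "\<And>n a x. a \<in> obj C \<Longrightarrow> x \<in> carrier (val (W n) a) \<Longrightarrow> f (Suc n) a (dW n a x) = dY n a (f n a x)"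
    and dYdY: "\<And>n a y. a \<in> obj C \<Longrightarrow> y \<in> carrier (val (Y n) a) \<Longrightarrow>
      dY (Suc n) a (dY n a y) = \<one>\<^bsub>val (Y (Suc (Suc n))) a\<^esub>"
    and ker0: "\<And>a x. \<lbrakk>a \<in> obj C; x \<in> carrier (val (W 0) a); dW 0 a x = \<one>\<^bsub>val (W 1) a\<^esub>\<rbrakk> \<Longrightarrow> f 0 a x =
        \<one>\<^bsub>val (Y 0) a\<^esub>"
    and exact: "\<And>n a x. \<lbrakk>a \<in> obj C; x \<in> carrier (val (W (Suc n)) a); dW (Suc n) a x =
        \<one>\<^bsub>val (W (Suc (Suc n))) a\<^esub>\<rbrakk> \<Longrightarrow> \<exists>y\<in>carrier (val (W n) a). dW n a y = x"
  shows "\<exists>h. (\<forall>n. h n \<in> cmod_hom C (W (Suc n)) (Y n)) \<and>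
    (\<forall>a\<in>obj C. \<forall>x\<in>carrier (val (W 0) a). f 0 a x = h 0 a (dW 0 a x)) \<and>
    (\<forall>n. \<forall>a\<in>obj C. \<forall>x\<in>carrier (val (W (Suc n)) a).
      f (Suc n) a x = h (Suc n) a (dW (Suc n) a x) \<otimes>\<^bsub>val (Y (Suc n)) a\<^esub> dY n a (h n a x))"
proof -
  note Yc = injective_cmodule_cmodule[OF Y]
  \<comment> \<open>\<open>Q\<close> is the homotopy formula linking two consecutive maps.
    \<open>P\<close> is what the next step requires: \<open>h\<close> after \<open>dW n\<close>
    agrees with \<open>f n\<close> once \<open>dY n\<close> is applied.\<close>
  define Q where "Q n h h' \<longleftrightarrow> (\<forall>a\<in>obj C. \<forall>x\<in>carrier (val (W (Suc n)) a). h' a (dW (Suc n) a x)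
     = f (Suc n) a x \<div>\<^bsub>val (Y (Suc n)) a\<^esub> dY n a (h a x))" for n and h h' :: "'o \<Rightarrow> 'u \<Rightarrow> 'u"
  define P where "P n h \<longleftrightarrow> h \<in> cmod_hom C (W (Suc n)) (Y n) \<and>
    (n = 0 \<longrightarrow> (\<forall>a\<in>obj C. \<forall>x\<in>carrier (val (W 0) a). h a (dW 0 a x) = f 0 a x)) \<and>
    (\<forall>a\<in>obj C. \<forall>x\<in>carrier (val (W n) a). dY n a (h a (dW n a x)) = dY n a (f n a x))" for n h
  have "\<exists>h\<in>cmod_hom C (W 1) (Y 0). \<forall>a\<in>obj C. \<forall>x\<in>carrier (val (W 0) a). h a (dW 0 a x) = f 0 a x"
    by (rule injective_cmodule_extend[OF Y inj_on_id W W _ f ker0]) (use dW[of 0] in auto)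
  then have P0: "\<exists>h. P 0 h" by (auto simp: P_def)
  have step: "\<exists>h'. P (Suc n) h' \<and> Q n h h'" if h: "P n h" for n h
  proof -
    have hh: "h \<in> cmod_hom C (W (Suc n)) (Y n)" using h by (simp add: P_def)
    let ?g = "\<lambda>a x. f (Suc n) a x \<div>\<^bsub>val (Y (Suc n)) a\<^esub> dY n a (h a x)"
    have g: "?g \<in> cmod_hom C (W (Suc n)) (Y (Suc n))"
      by (rule cmod_hom_diff[OF f cmod_hom_comp[OF hh dY] Yc])
    have "\<exists>h'\<in>cmod_hom C (W (Suc (Suc n))) (Y (Suc n)).
      \<forall>a\<in>obj C. \<forall>x\<in>carrier (val (W (Suc n)) a). h' a (dW (Suc n) a x) = ?g a x"
    proof (rule injective_cmodule_extend[OF Y inj_on_id W W dW g])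
      fix a x assume a: "a \<in> obj C" and x: "x \<in> carrier (val (W (Suc n)) a)" "dW (Suc n) a x =
          \<one>\<^bsub>val (W (Suc (Suc n))) a\<^esub>"
      obtain y where y: "y \<in> carrier (val (W n) a)" "dW n a y = x" using exact[OF a x] by blast
      have "f (Suc n) a x = dY n a (h a x)" using h a y(1) chain[OF a y(1)]
          by (simp add: P_def y(2)[symmetric])
      moreover have "f (Suc n) a x \<in> carrier (val (Y (Suc n)) a)" by (rule cmod_hom_closed[OF f a x(1)])
      ultimately show "?g a x = \<one>\<^bsub>val (Y (Suc n)) a\<^esub>"
        using comm_group_diff_self[OF cmodule_comm_group[OF Yc a]] by simp
    qed
    then obtain h' where h': "h' \<in> cmod_hom C (W (Suc (Suc n))) (Y (Suc n))"
      "\<And>a x. a \<in> obj C \<Longrightarrow> x \<in> carrier (val (W (Suc n)) a) \<Longrightarrow> h' a (dW (Suc n) a x) = ?g a x" by blast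
    have "dY (Suc n) a (h' a (dW (Suc n) a x)) = dY (Suc n) a (f (Suc n) a x)"
      if a: "a \<in> obj C" and x: "x \<in> carrier (val (W (Suc n)) a)" for a x
    proof -
      note c = cmod_hom_closed[OF f a x] cmod_hom_closed[OF hh a x]
      have "dY (Suc n) a (?g a x) = dY (Suc n) a (f (Suc n) a x) \<div>\<^bsub>val (Y (Suc (Suc n))) a\<^esub> dY (Suc n) a (dY
          n a (h a x))"
        by (rule hom_diff) (use c a in \<open>auto intro: cmod_hom_hom dY cmodule_comm_group Yc cmod_hom_closed\<close>)
      then show ?thesis
        using dYdY[OF a c(2)] comm_group_diff_one[OF cmodule_comm_group[OF Yc a] cmod_hom_closed[OF dY a
            c(1)]] h'(2)[OF a x]
        by simp
    qed
    then have "P (Suc n) h'" using h'(1) by (simp add: P_def)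
    then show ?thesis using h'(2) by (auto simp: Q_def)
  qed
  obtain h where h: "\<And>n. P n (h n)" "\<And>n. Q n (h n) (h (Suc n))"
    using dependent_nat_choice[of P Q, OF P0 step] by blast
  have "f (Suc n) a x = h (Suc n) a (dW (Suc n) a x) \<otimes>\<^bsub>val (Y (Suc n)) a\<^esub> dY n a (h n a x)"
    if a: "a \<in> obj C" and x: "x \<in> carrier (val (W (Suc n)) a)" for n a x
  proof -
    have "h n \<in> cmod_hom C (W (Suc n)) (Y n)" using h(1)[of n] by (simp add: P_def)
    then have "dY n a (h n a x) \<in> carrier (val (Y (Suc n)) a)" using a x cmod_hom_closed dY by metis
    then show ?thesis
      using h(2)[of n] comm_group_diff_mult[OF cmodule_comm_group[OF Yc a] cmod_hom_closed[OF f a x]] a x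
      by (simp add: Q_def)
  qed
  then show ?thesis using h(1) by (intro exI[of _ h]) (auto simp: P_def)
qed

text \<open>The comparison theorem of homological algebra, with exactness on the side of the source
  and injectivity on that of the target. It supplies a map in the direction opposite to a given
  comparison.\<close>

lemma chain_map_extension_exists:
  fixes A :: "('o, 'r, 'x) cmod" and W :: "nat \<Rightarrow> ('o, 'r, 'u) cmod" and Y :: "nat \<Rightarrow> ('o, 'r, 'u) cmod"
  assumes A: "cmodule C A" and W: "\<And>n. cmodule C (W n)" and Y: "\<And>n. injective_cmodule C (Y n)"
    and dW: "\<And>n. dW n \<in> cmod_hom C (W n) (W (Suc n))" and dY: "\<And>n. dY n \<in> cmod_hom C (Y n) (Y (Suc n))"
    and u: "u \<in> cmod_hom C A (W 0)" and v: "v \<in> cmod_hom C A (Y 0)"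
    and dYdY: "\<And>n a y. a \<in> obj C \<Longrightarrow> y \<in> carrier (val (Y n) a) \<Longrightarrow>
      dY (Suc n) a (dY n a y) = \<one>\<^bsub>val (Y (Suc (Suc n))) a\<^esub>"
    and dYv: "\<And>a x. a \<in> obj C \<Longrightarrow> x \<in> carrier (val A a) \<Longrightarrow> dY 0 a (v a x) = \<one>\<^bsub>val (Y 1) a\<^esub>"
    and inj: "\<And>a x. \<lbrakk>a \<in> obj C; x \<in> carrier (val A a); u a x = \<one>\<^bsub>val (W 0) a\<^esub>\<rbrakk> \<Longrightarrow> v a x = \<one>\<^bsub>val (Y 0) a\<^esub>"
    and exact0: "\<And>a x. \<lbrakk>a \<in> obj C; x \<in> carrier (val (W 0) a); dW 0 a x = \<one>\<^bsub>val (W 1) a\<^esub>\<rbrakk> \<Longrightarrow> \<exists>y\<in>carrier (val A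
        a). u a y = x"
    and exact: "\<And>n a x. \<lbrakk>a \<in> obj C; x \<in> carrier (val (W (Suc n)) a); dW (Suc n) a x =
        \<one>\<^bsub>val (W (Suc (Suc n))) a\<^esub>\<rbrakk> \<Longrightarrow> \<exists>y\<in>carrier (val (W n) a). dW n a y = x"
  shows "\<exists>f. (\<forall>n. f n \<in> cmod_hom C (W n) (Y n)) \<and>
    (\<forall>a\<in>obj C. \<forall>x\<in>carrier (val A a). f 0 a (u a x) = v a x) \<and>
    (\<forall>n. \<forall>a\<in>obj C. \<forall>x\<in>carrier (val (W n) a). f (Suc n) a (dW n a x) = dY n a (f n a x))"
proof -
  note Yc = injective_cmodule_cmodule[OF Y]
  define Q where "Q n f f' \<longleftrightarrow> (\<forall>a\<in>obj C. \<forall>x\<in>carrier (val (W n) a). f' a (dW n a x) = dY n a (f a x))"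
    for n and f f' :: "'o \<Rightarrow> 'u \<Rightarrow> 'u"
  \<comment> \<open>\<open>P\<close> records that \<open>f\<close> preserves cocycles: then
    \<open>dY n\<close> after \<open>f\<close> kills the kernel of \<open>dW n\<close> and so
    extends along \<open>dW n\<close>.\<close>
  define P where "P n f \<longleftrightarrow> f \<in> cmod_hom C (W n) (Y n) \<and>
    (n = 0 \<longrightarrow> (\<forall>a\<in>obj C. \<forall>x\<in>carrier (val A a). f a (u a x) = v a x)) \<and>
    (\<forall>a\<in>obj C. \<forall>x\<in>carrier (val (W n) a). dW n a x = \<one>\<^bsub>val (W (Suc n)) a\<^esub> \<longrightarrow>
      dY n a (f a x) = \<one>\<^bsub>val (Y (Suc n)) a\<^esub>)" for n f
  have "\<exists>f\<in>cmod_hom C (W 0) (Y 0). \<forall>a\<in>obj C. \<forall>x\<in>carrier (val A a). f a (u a x) = v a x"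
    by (rule injective_cmodule_extend[OF Y inj_on_id A W u v inj])
  then obtain f where f: "f \<in> cmod_hom C (W 0) (Y 0)"
    "\<And>a x. a \<in> obj C \<Longrightarrow> x \<in> carrier (val A a) \<Longrightarrow> f a (u a x) = v a x" by blast
  have "dY 0 a (f a x) = \<one>\<^bsub>val (Y 1) a\<^esub>"
    if a: "a \<in> obj C" and x: "x \<in> carrier (val (W 0) a)" "dW 0 a x = \<one>\<^bsub>val (W 1) a\<^esub>" for a x
    using exact0[OF a x] f(2)[OF a] dYv[OF a] by auto
  then have P0: "\<exists>f. P 0 f" using f by (auto simp: P_def)
  have step: "\<exists>f'. P (Suc n) f' \<and> Q n f f'" if f: "P n f" for n f
  proof -
    have ff: "f \<in> cmod_hom C (W n) (Y n)" using f by (simp add: P_def)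
    have "\<exists>f'\<in>cmod_hom C (W (Suc n)) (Y (Suc n)).
      \<forall>a\<in>obj C. \<forall>x\<in>carrier (val (W n) a). f' a (dW n a x) = (\<lambda>a x. dY n a (f a x)) a x"
      by (rule injective_cmodule_extend[OF Y inj_on_id W W dW cmod_hom_comp[OF ff dY]])
        (use f in \<open>auto simp: P_def\<close>)
    then obtain f' where f': "f' \<in> cmod_hom C (W (Suc n)) (Y (Suc n))"
      "\<And>a x. a \<in> obj C \<Longrightarrow> x \<in> carrier (val (W n) a) \<Longrightarrow> f' a (dW n a x) = dY n a (f a x)" by blast
    have "dY (Suc n) a (f' a x) = \<one>\<^bsub>val (Y (Suc (Suc n))) a\<^esub>"
      if a: "a \<in> obj C" and x: "x \<in> carrier (val (W (Suc n)) a)" "dW (Suc n) a x =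
          \<one>\<^bsub>val (W (Suc (Suc n))) a\<^esub>" for a x
      using exact[OF a x] f'(2)[OF a] dYdY[OF a] cmod_hom_closed[OF ff a] by auto
    then have "P (Suc n) f'" using f'(1) by (simp add: P_def)
    then show ?thesis using f'(2) by (auto simp: Q_def)
  qed
  obtain f where f: "\<And>n. P n (f n)" "\<And>n. Q n (f n) (f (Suc n))"
    using dependent_nat_choice[of P Q, OF P0 step] by blast
  have "\<forall>n. f n \<in> cmod_hom C (W n) (Y n)" using f(1) by (simp add: P_def)
  moreover have "\<forall>a\<in>obj C. \<forall>x\<in>carrier (val A a). f 0 a (u a x) = v a x" using f(1)[of 0]
      by (simp add: P_def)
  moreover have "\<forall>n. \<forall>a\<in>obj C. \<forall>x\<in>carrier (val (W n) a). f (Suc n) a (dW n a x) = dY n a (f n a x)"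
    using f(2) by (simp add: Q_def)
  ultimately show ?thesis by (intro exI[of _ f] conjI)
qed

section \<open>Cohomology of complexes of abelian groups\<close>

definition cochain_complex :: "(nat \<Rightarrow> 'x monoid) \<Rightarrow> (nat \<Rightarrow> 'x \<Rightarrow> 'x) \<Rightarrow> bool" where
  "cochain_complex K d \<longleftrightarrow> (\<forall>n. comm_group (K n) \<and> d n \<in> hom (K n) (K (Suc n)) \<and>
     (\<forall>x\<in>carrier (K n). d (Suc n) (d n x) = \<one>\<^bsub>K (Suc (Suc n))\<^esub>))"

definition cochain_map ::
  "(nat \<Rightarrow> 'x monoid) \<Rightarrow> (nat \<Rightarrow> 'x \<Rightarrow> 'x) \<Rightarrow> (nat \<Rightarrow> 'y monoid) \<Rightarrow> (nat \<Rightarrow> 'y \<Rightarrow> 'y) \<Rightarrow> (nat \<Rightarrow> 'x \<Rightarrow> 'y) \<Rightarrow> bool" where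
  "cochain_map K d L e f \<longleftrightarrow> (\<forall>n. f n \<in> hom (K n) (L n) \<and>
     (\<forall>x\<in>carrier (K n). f (Suc n) (d n x) = e n (f n x)))"

text \<open>Injectivity and surjectivity on cohomology, expressed by representatives, so that such
  maps can be built and composed without handling cosets.\<close>

definition quasi_iso ::
  "(nat \<Rightarrow> 'x monoid) \<Rightarrow> (nat \<Rightarrow> 'x \<Rightarrow> 'x) \<Rightarrow> (nat \<Rightarrow> 'y monoid) \<Rightarrow> (nat \<Rightarrow> 'y \<Rightarrow> 'y) \<Rightarrow> (nat \<Rightarrow> 'x \<Rightarrow> 'y) \<Rightarrow> bool" where
  "quasi_iso K d L e f \<longleftrightarrow> cochain_map K d L e f \<and>
     (\<forall>n. \<forall>x\<in>cocycles K d n. f n x \<in> coboundaries L e n \<longrightarrow> x \<in> coboundaries K d n) \<and>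
     (\<forall>n. \<forall>y\<in>cocycles L e n. \<exists>x\<in>cocycles K d n. f n x \<div>\<^bsub>L n\<^esub> y \<in> coboundaries L e n)"

lemma cochain_complexD:
  assumes "cochain_complex K d"
  shows "comm_group (K n)" "d n \<in> hom (K n) (K (Suc n))"
    "x \<in> carrier (K n) \<Longrightarrow> d (Suc n) (d n x) = \<one>\<^bsub>K (Suc (Suc n))\<^esub>"
  using assms by (simp_all add: cochain_complex_def)

lemma subgroup_cocycles:
  assumes "cochain_complex K d"
  shows "subgroup (cocycles K d n) (K n)"
  unfolding cocycles_def
  by (rule group_hom.subgroup_kernel)
     (use cochain_complexD[OF assms] in \<open>simp add: group_hom_def group_hom_axioms_def comm_group.axioms\<close>)

lemma subgroup_coboundaries:
  assumes "cochain_complex K d"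
  shows "subgroup (coboundaries K d n) (K n)"
proof (cases n)
  case 0
  show ?thesis using cochain_complexD(1)[OF assms, of 0]
      by (simp add: 0 coboundaries_def group.triv_subgroup comm_group.axioms)
next
  case (Suc m)
  show ?thesis
    using hom_image_subgroup[OF cochain_complexD(2)[OF assms, of m]] cochain_complexD(1)[OF assms]
    by (simp add: Suc coboundaries_def)
qed

lemma coboundaries_subset_cocycles:
  assumes "cochain_complex K d"
  shows "coboundaries K d n \<subseteq> cocycles K d n"
proof (cases n)
  case 0
  show ?thesis using subgroup.one_closed[OF subgroup_cocycles[OF assms, of 0]]
      by (simp add: 0 coboundaries_def)
next
  case (Suc m)
  show ?thesis
    using cochain_complexD(3)[OF assms] hom_in_carrier[OF cochain_complexD(2)[OF assms, of m]]
    by (auto simp: Suc coboundaries_def cocycles_def kernel_def)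
qed

lemma cochain_mapD:
  assumes "cochain_map K d L e f"
  shows "f n \<in> hom (K n) (L n)" "x \<in> carrier (K n) \<Longrightarrow> f (Suc n) (d n x) = e n (f n x)"
  using assms by (simp_all add: cochain_map_def)

lemma cochain_map_cocycles:
  assumes "cochain_complex K d" "cochain_complex L e" "cochain_map K d L e f" "x \<in> cocycles K d n"
  shows "f n x \<in> cocycles L e n"
proof -
  have x: "x \<in> carrier (K n)" "d n x = \<one>\<^bsub>K (Suc n)\<^esub>" using assms(4) by (simp_all add: cocycles_def kernel_def)
  have "e n (f n x) = f (Suc n) (d n x)" by (rule cochain_mapD(2)[OF assms(3) x(1), symmetric])
  also have "\<dots> = \<one>\<^bsub>L (Suc n)\<^esub>"
    unfolding x(2) by (rule hom_one_comm[OF cochain_mapD(1)[OF assms(3)] cochain_complexD(1)[OF assms(1)]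
        cochain_complexD(1)[OF assms(2)]])
  finally show ?thesis using hom_in_carrier[OF cochain_mapD(1)[OF assms(3)] x(1)]
      by (simp add: cocycles_def kernel_def)
qed

lemma cochain_map_coboundaries:
  assumes "cochain_complex K d" "cochain_complex L e" "cochain_map K d L e f" "x \<in> coboundaries K d n"
  shows "f n x \<in> coboundaries L e n"
proof (cases n)
  case 0
  show ?thesis
    using assms(4) hom_one_comm[OF cochain_mapD(1)[OF assms(3)] cochain_complexD(1)[OF assms(1)]
        cochain_complexD(1)[OF assms(2)]]
    by (simp add: 0 coboundaries_def)
next
  case (Suc m)
  then obtain w where w: "w \<in> carrier (K m)" "x = d m w" using assms(4) by (auto simp: coboundaries_def)
  then show ?thesis
    using cochain_mapD(2)[OF assms(3) w(1)] hom_in_carrier[OF cochain_mapD(1)[OF assms(3)] w(1)]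
    by (simp add: Suc coboundaries_def)
qed

lemma rcoset_eq_iff:
  assumes "group G" "subgroup B G" "x \<in> carrier G" "y \<in> carrier G"
  shows "B #>\<^bsub>G\<^esub> x = B #>\<^bsub>G\<^esub> y \<longleftrightarrow> x \<div>\<^bsub>G\<^esub> y \<in> B"
proof -
  interpret G: group G by fact
  show ?thesis
    using G.rcos_self[OF assms(3,2)] subgroup.rcos_module[OF assms(2,1,4,3)] G.repr_independence[OF _
        assms(4,2)] by metis
qed

lemma r_coset_carrier: "B #>\<^bsub>G\<lparr>carrier := Z\<rparr>\<^esub> x = B #>\<^bsub>G\<^esub> x"
  by (simp add: r_coset_def)

lemma quasi_iso_cohomology:
  assumes K: "cochain_complex K d" and L: "cochain_complex L e" and f: "quasi_iso K d L e f"
  shows "cohomology_map L e f n \<in> iso (cohomology K d n) (cohomology L e n)"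
proof -
  let ?ZK = "(K n)\<lparr>carrier := cocycles K d n\<rparr>" and ?ZL = "(L n)\<lparr>carrier := cocycles L e n\<rparr>"
  let ?BK = "coboundaries K d n" and ?BL = "coboundaries L e n"
  interpret Kn: comm_group "K n" by (rule cochain_complexD(1)[OF K])
  interpret Ln: comm_group "L n" by (rule cochain_complexD(1)[OF L])
  note sK = subgroup_cocycles[OF K, of n] and sL = subgroup_cocycles[OF L, of n]
  have fm: "cochain_map K d L e f" using f by (simp add: quasi_iso_def)
  have ZK: "comm_group ?ZK" by (rule comm_group_subgroup[OF Kn.comm_group_axioms sK])
  have ZL: "comm_group ?ZL" by (rule comm_group_subgroup[OF Ln.comm_group_axioms sL])
  note bK = subgroup_coboundaries[OF K, of n] and bL = subgroup_coboundaries[OF L, of n]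
  have BK: "?BK \<lhd> ?ZK"
    by (intro comm_group.subgroup_imp_normal ZK Kn.subgroup_incl bK sK coboundaries_subset_cocycles[OF K])
  have BL: "?BL \<lhd> ?ZL"
    by (intro comm_group.subgroup_imp_normal ZL Ln.subgroup_incl bL sL coboundaries_subset_cocycles[OF L])
  have carK: "carrier (cohomology K d n) = (\<lambda>x. ?BK #>\<^bsub>K n\<^esub> x) ` cocycles K d n"
    by (simp add: cohomology_def carrier_FactGroup r_coset_carrier)
  have carL: "carrier (cohomology L e n) = (\<lambda>x. ?BL #>\<^bsub>L n\<^esub> x) ` cocycles L e n"
    by (simp add: cohomology_def carrier_FactGroup r_coset_carrier)
  have multK: "(?BK #>\<^bsub>K n\<^esub> x) \<otimes>\<^bsub>cohomology K d n\<^esub> (?BK #>\<^bsub>K n\<^esub> y) = ?BK #>\<^bsub>K n\<^esub> (x \<otimes>\<^bsub>K n\<^esub> y)"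
    if "x \<in> cocycles K d n" "y \<in> cocycles K d n" for x y
    using normal.rcos_sum[OF BK, of x y] that by (simp add: cohomology_def r_coset_carrier)
  have multL: "(?BL #>\<^bsub>L n\<^esub> x) \<otimes>\<^bsub>cohomology L e n\<^esub> (?BL #>\<^bsub>L n\<^esub> y) = ?BL #>\<^bsub>L n\<^esub> (x \<otimes>\<^bsub>L n\<^esub> y)"
    if "x \<in> cocycles L e n" "y \<in> cocycles L e n" for x y
    using normal.rcos_sum[OF BL, of x y] that by (simp add: cohomology_def r_coset_carrier)
  have cK: "x \<in> carrier (K n)" if "x \<in> cocycles K d n" for x using subgroup.mem_carrier[OF sK that] .
  have cL: "x \<in> carrier (L n)" if "x \<in> cocycles L e n" for x using subgroup.mem_carrier[OF sL that] .
  note fh = cochain_mapD(1)[OF fm, of n] and fz = cochain_map_cocycles[OF K L fm, of _ n]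
  \<comment> \<open>Members of a coset differ by coboundaries, which \<open>f n\<close> preserves;
    so the union defining \<open>cohomology_map\<close> is a single class.\<close>
  have val: "cohomology_map L e f n (?BK #>\<^bsub>K n\<^esub> x) = ?BL #>\<^bsub>L n\<^esub> f n x" if x: "x \<in> cocycles K d n" for x
  proof -
    have "?BL #>\<^bsub>L n\<^esub> f n z = ?BL #>\<^bsub>L n\<^esub> f n x" if z: "z \<in> ?BK #>\<^bsub>K n\<^esub> x" for z
    proof -
      have zc: "z \<in> carrier (K n)"
        using z Kn.r_coset_subset_G[OF subgroup.subset[OF bK] cK[OF x]] by blast
      have "z \<div>\<^bsub>K n\<^esub> x \<in> ?BK"
        using z subgroup.rcos_module[OF bK Kn.is_group cK[OF x] zc] by blast
      then have "f n z \<div>\<^bsub>L n\<^esub> f n x \<in> ?BL"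
        using cochain_map_coboundaries[OF K L fm] hom_diff[OF fh Kn.comm_group_axioms Ln.comm_group_axioms
            zc cK[OF x]] by metis
      then show ?thesis
        using rcoset_eq_iff[OF Ln.is_group bL hom_in_carrier[OF fh zc] hom_in_carrier[OF fh cK[OF x]]] by
            blast
    qed
    moreover have "x \<in> ?BK #>\<^bsub>K n\<^esub> x" by (rule Kn.rcos_self[OF cK[OF x] bK])
    ultimately show ?thesis unfolding cohomology_map_def by blast
  qed
  show ?thesis
  proof (rule isoI)
    show "cohomology_map L e f n \<in> hom (cohomology K d n) (cohomology L e n)"
    proof (rule homI)
      fix c assume "c \<in> carrier (cohomology K d n)"
      then show "cohomology_map L e f n c \<in> carrier (cohomology L e n)"
        using val fz by (auto simp: carK carL)
    next
      fix c c' assume "c \<in> carrier (cohomology K d n)" "c' \<in> carrier (cohomology K d n)"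
      then obtain x y where x: "x \<in> cocycles K d n" "c = ?BK #>\<^bsub>K n\<^esub> x" and y: "y \<in> cocycles K d n" "c' = ?BK
          #>\<^bsub>K n\<^esub> y"
        by (auto simp: carK)
      have xy: "x \<otimes>\<^bsub>K n\<^esub> y \<in> cocycles K d n" by (rule subgroup.m_closed[OF sK x(1) y(1)])
      show "cohomology_map L e f n (c \<otimes>\<^bsub>cohomology K d n\<^esub> c')
        = cohomology_map L e f n c \<otimes>\<^bsub>cohomology L e n\<^esub> cohomology_map L e f n c'"
        using val[OF xy] val[OF x(1)] val[OF y(1)] multK[OF x(1) y(1)] multL[OF fz[OF x(1)] fz[OF y(1)]]
          hom_mult[OF fh cK[OF x(1)] cK[OF y(1)]] by (simp add: x(2) y(2))
    qed
    show "bij_betw (cohomology_map L e f n) (carrier (cohomology K d n)) (carrier (cohomology L e n))"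
    proof (rule bij_betwI')
      fix c c' assume "c \<in> carrier (cohomology K d n)" "c' \<in> carrier (cohomology K d n)"
      then obtain x y where x: "x \<in> cocycles K d n" "c = ?BK #>\<^bsub>K n\<^esub> x" and y: "y \<in> cocycles K d n" "c' = ?BK
          #>\<^bsub>K n\<^esub> y"
        by (auto simp: carK)
      have "c = c'" if "cohomology_map L e f n c = cohomology_map L e f n c'"
      proof -
        have "?BL #>\<^bsub>L n\<^esub> f n x = ?BL #>\<^bsub>L n\<^esub> f n y" using that val x y by simp
        then have "f n x \<div>\<^bsub>L n\<^esub> f n y \<in> ?BL"
          using rcoset_eq_iff[OF Ln.is_group bL] hom_in_carrier[OF fh] cK x(1) y(1) by blast
        then have "f n (x \<div>\<^bsub>K n\<^esub> y) \<in> ?BL"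
          using hom_diff[OF fh Kn.comm_group_axioms Ln.comm_group_axioms] cK x(1) y(1) by simp
        moreover have "x \<div>\<^bsub>K n\<^esub> y \<in> cocycles K d n"
          by (rule subgroup.m_closed[OF sK x(1) subgroup.m_inv_closed[OF sK y(1)]])
        ultimately have "x \<div>\<^bsub>K n\<^esub> y \<in> ?BK" using f by (simp add: quasi_iso_def)
        then show ?thesis using rcoset_eq_iff[OF Kn.is_group bK] cK x y by blast
      qed
      then show "(cohomology_map L e f n c = cohomology_map L e f n c') = (c = c')" by blast
    next
      fix c assume "c \<in> carrier (cohomology K d n)"
      then show "cohomology_map L e f n c \<in> carrier (cohomology L e n)"
        using val fz by (auto simp: carK carL)
    next
      fix c assume "c \<in> carrier (cohomology L e n)"
      then obtain y where y: "y \<in> cocycles L e n" "c = ?BL #>\<^bsub>L n\<^esub> y" by (auto simp: carL)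
      obtain x where x: "x \<in> cocycles K d n" "f n x \<div>\<^bsub>L n\<^esub> y \<in> ?BL"
        using f y(1) unfolding quasi_iso_def by blast
      have "?BL #>\<^bsub>L n\<^esub> f n x = ?BL #>\<^bsub>L n\<^esub> y"
        using rcoset_eq_iff[OF Ln.is_group bL] hom_in_carrier[OF fh] cK cL x y(1) by blast
      then show "\<exists>c'\<in>carrier (cohomology K d n). c = cohomology_map L e f n c'"
        using val[OF x(1)] x(1) y(2) by (auto simp: carK)
    qed
  qed
qed

lemma quasi_iso_comp:
  assumes K: "cochain_complex K d" and L: "cochain_complex L e" and N: "cochain_complex N b"
    and f: "quasi_iso K d L e f" and g: "quasi_iso L e N b g"
  shows "quasi_iso K d N b (\<lambda>n. g n \<circ> f n)"
proof -
  have fm: "cochain_map K d L e f" and gm: "cochain_map L e N b g" using f g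
      by (simp_all add: quasi_iso_def)
  note cN = cochain_complexD(1)[OF N] and fh = cochain_mapD(1)[OF fm] and gh = cochain_mapD(1)[OF gm]
  have "cochain_map K d N b (\<lambda>n. g n \<circ> f n)"
    unfolding cochain_map_def comp_def
  proof (intro allI conjI ballI)
    show "(\<lambda>x. g n (f n x)) \<in> hom (K n) (N n)" for n
      using Group.hom_compose[OF fh gh] by (simp add: comp_def)
    show "g (Suc n) (f (Suc n) (d n x)) = b n (g n (f n x))" if "x \<in> carrier (K n)" for n x
      using cochain_mapD(2)[OF fm that] cochain_mapD(2)[OF gm hom_in_carrier[OF fh that]] by simp
  qed
  moreover have "x \<in> coboundaries K d n" if "x \<in> cocycles K d n" "g n (f n x) \<in> coboundaries N b n" for n x
    using that f g cochain_map_cocycles[OF K L fm that(1)] by (simp add: quasi_iso_def)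
  moreover have "\<exists>x\<in>cocycles K d n. g n (f n x) \<div>\<^bsub>N n\<^esub> y \<in> coboundaries N b n"
    if y: "y \<in> cocycles N b n" for n y
  proof -
    interpret Nn: comm_group "N n" by (rule cN)
    obtain z where z: "z \<in> cocycles L e n" "g n z \<div>\<^bsub>N n\<^esub> y \<in> coboundaries N b n"
      using g y unfolding quasi_iso_def by blast
    obtain x where x: "x \<in> cocycles K d n" "f n x \<div>\<^bsub>L n\<^esub> z \<in> coboundaries L e n"
      using f z(1) unfolding quasi_iso_def by blast
    have xc: "x \<in> carrier (K n)" and zc: "z \<in> carrier (L n)" and yc: "y \<in> carrier (N n)"
      using x(1) z(1) y by (simp_all add: cocycles_def kernel_def)
    note fx = hom_in_carrier[OF fh xc]
    note c = hom_in_carrier[OF gh fx] hom_in_carrier[OF gh zc]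
    have "g n (f n x) \<div>\<^bsub>N n\<^esub> g n z \<in> coboundaries N b n"
      using cochain_map_coboundaries[OF L N gm x(2)] hom_diff[OF gh cochain_complexD(1)[OF L] cN fx zc] by
          simp
    from subgroup.m_closed[OF subgroup_coboundaries[OF N] this z(2)]
    have "g n (f n x) \<div>\<^bsub>N n\<^esub> y \<in> coboundaries N b n"
      using c yc by (simp add: Nn.m_assoc[symmetric]) (simp add: Nn.m_assoc)
    then show ?thesis using x(1) by blast
  qed
  ultimately show ?thesis by (simp add: quasi_iso_def)
qed

text \<open>Homotopies enter only through their effect on cocycles. If \<open>f n x\<close> is a
  coboundary, then \<open>x\<close> is the difference of the two coboundaries
  \<open>g n (f n x)\<close> and \<open>g n (f n x) - x\<close>, in additive terms; surjectivity is
  witnessed by \<open>g n y\<close>.\<close>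

lemma quasi_isoI_homotopy_inverse:
  assumes K: "cochain_complex K d" and L: "cochain_complex L e"
    and f: "cochain_map K d L e f" and g: "cochain_map L e K d g"
    and gf: "\<And>n x. x \<in> cocycles K d n \<Longrightarrow> g n (f n x) \<div>\<^bsub>K n\<^esub> x \<in> coboundaries K d n"
    and fg: "\<And>n y. y \<in> cocycles L e n \<Longrightarrow> f n (g n y) \<div>\<^bsub>L n\<^esub> y \<in> coboundaries L e n"
  shows "quasi_iso K d L e f"
proof -
  have "x \<in> coboundaries K d n" if x: "x \<in> cocycles K d n" "f n x \<in> coboundaries L e n" for n x
  proof -
    interpret Kn: comm_group "K n" by (rule cochain_complexD(1)[OF K])
    note s = subgroup_coboundaries[OF K, of n]
    have gfx: "g n (f n x) \<in> coboundaries K d n" by (rule cochain_map_coboundaries[OF L K g x(2)])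
    have "x \<in> carrier (K n)" using x(1) by (simp add: cocycles_def kernel_def)
    then have "inv\<^bsub>K n\<^esub> (g n (f n x) \<div>\<^bsub>K n\<^esub> x) \<otimes>\<^bsub>K n\<^esub> g n (f n x) = x"
      using subgroup.mem_carrier[OF s gfx] by (simp add: Kn.inv_mult Kn.m_ac)
    then show ?thesis using subgroup.m_closed[OF s subgroup.m_inv_closed[OF s gf[OF x(1)]] gfx] by simp
  qed
  moreover have "\<exists>x\<in>cocycles K d n. f n x \<div>\<^bsub>L n\<^esub> y \<in> coboundaries L e n" if "y \<in> cocycles L e n" for n y
    by (rule bexI[of _ "g n y"]) (rule fg[OF that], rule cochain_map_cocycles[OF L K g that])
  ultimately show ?thesis using f by (simp add: quasi_iso_def)
qed

section \<open>Inverse limits of modules and of complexes of modules\<close>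

lemma in_cat_lim:
  "x \<in> carrier (cat_lim C \<Phi>) \<longleftrightarrow> x \<in> (\<Pi>\<^sub>E a\<in>obj C. carrier (val \<Phi> a)) \<and>
     (\<forall>a\<in>obj C. \<forall>b\<in>obj C. \<forall>f\<in>mor C a b. arr \<Phi> a b f (x b) = x a)"
  by (simp add: cat_lim_def)

lemma cat_lim_closed: "x \<in> carrier (cat_lim C \<Phi>) \<Longrightarrow> a \<in> obj C \<Longrightarrow> x a \<in> carrier (val \<Phi> a)"
  by (auto simp: in_cat_lim)

lemma cat_lim_compat:
  "\<lbrakk>x \<in> carrier (cat_lim C \<Phi>); a \<in> obj C; b \<in> obj C; f \<in> mor C a b\<rbrakk> \<Longrightarrow> arr \<Phi> a b f (x b) = x a"
  by (simp add: in_cat_lim)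

lemma mult_cat_lim: "x \<otimes>\<^bsub>cat_lim C \<Phi>\<^esub> y = (\<lambda>a\<in>obj C. x a \<otimes>\<^bsub>val \<Phi> a\<^esub> y a)"
  by (simp add: cat_lim_def)

lemma one_cat_lim: "\<one>\<^bsub>cat_lim C \<Phi>\<^esub> = (\<lambda>a\<in>obj C. \<one>\<^bsub>val \<Phi> a\<^esub>)"
  by (simp add: cat_lim_def)

lemma restrict_in_cat_lim:
  assumes "\<And>a. a \<in> obj C \<Longrightarrow> x a \<in> carrier (val \<Phi> a)"
    "\<And>a b f. \<lbrakk>a \<in> obj C; b \<in> obj C; f \<in> mor C a b\<rbrakk> \<Longrightarrow> arr \<Phi> a b f (x b) = x a"
  shows "(\<lambda>a\<in>obj C. x a) \<in> carrier (cat_lim C \<Phi>)"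
  using assms by (auto simp: in_cat_lim)

lemma comm_group_cat_lim:
  assumes \<Phi>: "cmodule C \<Phi>"
  shows "comm_group (cat_lim C \<Phi>)"
proof (rule comm_groupI)
  note cg = cmodule_comm_group[OF \<Phi>] and ah = cmodule_arr_hom[OF \<Phi>]
  fix x assume x: "x \<in> carrier (cat_lim C \<Phi>)"
  note xc = cat_lim_closed[OF x] and xa = cat_lim_compat[OF x]
  show "\<one>\<^bsub>cat_lim C \<Phi>\<^esub> \<otimes>\<^bsub>cat_lim C \<Phi>\<^esub> x = x"
    using x comm_groupE(5)[OF cg xc]
        by (auto simp: mult_cat_lim one_cat_lim in_cat_lim PiE_iff extensional_def)
  have "(\<lambda>a\<in>obj C. inv\<^bsub>val \<Phi> a\<^esub> x a) \<in> carrier (cat_lim C \<Phi>)"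
    by (rule restrict_in_cat_lim) (simp_all add: comm_group_inv_closed cg xc hom_inv_comm[OF ah cg cg xc]
        xa)
  moreover have "(\<lambda>a\<in>obj C. inv\<^bsub>val \<Phi> a\<^esub> x a) \<otimes>\<^bsub>cat_lim C \<Phi>\<^esub> x = \<one>\<^bsub>cat_lim C \<Phi>\<^esub>"
    using cg xc by (auto simp: mult_cat_lim one_cat_lim group.l_inv comm_group.axioms intro!: restrict_ext)
  ultimately show "\<exists>y\<in>carrier (cat_lim C \<Phi>). y \<otimes>\<^bsub>cat_lim C \<Phi>\<^esub> x = \<one>\<^bsub>cat_lim C \<Phi>\<^esub>" by blast
  fix y assume y: "y \<in> carrier (cat_lim C \<Phi>)"
  note yc = cat_lim_closed[OF y] and ya = cat_lim_compat[OF y]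
  show "x \<otimes>\<^bsub>cat_lim C \<Phi>\<^esub> y \<in> carrier (cat_lim C \<Phi>)" unfolding mult_cat_lim
    by (rule restrict_in_cat_lim) (simp_all add: comm_groupE(1)[OF cg] xc yc hom_mult[OF ah] xa ya)
  show "x \<otimes>\<^bsub>cat_lim C \<Phi>\<^esub> y = y \<otimes>\<^bsub>cat_lim C \<Phi>\<^esub> x"
    unfolding mult_cat_lim by (rule restrict_ext) (rule comm_groupE(4)[OF cg]; simp add: xc yc)
  fix z assume z: "z \<in> carrier (cat_lim C \<Phi>)"
  show "x \<otimes>\<^bsub>cat_lim C \<Phi>\<^esub> y \<otimes>\<^bsub>cat_lim C \<Phi>\<^esub> z = x \<otimes>\<^bsub>cat_lim C \<Phi>\<^esub> (y \<otimes>\<^bsub>cat_lim C \<Phi>\<^esub> z)"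
    unfolding mult_cat_lim
    by (rule restrict_ext) (simp add: comm_groupE(3)[OF cg] xc yc cat_lim_closed[OF z])
next
  show "\<one>\<^bsub>cat_lim C \<Phi>\<^esub> \<in> carrier (cat_lim C \<Phi>)" unfolding one_cat_lim
    by (rule restrict_in_cat_lim) (simp_all add: comm_groupE(2)[OF cmodule_comm_group[OF \<Phi>]]
        cmodule_arr_one[OF \<Phi>])
qed

lemma inv_cat_lim:
  assumes "cmodule C \<Phi>" "x \<in> carrier (cat_lim C \<Phi>)" "a \<in> obj C"
  shows "(inv\<^bsub>cat_lim C \<Phi>\<^esub> x) a = inv\<^bsub>val \<Phi> a\<^esub> x a"
proof -
  have "(\<lambda>x. x a) \<in> hom (cat_lim C \<Phi>) (val \<Phi> a)"
    using assms(3) by (auto simp: hom_def cat_lim_closed mult_cat_lim)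
  from hom_inv_comm[OF this comm_group_cat_lim[OF assms(1)] cmodule_comm_group[OF assms(1,3)] assms(2)]
  show ?thesis .
qed

lemma lim_map_hom:
  assumes "\<eta> \<in> cmod_hom C \<Phi> \<Psi>"
  shows "lim_map C \<eta> \<in> hom (cat_lim C \<Phi>) (cat_lim C \<Psi>)"
proof (rule homI)
  fix x assume x: "x \<in> carrier (cat_lim C \<Phi>)"
  note xc = cat_lim_closed[OF x]
  show "lim_map C \<eta> x \<in> carrier (cat_lim C \<Psi>)" unfolding lim_map_def
    by (rule restrict_in_cat_lim)
      (simp_all add: cmod_hom_closed[OF assms] xc cmod_hom_natural[OF assms _ _ _ xc, symmetric]
          cat_lim_compat[OF x])
  fix y assume y: "y \<in> carrier (cat_lim C \<Phi>)"
  show "lim_map C \<eta> (x \<otimes>\<^bsub>cat_lim C \<Phi>\<^esub> y) = lim_map C \<eta> x \<otimes>\<^bsub>cat_lim C \<Psi>\<^esub> lim_map C \<eta> y"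
    unfolding mult_cat_lim lim_map_def
    by (rule restrict_ext) (simp add: hom_mult[OF cmod_hom_hom[OF assms]] xc cat_lim_closed[OF y])
qed

lemma lim_map_in_cat_lim:
  "\<eta> \<in> cmod_hom C \<Phi> \<Psi> \<Longrightarrow> x \<in> carrier (cat_lim C \<Phi>) \<Longrightarrow> lim_map C \<eta> x \<in> carrier (cat_lim C \<Psi>)"
  by (rule hom_in_carrier[OF lim_map_hom])

lemma lim_map_apply: "a \<in> obj C \<Longrightarrow> lim_map C \<eta> x a = \<eta> a (x a)"
  by (simp add: lim_map_def)

lemma cochain_complex_lim:
  assumes Y: "\<And>n. cmodule C (Y n)" and d: "\<And>n. d n \<in> cmod_hom C (Y n) (Y (Suc n))"
    and dd: "\<And>n a y. a \<in> obj C \<Longrightarrow> y \<in> carrier (val (Y n) a) \<Longrightarrow>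
      d (Suc n) a (d n a y) = \<one>\<^bsub>val (Y (Suc (Suc n))) a\<^esub>"
  shows "cochain_complex (\<lambda>n. cat_lim C (Y n)) (\<lambda>n. lim_map C (d n))"
  unfolding cochain_complex_def
proof (intro allI conjI ballI)
  show "lim_map C (d (Suc n)) (lim_map C (d n) x) = \<one>\<^bsub>cat_lim C (Y (Suc (Suc n)))\<^esub>"
    if "x \<in> carrier (cat_lim C (Y n))" for n x
    unfolding one_cat_lim lim_map_def[of C "d (Suc n)"]
    by (rule restrict_ext) (simp add: lim_map_apply dd cat_lim_closed[OF that])
qed (rule comm_group_cat_lim lim_map_hom Y d)+

lemma cochain_map_lim:
  assumes f: "\<And>n. f n \<in> cmod_hom C (W n) (Y n)"
    and chain: "\<And>n a x. a \<in> obj C \<Longrightarrow> x \<in> carrier (val (W n) a) \<Longrightarrow> f (Suc n) a (dW n a x) = dY n a (f n a x)"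
  shows "cochain_map (\<lambda>n. cat_lim C (W n)) (\<lambda>n. lim_map C (dW n))
    (\<lambda>n. cat_lim C (Y n)) (\<lambda>n. lim_map C (dY n)) (\<lambda>n. lim_map C (f n))"
  unfolding cochain_map_def
proof (intro allI conjI ballI)
  show "lim_map C (f (Suc n)) (lim_map C (dW n) x) = lim_map C (dY n) (lim_map C (f n) x)"
    if "x \<in> carrier (cat_lim C (W n))" for n x
    unfolding lim_map_def[of C "f (Suc n)"] lim_map_def[of C "dY n"]
    by (rule restrict_ext) (simp add: lim_map_apply chain cat_lim_closed[OF that])
qed (rule lim_map_hom f)+

lemma in_cocycles_lim:
  "x \<in> cocycles (\<lambda>n. cat_lim C (W n)) (\<lambda>n. lim_map C (d n)) n \<longleftrightarrow>
    x \<in> carrier (cat_lim C (W n)) \<and> (\<forall>a\<in>obj C. d n a (x a) = \<one>\<^bsub>val (W (Suc n)) a\<^esub>)"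
  by (auto simp: cocycles_def kernel_def one_cat_lim lim_map_def restrict_def fun_eq_iff)

text \<open>On a cocycle the term of the homotopy formula containing \<open>dW n\<close> drops out,
  and the other term is the limit of \<open>dY m\<close> applied to the limit of \<open>h m\<close>.
  In degree 0 nothing remains, in accordance with the trivial group of coboundaries there.\<close>

lemma lim_null_homotopic:
  assumes W: "\<And>n. cmodule C (W n)" and Y: "\<And>n. cmodule C (Y n)"
    and dW: "\<And>n. dW n \<in> cmod_hom C (W n) (W (Suc n))" and dY: "\<And>n. dY n \<in> cmod_hom C (Y n) (Y (Suc n))"
    and h: "\<And>n. h n \<in> cmod_hom C (W (Suc n)) (Y n)"
      "\<And>a x. a \<in> obj C \<Longrightarrow> x \<in> carrier (val (W 0) a) \<Longrightarrow> f 0 a x = h 0 a (dW 0 a x)"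
      "\<And>n a x. a \<in> obj C \<Longrightarrow> x \<in> carrier (val (W (Suc n)) a) \<Longrightarrow>
        f (Suc n) a x = h (Suc n) a (dW (Suc n) a x) \<otimes>\<^bsub>val (Y (Suc n)) a\<^esub> dY n a (h n a x)"
    and x: "x \<in> cocycles (\<lambda>n. cat_lim C (W n)) (\<lambda>n. lim_map C (dW n)) n"
  shows "n = 0 \<Longrightarrow> lim_map C (f n) x = \<one>\<^bsub>cat_lim C (Y 0)\<^esub>"
    "n = Suc m \<Longrightarrow> lim_map C (f n) x = lim_map C (dY m) (lim_map C (h m) x)"
proof -
  have xl: "x \<in> carrier (cat_lim C (W n))" and xd: "\<And>a. a \<in> obj C \<Longrightarrow> dW n a (x a) = \<one>\<^bsub>val (W (Suc n)) a\<^esub>"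
    using x by (simp_all add: in_cocycles_lim)
  note xc = cat_lim_closed[OF xl]
  show "lim_map C (f n) x = \<one>\<^bsub>cat_lim C (Y 0)\<^esub>" if n: "n = 0"
    unfolding one_cat_lim lim_map_def
  proof (rule restrict_ext)
    fix a assume a: "a \<in> obj C"
    show "f n a (x a) = \<one>\<^bsub>val (Y 0) a\<^esub>"
      using h(2)[OF a] xc[OF a] xd[OF a] cmod_hom_one[OF h(1) W Y a, of 0] by (simp add: n)
  qed
  show "lim_map C (f n) x = lim_map C (dY m) (lim_map C (h m) x)" if n: "n = Suc m"
    unfolding lim_map_def[of C "f n"] lim_map_def[of C "dY m"]
  proof (rule restrict_ext)
    fix a assume a: "a \<in> obj C"
    have xa: "x a \<in> carrier (val (W (Suc m)) a)" using xc[OF a] by (simp add: n)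
    have "f n a (x a) = \<one>\<^bsub>val (Y n) a\<^esub> \<otimes>\<^bsub>val (Y n) a\<^esub> dY m a (h m a (x a))"
      using h(3)[OF a xa] xd[OF a] cmod_hom_one[OF h(1) W Y a, of n] by (simp add: n)
    also have "\<dots> = dY m a (h m a (x a))"
      by (rule comm_groupE(5)[OF cmodule_comm_group[OF Y a]])
        (simp add: n cmod_hom_closed[OF dY a] cmod_hom_closed[OF h(1) a xa])
    finally show "f n a (x a) = dY m a (lim_map C (h m) x a)" by (simp add: lim_map_apply a)
  qed
qed

section \<open>Injective modules\<close>

lemma small_categoryD:
  assumes "small_category C"
  shows "a \<in> obj C \<Longrightarrow> idt C a \<in> mor C a a"
    "\<lbrakk>a \<in> obj C; b \<in> obj C; c \<in> obj C; f \<in> mor C a b; g \<in> mor C b c\<rbrakk> \<Longrightarrow> cmp C a b c g f \<in> mor C a c"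
    "\<lbrakk>a \<in> obj C; b \<in> obj C; f \<in> mor C a b\<rbrakk> \<Longrightarrow> cmp C a a b f (idt C a) = f"
    "\<lbrakk>a \<in> obj C; b \<in> obj C; f \<in> mor C a b\<rbrakk> \<Longrightarrow> cmp C a b b (idt C b) f = f"
    "\<lbrakk>a \<in> obj C; b \<in> obj C; c \<in> obj C; d \<in> obj C; f \<in> mor C a b; g \<in> mor C b c; h \<in> mor C c d\<rbrakk> \<Longrightarrow> cmp C a b
        d (cmp C b c d h g) f = cmp C a c d h (cmp C a b c g f)"
  using assms unfolding small_category_def by simp_all

lemma full_subcat_simps [simp]:
  "obj (full_subcat C S) = S" "mor (full_subcat C S) = mor C" "idt (full_subcat C S) = idt C" "cmp
      (full_subcat C S) = cmp C"
  by (simp_all add: full_subcat_def)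

lemma cmodule_full_subcat: "cmodule C \<Phi> \<Longrightarrow> S \<subseteq> obj C \<Longrightarrow> cmodule (full_subcat C S) \<Phi>"
  by (rule cmoduleI) (simp_all add: cmodule_comm_group cmodule_arr_hom cmodule_arr_id cmodule_arr_comp
      subset_iff)

lemma cmod_hom_full_subcat: "\<eta> \<in> cmod_hom C \<Phi> \<Psi> \<Longrightarrow> S \<subseteq> obj C \<Longrightarrow> \<eta> \<in> cmod_hom (full_subcat C S) \<Phi> \<Psi>"
  by (rule cmod_homI) (simp_all add: cmod_hom_hom cmod_hom_natural subset_iff)

text \<open>The source is recorded with the arrow because hom-sets of different pairs of objects may
  overlap.\<close>

definition incoming :: "('o, 'r) cat \<Rightarrow> 'o \<Rightarrow> ('o \<times> 'r) set" where
  "incoming C a = {(c, f). c \<in> obj C \<and> f \<in> mor C c a}"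

text \<open>At \<open>a\<close> this is the product over all \<open>c\<close> of the functions from
  \<open>mor C c a\<close> to \<open>val \<Phi> c\<close>: the module coinduced from the objects of
  \<open>C\<close> without their arrows, with \<open>godement_unit\<close> as the unit of the
  adjunction. Arrows only recompose indices, so limits and cochains can be handled one
  \<open>c\<close> at a time.\<close>

definition godement :: "('o, 'r) cat \<Rightarrow> ('o, 'r, 'u) cmod \<Rightarrow> ('o, 'r, 'o \<times> 'r \<Rightarrow> 'u) cmod" where
  "godement C \<Phi> = \<lparr>
     val = (\<lambda>a. product_group (incoming C a) (\<lambda>p. val \<Phi> (fst p))),
     arr = (\<lambda>a b g y. \<lambda>p\<in>incoming C a. y (fst p, cmp C (fst p) a b g (snd p)))\<rparr>"

definition godement_unit :: "('o, 'r) cat \<Rightarrow> ('o, 'r, 'u) cmod \<Rightarrow> 'o \<Rightarrow> 'u \<Rightarrow> 'o \<times> 'r \<Rightarrow> 'u" where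
  "godement_unit C \<Phi> a x = (\<lambda>p\<in>incoming C a. arr \<Phi> (fst p) a (snd p) x)"

lemma val_godement: "val (godement C \<Phi>) a = product_group (incoming C a) (\<lambda>p. val \<Phi> (fst p))"
  by (simp add: godement_def)

lemma arr_godement:
  "p \<in> incoming C a \<Longrightarrow> arr (godement C \<Phi>) a b g y p = y (fst p, cmp C (fst p) a b g (snd p))"
  by (simp add: godement_def)

lemma comm_group_product_group:
  assumes "\<And>i. i \<in> J \<Longrightarrow> comm_group (G i)"
  shows "comm_group (product_group J G)"
proof (rule group.group_comm_groupI)
  show "group (product_group J G)" using assms by (simp add: comm_group.axioms)
next
  fix x y assume "x \<in> carrier (product_group J G)" "y \<in> carrier (product_group J G)"
  then show "x \<otimes>\<^bsub>product_group J G\<^esub> y = y \<otimes>\<^bsub>product_group J G\<^esub> x"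
    using assms by (auto intro!: restrict_ext comm_groupE(4))
qed

context
  fixes C :: "('o, 'r) cat"
  assumes C: "small_category C"
begin

lemma incoming_comp:
  "\<lbrakk>a \<in> obj C; b \<in> obj C; g \<in> mor C a b; p \<in> incoming C a\<rbrakk> \<Longrightarrow> (fst p, cmp C (fst p) a b g (snd p)) \<in>
      incoming C b"
  by (auto simp: incoming_def small_categoryD[OF C])

lemma cmodule_godement:
  assumes \<Phi>: "cmodule C \<Phi>"
  shows "cmodule C (godement C \<Phi>)"
proof (rule cmoduleI)
  show "comm_group (val (godement C \<Phi>) a)" for a
    unfolding val_godement
    by (rule comm_group_product_group) (auto simp: incoming_def cmodule_comm_group[OF \<Phi>])
next
  fix a b f assume h: "a \<in> obj C" "b \<in> obj C" "f \<in> mor C a b"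
  note ic = incoming_comp[OF h]
  show "arr (godement C \<Phi>) a b f \<in> hom (val (godement C \<Phi>) b) (val (godement C \<Phi>) a)"
  proof (rule homI)
    fix x assume x: "x \<in> carrier (val (godement C \<Phi>) b)"
    have "x (fst p, cmp C (fst p) a b f (snd p)) \<in> carrier (val \<Phi> (fst p))" if "p \<in> incoming C a" for p
      using PiE_mem[OF x[unfolded val_godement carrier_product_group] ic[OF that]] by simp
    then show "arr (godement C \<Phi>) a b f x \<in> carrier (val (godement C \<Phi>) a)"
      by (auto simp: godement_def)
  next
    fix x y
    show "arr (godement C \<Phi>) a b f (x \<otimes>\<^bsub>val (godement C \<Phi>) b\<^esub> y)
      = arr (godement C \<Phi>) a b f x \<otimes>\<^bsub>val (godement C \<Phi>) a\<^esub> arr (godement C \<Phi>) a b f y"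
      using ic by (auto simp: godement_def intro!: restrict_ext)
  qed
next
  fix a x assume a: "a \<in> obj C" and x: "x \<in> carrier (val (godement C \<Phi>) a)"
  show "arr (godement C \<Phi>) a a (idt C a) x = x"
  proof (rule extensionalityI)
    show "arr (godement C \<Phi>) a a (idt C a) x \<in> extensional (incoming C a)" by (simp add: godement_def)
    show "x \<in> extensional (incoming C a)" using x by (auto simp: val_godement PiE_def)
    fix p assume "p \<in> incoming C a"
    then show "arr (godement C \<Phi>) a a (idt C a) x p = x p"
      using small_categoryD(4)[OF C _ a] by (auto simp: godement_def incoming_def)
  qed
next
  fix a b c f g x assume h: "a \<in> obj C" "b \<in> obj C" "c \<in> obj C" "f \<in> mor C a b" "g \<in> mor C b c"
    and x: "x \<in> carrier (val (godement C \<Phi>) c)"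
  show "arr (godement C \<Phi>) a c (cmp C a b c g f) x = arr (godement C \<Phi>) a b f (arr (godement C \<Phi>) b c g x)"
    unfolding godement_def
    using incoming_comp[OF h(1,2,4)] small_categoryD(5)[OF C _ h(1-3) _ h(4,5)]
    by (auto simp: incoming_def intro!: restrict_ext)
qed

lemma godement_unit_hom:
  assumes \<Phi>: "cmodule C \<Phi>"
  shows "godement_unit C \<Phi> \<in> cmod_hom C \<Phi> (godement C \<Phi>)"
proof (rule cmod_homI)
  fix a assume a: "a \<in> obj C"
  have h: "arr \<Phi> c a f \<in> hom (val \<Phi> a) (val \<Phi> c)" if "(c, f) \<in> incoming C a" for c f
    using that by (auto simp: incoming_def intro: cmodule_arr_hom[OF \<Phi> _ a])
  show "godement_unit C \<Phi> a \<in> hom (val \<Phi> a) (val (godement C \<Phi>) a)"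
    by (rule homI) (auto simp: godement_unit_def val_godement hom_in_carrier[OF h] hom_mult[OF h] intro!:
        restrict_ext)
next
  fix a b f x assume h: "a \<in> obj C" "b \<in> obj C" "f \<in> mor C a b" "x \<in> carrier (val \<Phi> b)"
  show "godement_unit C \<Phi> a (arr \<Phi> a b f x) = arr (godement C \<Phi>) a b f (godement_unit C \<Phi> b x)"
    unfolding godement_unit_def godement_def
    using incoming_comp[OF h(1-3)] cmodule_arr_comp[OF \<Phi> _ h(1,2) _ h(3,4)]
    by (auto simp: incoming_def intro!: restrict_ext)
qed

text \<open>The component of the unit at the identity arrow is the identity, so the unit is
  injective and the identity of \<open>I\<close> extends along it. The values of
  \<open>godement C I\<close> are functions, and \<open>e\<close> brings them back into the type of
  \<open>I\<close>. Properties that pass to retracts can thus be checked on Godement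
  modules.\<close>

lemma godement_retraction:
  fixes I :: "('o, 'r, 'u) cmod" and e :: "('o \<times> 'r \<Rightarrow> 'u) \<Rightarrow> 'u"
  assumes I: "injective_cmodule C I" and e: "inj e"
  shows "\<exists>r\<in>cmod_hom C (godement C I) I. \<forall>a\<in>obj C. \<forall>x\<in>carrier (val I a). r a (godement_unit C I a x) = x"
proof -
  note Ic = injective_cmodule_cmodule[OF I]
  have "\<exists>r\<in>cmod_hom C (godement C I) I. \<forall>a\<in>obj C. \<forall>x\<in>carrier (val I a). r a (godement_unit C I a x) = (\<lambda>a
      x. x) a x"
  proof (rule injective_cmodule_extend[OF I e Ic cmodule_godement[OF Ic] godement_unit_hom[OF Ic]])
    show "(\<lambda>a x. x) \<in> cmod_hom C I I" by (rule cmod_homI, rule homI) simp_all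
  next
    fix a x assume a: "a \<in> obj C" and x: "x \<in> carrier (val I a)" "godement_unit C I a x =
        \<one>\<^bsub>val (godement C I) a\<^esub>"
    have i: "(a, idt C a) \<in> incoming C a" using a by (simp add: incoming_def small_categoryD[OF C])
    have "x = godement_unit C I a x (a, idt C a)" using i
        by (simp add: godement_unit_def cmodule_arr_id[OF Ic a x(1)])
    also have "\<dots> = \<one>\<^bsub>val I a\<^esub>" using i by (simp add: x(2) val_godement)
    finally show "x = \<one>\<^bsub>val I a\<^esub>" .
  qed
  then show ?thesis by simp
qed

text \<open>In the Godement module the coordinate of an arrow from \<open>c\<close> is set to
  \<open>y c\<close> if \<open>c\<close> lies in \<open>S\<close>, and to one otherwise. It depends
  on the source only and is therefore compatible. Over an object of the sieve all sources lie in
  \<open>S\<close>, so there the family is the unit applied to \<open>y\<close>, and the retraction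
  returns \<open>y\<close>.\<close>

lemma lim_restrict_surj:
  fixes I :: "('o, 'r, 'u) cmod" and e :: "('o \<times> 'r \<Rightarrow> 'u) \<Rightarrow> 'u"
  assumes I: "injective_cmodule C I" and e: "inj e" and S: "S \<subseteq> obj C"
    and sieve: "\<And>a b f. \<lbrakk>a \<in> obj C; b \<in> S; f \<in> mor C a b\<rbrakk> \<Longrightarrow> a \<in> S"
    and y: "y \<in> carrier (cat_lim (full_subcat C S) I)"
  shows "\<exists>x\<in>carrier (cat_lim C I). lim_restrict (full_subcat C S) x = y"
proof -
  note Ic = injective_cmodule_cmodule[OF I]
  obtain r where r: "r \<in> cmod_hom C (godement C I) I"
    "\<And>a x. a \<in> obj C \<Longrightarrow> x \<in> carrier (val I a) \<Longrightarrow> r a (godement_unit C I a x) = x"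
    using godement_retraction[OF I e] by blast
  note yc = cat_lim_closed[OF y, simplified] and ya = cat_lim_compat[OF y, simplified]
  have cg: "comm_group (val I c)" if "c \<in> obj C" for c by (rule cmodule_comm_group[OF Ic that])
  let ?y = "\<lambda>a. \<lambda>p\<in>incoming C a. if fst p \<in> S then y (fst p) else \<one>\<^bsub>val I (fst p)\<^esub>"
  have "(\<lambda>a\<in>obj C. ?y a) \<in> carrier (cat_lim C (godement C I))"
  proof (rule restrict_in_cat_lim)
    show "?y a \<in> carrier (val (godement C I) a)" for a
      by (auto simp: val_godement yc incoming_def comm_groupE(2)[OF cg])
  next
    fix a b f assume "a \<in> obj C" "b \<in> obj C" "f \<in> mor C a b"
    then show "arr (godement C I) a b f (?y b) = ?y a"
      using incoming_comp by (auto simp: godement_def intro!: restrict_ext)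
  qed
  from lim_map_in_cat_lim[OF r(1) this]
  have "lim_map C r (\<lambda>a\<in>obj C. ?y a) \<in> carrier (cat_lim C I)" .
  moreover have "lim_restrict (full_subcat C S) (lim_map C r (\<lambda>a\<in>obj C. ?y a)) = y"
  proof (rule extensionalityI)
    show "y \<in> extensional S" using y by (auto simp: in_cat_lim PiE_def)
    fix a assume a: "a \<in> S"
    then have ao: "a \<in> obj C" using S by blast
    have "?y a = godement_unit C I a (y a)"
      unfolding godement_unit_def
      using sieve[OF _ a] ya[OF _ a] by (auto simp: incoming_def intro!: restrict_ext)
    then show "lim_restrict (full_subcat C S) (lim_map C r (\<lambda>a\<in>obj C. ?y a)) a = y a"
      using a r(2)[OF ao yc[OF a]] by (simp add: lim_restrict_def lim_map_def ao)
  qed (simp add: lim_restrict_def)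
  ultimately show ?thesis by blast
qed

end

text \<open>Outside \<open>S\<close> nothing is known about \<open>\<Phi>\<close>, not even that its
  unit is one; hence the one-element group on \<open>undefined\<close>.\<close>

definition extend_by_zero :: "'o set \<Rightarrow> ('o, 'r, 'u) cmod \<Rightarrow> ('o, 'r, 'u) cmod" where
  "extend_by_zero S \<Phi> = \<lparr>
     val = (\<lambda>a. if a \<in> S then val \<Phi> a else singleton_group undefined),
     arr = (\<lambda>a b f x. if b \<in> S then arr \<Phi> a b f x else if a \<in> S then \<one>\<^bsub>val \<Phi> a\<^esub> else undefined)\<rparr>"

text \<open>An arrow ending in the sieve also starts there, so every map added by the extension by
  zero has a trivial group as its domain. This makes the extension functorial, and a solution of the
  extended problem over \<open>C\<close> restricts to one over the subcategory.\<close>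

lemma injective_full_subcat:
  fixes C :: "('o, 'r) cat" and I :: "('o, 'r, 'u) cmod"
  assumes C: "small_category C" and I: "injective_cmodule C I" and S: "S \<subseteq> obj C"
    and sieve: "\<And>a b f. \<lbrakk>a \<in> obj C; b \<in> S; f \<in> mor C a b\<rbrakk> \<Longrightarrow> a \<in> S"
  shows "injective_cmodule (full_subcat C S) I"
  unfolding injective_cmodule_def
proof (intro conjI allI impI; (elim conjE)?)
  note Ic = injective_cmodule_cmodule[OF I]
  show "cmodule (full_subcat C S) I" by (rule cmodule_full_subcat[OF Ic S])
  let ?D = "full_subcat C S"
  have mod: "cmodule C (extend_by_zero S A)" if A: "cmodule ?D A" for A
  proof (rule cmoduleI)
    note cg = cmodule_comm_group[OF A, simplified] and ah = cmodule_arr_hom[OF A, simplified]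
    show "comm_group (val (extend_by_zero S A) a)" for a
      by (simp add: extend_by_zero_def cg)
    show "arr (extend_by_zero S A) a b f \<in> hom (val (extend_by_zero S A) b) (val (extend_by_zero S A) a)"
      if h: "a \<in> obj C" "b \<in> obj C" "f \<in> mor C a b" for a b f
      using ah[OF sieve[OF h(1) _ h(3)] _ h(3)] sieve[OF h(1) _ h(3)] comm_groupE(2)[OF cg]
          comm_groupE(5)[OF cg]
      by (auto simp: extend_by_zero_def hom_def singleton_group_def)
    show "arr (extend_by_zero S A) a a (idt C a) x = x"
      if "a \<in> obj C" "x \<in> carrier (val (extend_by_zero S A) a)" for a x
      using that cmodule_arr_id[OF A] by (auto simp: extend_by_zero_def split: if_splits)
    show "arr (extend_by_zero S A) a c (cmp C a b c g f) x
        = arr (extend_by_zero S A) a b f (arr (extend_by_zero S A) b c g x)"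
      if h: "a \<in> obj C" "b \<in> obj C" "c \<in> obj C" "f \<in> mor C a b" "g \<in> mor C b c"
        and x: "x \<in> carrier (val (extend_by_zero S A) c)" for a b c f g x
    proof (cases "c \<in> S")
      case True
      have b: "b \<in> S" by (rule sieve[OF h(2) True h(5)])
      have a: "a \<in> S" by (rule sieve[OF h(1) b h(4)])
      show ?thesis using cmodule_arr_comp[OF A, simplified, OF a b True h(4,5)] x
          by (simp add: extend_by_zero_def a b True)
    next
      case False
      show ?thesis
      proof (cases "b \<in> S")
        case True
        then show ?thesis using cmodule_arr_one[OF A, simplified, OF sieve[OF h(1) True h(4)] True h(4)]
            sieve[OF h(1) True h(4)] False
          by (simp add: extend_by_zero_def)
      qed (simp add: extend_by_zero_def False)
    qed
  qed
  fix A B \<iota> \<phi>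
  assume A: "cmodule ?D (A :: ('o, 'r, 'u) cmod)" and B: "cmodule ?D (B :: ('o, 'r, 'u) cmod)"
    and \<iota>: "\<iota> \<in> cmod_hom ?D A B" "\<forall>a\<in>obj ?D. inj_on (\<iota> a) (carrier (val A a))" and \<phi>: "\<phi> \<in> cmod_hom ?D A I"
  let ?A = "extend_by_zero S A" and ?B = "extend_by_zero S B"
  let ?\<iota> = "\<lambda>a x. if a \<in> S then \<iota> a x else undefined" and ?\<phi> = "\<lambda>a x. if a \<in> S then \<phi> a x else \<one>\<^bsub>val I a\<^esub>"
  have \<iota>': "?\<iota> \<in> cmod_hom C ?A ?B"
  proof (rule cmod_homI)
    show "?\<iota> a \<in> hom (val ?A a) (val ?B a)" for a
      using cmod_hom_hom[OF \<iota>(1), of a] by (auto simp: extend_by_zero_def hom_def singleton_group_def)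
    show "?\<iota> a (arr ?A a b f x) = arr ?B a b f (?\<iota> b x)"
      if h: "a \<in> obj C" "b \<in> obj C" "f \<in> mor C a b" "x \<in> carrier (val ?A b)" for a b f x
      using sieve[OF h(1) _ h(3)] cmod_hom_natural[OF \<iota>(1), of a b f x] cmod_hom_one[OF \<iota>(1) A B, of a] h
      by (auto simp: extend_by_zero_def)
  qed
  have \<phi>': "?\<phi> \<in> cmod_hom C ?A I"
  proof (rule cmod_homI)
    show "?\<phi> a \<in> hom (val ?A a) (val I a)" if "a \<in> obj C" for a
      using cmod_hom_hom[OF \<phi>, of a] comm_groupE(2,5)[OF cmodule_comm_group[OF Ic that]]
      by (auto simp: extend_by_zero_def hom_def)
    show "?\<phi> a (arr ?A a b f x) = arr I a b f (?\<phi> b x)"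
      if h: "a \<in> obj C" "b \<in> obj C" "f \<in> mor C a b" "x \<in> carrier (val ?A b)" for a b f x
      using sieve[OF h(1) _ h(3)] cmod_hom_natural[OF \<phi>, of a b f x] h
        cmod_hom_one[OF \<phi> A cmodule_full_subcat[OF Ic S], of a] cmodule_arr_one[OF Ic h(1-3)]
      by (auto simp: extend_by_zero_def)
  qed
  have "\<exists>\<psi>\<in>cmod_hom C ?B I. \<forall>a\<in>obj C. \<forall>x\<in>carrier (val ?A a). \<psi> a (?\<iota> a x) = ?\<phi> a x"
  proof (rule injective_cmodule_extend[OF I inj_on_id mod[OF A] mod[OF B] \<iota>' \<phi>'])
    fix a x assume h: "a \<in> obj C" "x \<in> carrier (val ?A a)" "?\<iota> a x = \<one>\<^bsub>val ?B a\<^esub>"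
    show "?\<phi> a x = \<one>\<^bsub>val I a\<^esub>"
    proof (cases "a \<in> S")
      case True
      then have x: "x \<in> carrier (val A a)" "\<iota> a x = \<one>\<^bsub>val B a\<^esub>" using h by (simp_all add: extend_by_zero_def)
      have o: "\<one>\<^bsub>val A a\<^esub> \<in> carrier (val A a)" using comm_groupE(2)[OF cmodule_comm_group[OF A]] True by simp
      have "x = \<one>\<^bsub>val A a\<^esub>"
        using \<iota>(2) x o True cmod_hom_one[OF \<iota>(1) A B, of a] by (simp add: inj_on_def)
      then show ?thesis using cmod_hom_one[OF \<phi> A cmodule_full_subcat[OF Ic S], of a] True by simp
    qed simp
  qed
  then obtain \<psi> where \<psi>: "\<psi> \<in> cmod_hom C ?B I"
    "\<forall>a\<in>obj C. \<forall>x\<in>carrier (val ?A a). \<psi> a (?\<iota> a x) = ?\<phi> a x" by blast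
  have \<psi>D: "\<psi> \<in> cmod_hom ?D B I"
  proof (rule cmod_homI)
    show "\<psi> a \<in> hom (val B a) (val I a)" if "a \<in> obj ?D" for a
      using cmod_hom_hom[OF \<psi>(1), of a] that S by (auto simp: extend_by_zero_def)
    show "\<psi> a (arr B a b f x) = arr I a b f (\<psi> b x)"
      if "a \<in> obj ?D" "b \<in> obj ?D" "f \<in> mor ?D a b" "x \<in> carrier (val B b)" for a b f x
      using cmod_hom_natural[OF \<psi>(1), of a b f x] that S by (auto simp: extend_by_zero_def)
  qed
  have "\<psi> a (\<iota> a x) = \<phi> a x" if "a \<in> S" "x \<in> carrier (val A a)" for a x
    using bspec[OF bspec[OF \<psi>(2) subsetD[OF S that(1)]], of x] that by (simp add: extend_by_zero_def)
  then have "\<forall>a\<in>obj ?D. \<forall>x\<in>carrier (val A a). \<psi> a (\<iota> a x) = \<phi> a x" by simp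
  then show "\<exists>\<psi>\<in>cmod_hom ?D B I. \<forall>a\<in>obj ?D. \<forall>x\<in>carrier (val A a). \<psi> a (\<iota> a x) = \<phi> a x"
    using \<psi>D by (rule bexI)
qed

text \<open>The index type \<open>nat \<times> 'o \<times> 'r\<close> is infinite because of its
  first factor, so it maps onto its own square. Composing with such a surjection turns a function of
  two indices into a function of one without loss, and a pair in \<open>'o \<times> 'r\<close> is
  part of an index.\<close>

lemma ex_inj_univ: "\<exists>e :: ('o \<times> 'r \<Rightarrow> ('o, 'r, 'a) univ) \<Rightarrow> ('o, 'r, 'a) univ. inj e"
proof -
  let ?T = "UNIV :: (nat \<times> 'o \<times> 'r) set"
  have "infinite ?T" by (simp add: finite_prod)
  then have "|?T \<times> ?T| =o |?T|" by (rule card_of_Times_same_infinite)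
  then obtain g where g: "g ` ?T = ?T \<times> ?T"
    using card_of_ordLeq2[of "?T \<times> ?T" ?T] ordIso_iff_ordLeq by blast
  let ?e = "\<lambda>(F :: 'o \<times> 'r \<Rightarrow> ('o, 'r, 'a) univ) t. F (snd (fst (g t))) (snd (g t))"
  have "inj ?e"
  proof (rule injI, rule ext, rule ext)
    fix F F' :: "'o \<times> 'r \<Rightarrow> ('o, 'r, 'a) univ" and p s assume F: "?e F = ?e F'"
    obtain t where "g t = ((0, p), s)" using g by (metis UNIV_Times_UNIV UNIV_I imageE)
    then show "F p s = F' p s" using fun_cong[OF F, of t] by simp
  qed
  then show ?thesis by blast
qed

section \<open>Directed diagrams\<close>

text \<open>A functor \<open>inc\<close> into \<open>C\<close> from a directed preorder on a set of
  objects. In the application \<open>J\<close> consists of the nontrivial finite subgroups of an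
  infinite \<open>p\<close>-subgroup, ordered by inclusion.\<close>

locale directed_diagram =
  fixes C :: "('o, 'r) cat" and J :: "'o set" and rel :: "'o \<Rightarrow> 'o \<Rightarrow> bool" and inc :: "'o \<Rightarrow> 'o \<Rightarrow> 'r"
  assumes C: "small_category C" and J: "J \<subseteq> obj C"
    and rel_refl: "a \<in> J \<Longrightarrow> rel a a"
    and rel_trans: "\<lbrakk>a \<in> J; b \<in> J; c \<in> J; rel a b; rel b c\<rbrakk> \<Longrightarrow> rel a c"
    and directed: "\<lbrakk>a \<in> J; b \<in> J\<rbrakk> \<Longrightarrow> \<exists>d\<in>J. rel a d \<and> rel b d"
    and inc_mor: "\<lbrakk>a \<in> J; b \<in> J; rel a b\<rbrakk> \<Longrightarrow> inc a b \<in> mor C a b"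
    and inc_refl: "a \<in> J \<Longrightarrow> inc a a = idt C a"
    and inc_comp: "\<lbrakk>a \<in> J; b \<in> J; c \<in> J; rel a b; rel b c\<rbrakk> \<Longrightarrow> cmp C a b c (inc b c) (inc a b) = inc a c"
begin

text \<open>Only values on chains with \<open>n\<close> vertices are constrained, so identities
  between cochains are asserted only there.\<close>

definition cochains :: "('o, 'r, 'u) cmod \<Rightarrow> nat \<Rightarrow> ('o list \<Rightarrow> 'u) set" where
  "cochains \<Phi> n = {x. \<forall>\<sigma>\<in>chains rel J n. x \<sigma> \<in> carrier (val \<Phi> (last \<sigma>))}"

text \<open>
  A cochain takes its value on a chain in the module at the last, that is smallest, element; \<open>pull\<close>
  restricts the values on the faces of a chain ending in \<open>q\<close> to \<open>q\<close>. The empty face contributes nothing.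
\<close>

definition pull :: "('o, 'r, 'u) cmod \<Rightarrow> 'o \<Rightarrow> ('o list \<Rightarrow> 'u) \<Rightarrow> 'o list \<Rightarrow> 'u" where
  "pull \<Phi> q x \<tau> = (if \<tau> = [] then \<one>\<^bsub>val \<Phi> q\<^esub> else arr \<Phi> q (last \<tau>) (inc q (last \<tau>)) (x \<tau>))"

definition cobd :: "('o, 'r, 'u) cmod \<Rightarrow> ('o list \<Rightarrow> 'u) \<Rightarrow> 'o list \<Rightarrow> 'u" where
  "cobd \<Phi> x \<sigma> = alt (val \<Phi> (last \<sigma>)) (pull \<Phi> (last \<sigma>) x) \<sigma>"

lemma J_obj: "a \<in> J \<Longrightarrow> a \<in> obj C"
  using J by blast

lemma last_chain: "\<sigma> \<in> chains rel J (Suc n) \<Longrightarrow> last \<sigma> \<in> J"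
  by (cases "\<sigma> = []") (auto simp: chains_def)

lemma last_subseq:
  assumes "\<sigma> \<in> chains rel J n" "subseq \<tau> \<sigma>" "\<tau> \<noteq> []"
  shows "last \<tau> \<in> J" "rel (last \<sigma>) (last \<tau>)"
proof -
  have l: "last \<tau> \<in> set \<sigma>" using set_subseq[OF assms(2)] assms(3) by auto
  then show "last \<tau> \<in> J" using assms(1) by (auto simp: chains_def)
  show "rel (last \<sigma>) (last \<tau>)" by (rule chains_last_le[OF assms(1) l rel_refl])
qed

lemma pull_closed:
  assumes "cmodule C \<Phi>" "x \<in> cochains \<Phi> n" "\<tau> \<in> chains rel J n" "q \<in> J" "\<tau> \<noteq> [] \<Longrightarrow> rel q (last \<tau>)"
  shows "pull \<Phi> q x \<tau> \<in> carrier (val \<Phi> q)"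
proof (cases "\<tau> = []")
  case True
  then show ?thesis using comm_groupE(2)[OF cmodule_comm_group[OF assms(1) J_obj[OF assms(4)]]]
      by (simp add: pull_def)
next
  case False
  then have l: "last \<tau> \<in> J" using assms(3) by (cases n) (auto simp: chains_def last_chain)
  show ?thesis
    using cmodule_arr_closed[OF assms(1) J_obj[OF assms(4)] J_obj[OF l] inc_mor[OF assms(4) l assms(5)[OF
        False]]] assms(2,3) False
    by (simp add: pull_def cochains_def)
qed

lemma pull_face_closed:
  assumes "cmodule C \<Phi>" "x \<in> cochains \<Phi> n" "\<sigma> \<in> chains rel J (Suc n)" "face \<tau> \<sigma>"
  shows "pull \<Phi> (last \<sigma>) x \<tau> \<in> carrier (val \<Phi> (last \<sigma>))"
  by (rule pull_closed[OF assms(1,2) chains_face[OF assms(4,3)] last_chain[OF assms(3)] last_subseq(2)[OF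
      assms(3)]])
    (use assms(4) in \<open>simp_all add: face_def\<close>)

lemma cobd_closed:
  assumes "cmodule C \<Phi>" "x \<in> cochains \<Phi> n"
  shows "cobd \<Phi> x \<in> cochains \<Phi> (Suc n)"
  unfolding cochains_def cobd_def
  by (auto intro!: comm_group.alt_closed[OF cmodule_comm_group[OF assms(1) J_obj[OF last_chain]]]
      pull_face_closed[OF assms])

lemma cobd_cong:
  assumes "\<And>\<tau>. \<tau> \<in> chains rel J n \<Longrightarrow> x \<tau> = y \<tau>" "\<sigma> \<in> chains rel J (Suc n)"
  shows "cobd \<Phi> x \<sigma> = cobd \<Phi> y \<sigma>"
  unfolding cobd_def by (rule alt_cong) (simp add: pull_def assms(1)[OF chains_face[OF _ assms(2)]])

lemma pull_pull:
  assumes "cmodule C \<Phi>" "x \<in> cochains \<Phi> n" "\<tau> \<in> chains rel J n" "q \<in> J" "q' \<in> J" "rel q q'" "\<tau> \<noteq> [] \<Longrightarrow> rel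
      q' (last \<tau>)"
  shows "arr \<Phi> q q' (inc q q') (pull \<Phi> q' x \<tau>) = pull \<Phi> q x \<tau>"
proof (cases "\<tau> = []")
  case True
  then show ?thesis
    using cmodule_arr_one[OF assms(1) J_obj[OF assms(4)] J_obj[OF assms(5)] inc_mor[OF assms(4-6)]]
        by (simp add: pull_def)
next
  case False
  then have l: "last \<tau> \<in> J" using assms(3) by (cases n) (auto simp: chains_def last_chain)
  have r: "rel q' (last \<tau>)" by (rule assms(7)[OF False])
  show ?thesis
    using cmodule_arr_comp[OF assms(1) J_obj[OF assms(4)] J_obj[OF assms(5)] J_obj[OF l] inc_mor[OF
        assms(4-6)] inc_mor[OF assms(5) l r]]
      inc_comp[OF assms(4,5) l assms(6) r] assms(2,3) False
    by (simp add: pull_def cochains_def)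
qed

text \<open>By functoriality all values can be restricted at once to the last vertex of
  \<open>\<sigma>\<close>, where the claim becomes \<open>alt_alt\<close> in a single abelian
  group.\<close>

lemma cobd_cobd:
  assumes \<Phi>: "cmodule C \<Phi>" and x: "x \<in> cochains \<Phi> n" and \<sigma>: "\<sigma> \<in> chains rel J (Suc (Suc n))"
  shows "cobd \<Phi> (cobd \<Phi> x) \<sigma> = \<one>\<^bsub>val \<Phi> (last \<sigma>)\<^esub>"
proof -
  let ?q = "last \<sigma>"
  have q: "?q \<in> J" by (rule last_chain[OF \<sigma>])
  interpret q: comm_group "val \<Phi> ?q" by (rule cmodule_comm_group[OF \<Phi> J_obj[OF q]])
  \<comment> \<open>\<open>alt_alt\<close> asks for group elements at all subsequences of
    \<open>\<sigma>\<close>, while \<open>x\<close> is controlled only on chains with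
    \<open>n\<close> vertices, the length of a face of a face; all other lists get the value
    one.\<close>
  define y where "y \<rho> = (if subseq \<rho> \<sigma> \<and> length \<rho> = n then pull \<Phi> ?q x \<rho> else \<one>\<^bsub>val \<Phi> ?q\<^esub>)" for \<rho>
  have sub: "\<rho> \<in> chains rel J (length \<rho>)" if "subseq \<rho> \<sigma>" for \<rho>
    using set_subseq[OF that] sorted_wrt_subseq[OF that, of "\<lambda>a b. rel b a"] \<sigma> by (auto simp: chains_def)
  have y: "y \<rho> \<in> carrier (val \<Phi> ?q)" for \<rho>
  proof (cases "subseq \<rho> \<sigma> \<and> length \<rho> = n")
    case True
    then have "\<rho> \<in> chains rel J n" using sub by blast
    then show ?thesis using pull_closed[OF \<Phi> x _ q] last_subseq(2)[OF \<sigma>] True by (simp add: y_def)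
  next
    case False
    then show ?thesis unfolding y_def by (simp only: if_False q.one_closed)
  qed
  have "pull \<Phi> ?q (cobd \<Phi> x) \<tau> = alt (val \<Phi> ?q) y \<tau>" if f: "face \<tau> \<sigma>" for \<tau>
  proof -
    have \<tau>: "\<tau> \<in> chains rel J (Suc n)" by (rule chains_face[OF f \<sigma>])
    have ne: "\<tau> \<noteq> []" using \<tau> by (auto simp: chains_def)
    have st: "subseq \<tau> \<sigma>" using f by (simp add: face_def)
    note l = last_subseq[OF \<sigma> st ne]
    interpret l: comm_group "val \<Phi> (last \<tau>)" by (rule cmodule_comm_group[OF \<Phi> J_obj[OF l(1)]])
    have "pull \<Phi> ?q (cobd \<Phi> x) \<tau> = arr \<Phi> ?q (last \<tau>) (inc ?q (last \<tau>)) (alt (val \<Phi> (last \<tau>)) (pull \<Phi> (last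
        \<tau>) x) \<tau>)"
      using ne by (simp add: pull_def cobd_def)
    also have "\<dots> = alt (val \<Phi> ?q) (\<lambda>\<rho>. arr \<Phi> ?q (last \<tau>) (inc ?q (last \<tau>)) (pull \<Phi> (last \<tau>) x \<rho>)) \<tau>"
      by (rule l.alt_hom[OF cmodule_arr_hom[OF \<Phi> J_obj[OF q] J_obj[OF l(1)] inc_mor[OF q l]]
          q.comm_group_axioms])
        (rule pull_face_closed[OF \<Phi> x \<tau>])
    also have "\<dots> = alt (val \<Phi> ?q) y \<tau>"
    proof (rule alt_cong)
      fix \<rho> assume r: "face \<rho> \<tau>"
      have rc: "\<rho> \<in> chains rel J n" by (rule chains_face[OF r \<tau>])
      have rt: "subseq \<rho> \<tau>" using r by (simp add: face_def)
      have "subseq \<rho> \<sigma> \<and> length \<rho> = n" using subseq_order.trans[OF rt st] rc by (simp add: chains_def)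
      then show "arr \<Phi> ?q (last \<tau>) (inc ?q (last \<tau>)) (pull \<Phi> (last \<tau>) x \<rho>) = y \<rho>"
        using pull_pull[OF \<Phi> x rc q l last_subseq(2)[OF \<tau> rt]] by (simp add: y_def)
    qed
    finally show ?thesis .
  qed
  then have "cobd \<Phi> (cobd \<Phi> x) \<sigma> = alt (val \<Phi> ?q) (alt (val \<Phi> ?q) y) \<sigma>"
    unfolding cobd_def[of \<Phi> "cobd \<Phi> x"] by (rule alt_cong)
  also have "\<dots> = \<one>\<^bsub>val \<Phi> ?q\<^esub>" by (rule q.alt_alt[OF y])
  finally show ?thesis .
qed

text \<open>Makes both the differentials of a complex of modules and the retractions from Godement
  modules commute with \<open>cobd\<close>.\<close>

lemma cobd_natural:
  assumes \<Phi>: "cmodule C \<Phi>" and \<Psi>: "cmodule C \<Psi>" and \<eta>: "\<eta> \<in> cmod_hom C \<Phi> \<Psi>"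
    and x: "x \<in> cochains \<Phi> n" and \<sigma>: "\<sigma> \<in> chains rel J (Suc n)"
  shows "\<eta> (last \<sigma>) (cobd \<Phi> x \<sigma>) = cobd \<Psi> (\<lambda>\<tau>. \<eta> (last \<tau>) (x \<tau>)) \<sigma>"
proof -
  let ?q = "last \<sigma>"
  have q: "?q \<in> J" by (rule last_chain[OF \<sigma>])
  note qo = J_obj[OF q]
  interpret q: comm_group "val \<Phi> ?q" by (rule cmodule_comm_group[OF \<Phi> qo])
  have "\<eta> ?q (cobd \<Phi> x \<sigma>) = alt (val \<Psi> ?q) (\<lambda>\<tau>. \<eta> ?q (pull \<Phi> ?q x \<tau>)) \<sigma>"
    unfolding cobd_def
    by (rule q.alt_hom[OF cmod_hom_hom[OF \<eta> qo] cmodule_comm_group[OF \<Psi> qo]]) (rule pull_face_closed[OF \<Phi> x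
        \<sigma>])
  also have "\<dots> = cobd \<Psi> (\<lambda>\<tau>. \<eta> (last \<tau>) (x \<tau>)) \<sigma>"
    unfolding cobd_def
  proof (rule alt_cong)
    fix \<tau> assume f: "face \<tau> \<sigma>"
    show "\<eta> ?q (pull \<Phi> ?q x \<tau>) = pull \<Psi> ?q (\<lambda>\<tau>. \<eta> (last \<tau>) (x \<tau>)) \<tau>"
    proof (cases "\<tau> = []")
      case True
      then show ?thesis by (simp add: pull_def cmod_hom_one[OF \<eta> \<Phi> \<Psi> qo])
    next
      case False
      have st: "subseq \<tau> \<sigma>" using f by (simp add: face_def)
      note l = last_subseq[OF \<sigma> st False]
      have "x \<tau> \<in> carrier (val \<Phi> (last \<tau>))" using x chains_face[OF f \<sigma>] by (simp add: cochains_def)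
      from cmod_hom_natural[OF \<eta> qo J_obj[OF l(1)] inc_mor[OF q l] this]
      show ?thesis using False by (simp add: pull_def)
    qed
  qed
  finally show ?thesis .
qed

lemma cochains_map:
  "\<eta> \<in> cmod_hom C \<Phi> \<Psi> \<Longrightarrow> x \<in> cochains \<Phi> (Suc n) \<Longrightarrow> (\<lambda>\<tau>. \<eta> (last \<tau>) (x \<tau>)) \<in> cochains \<Psi> (Suc n)"
  using last_chain by (auto simp: cochains_def cmod_hom_closed J_obj)

lemma cochains_diff:
  assumes "cmodule C \<Phi>" "x \<in> cochains \<Phi> (Suc n)" "y \<in> cochains \<Phi> (Suc n)"
  shows "(\<lambda>\<sigma>. x \<sigma> \<div>\<^bsub>val \<Phi> (last \<sigma>)\<^esub> y \<sigma>) \<in> cochains \<Phi> (Suc n)"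
  using assms(2,3) comm_group_diff_closed[OF cmodule_comm_group[OF assms(1) J_obj[OF last_chain]]]
  by (simp add: cochains_def)

lemma cobd_diff:
  assumes \<Phi>: "cmodule C \<Phi>" and x: "x \<in> cochains \<Phi> n" and y: "y \<in> cochains \<Phi> n" and \<sigma>: "\<sigma> \<in> chains rel J
      (Suc n)"
  shows "cobd \<Phi> (\<lambda>\<sigma>. x \<sigma> \<div>\<^bsub>val \<Phi> (last \<sigma>)\<^esub> y \<sigma>) \<sigma>
    = cobd \<Phi> x \<sigma> \<div>\<^bsub>val \<Phi> (last \<sigma>)\<^esub> cobd \<Phi> y \<sigma>"
proof -
  let ?q = "last \<sigma>"
  have q: "?q \<in> J" by (rule last_chain[OF \<sigma>])
  note qo = J_obj[OF q]
  interpret q: comm_group "val \<Phi> ?q" by (rule cmodule_comm_group[OF \<Phi> qo])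
  have "alt (val \<Phi> ?q) (pull \<Phi> ?q (\<lambda>\<sigma>. x \<sigma> \<div>\<^bsub>val \<Phi> (last \<sigma>)\<^esub> y \<sigma>)) \<sigma>
    = alt (val \<Phi> ?q) (\<lambda>\<tau>. pull \<Phi> ?q x \<tau> \<div>\<^bsub>val \<Phi> ?q\<^esub> pull \<Phi> ?q y \<tau>) \<sigma>"
  proof (rule alt_cong)
    fix \<tau> assume f: "face \<tau> \<sigma>"
    show "pull \<Phi> ?q (\<lambda>\<sigma>. x \<sigma> \<div>\<^bsub>val \<Phi> (last \<sigma>)\<^esub> y \<sigma>) \<tau>
      = pull \<Phi> ?q x \<tau> \<div>\<^bsub>val \<Phi> ?q\<^esub> pull \<Phi> ?q y \<tau>"
    proof (cases "\<tau> = []")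
      case False
      have st: "subseq \<tau> \<sigma>" using f by (simp add: face_def)
      note l = last_subseq[OF \<sigma> st False]
      have "x \<tau> \<in> carrier (val \<Phi> (last \<tau>))" "y \<tau> \<in> carrier (val \<Phi> (last \<tau>))"
        using x y chains_face[OF f \<sigma>] by (simp_all add: cochains_def)
      from hom_diff[OF cmodule_arr_hom[OF \<Phi> qo J_obj[OF l(1)] inc_mor[OF q l]]
          cmodule_comm_group[OF \<Phi> J_obj[OF l(1)]] q.comm_group_axioms this]
      show ?thesis using False by (simp add: pull_def)
    qed (simp add: pull_def)
  qed
  also have "\<dots> = alt (val \<Phi> ?q) (pull \<Phi> ?q x) \<sigma> \<div>\<^bsub>val \<Phi> ?q\<^esub> alt (val \<Phi> ?q) (pull \<Phi> ?q y) \<sigma>"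
    by (rule q.alt_diff) (rule pull_face_closed[OF \<Phi> x \<sigma>] pull_face_closed[OF \<Phi> y \<sigma>]; assumption)+
  finally show ?thesis by (simp add: cobd_def)
qed

section \<open>Exactness of the cochain rows of an injective module\<close>

definition coslice :: "'o \<Rightarrow> ('o \<times> 'r) set" where
  "coslice c = {(Q, f). Q \<in> J \<and> f \<in> mor C c Q}"

text \<open>The category of elements of the functor \<open>Q \<mapsto> mor C c Q\<close> on the
  diagram, again a preorder. One of its nonempty chains amounts to a chain of the diagram with an
  arrow from \<open>c\<close> to the smallest vertex.\<close>

definition coslice_rel :: "'o \<Rightarrow> 'o \<times> 'r \<Rightarrow> 'o \<times> 'r \<Rightarrow> bool" where
  "coslice_rel c p p' \<longleftrightarrow> rel (fst p) (fst p') \<and>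
     snd p' = cmp C c (fst p) (fst p') (inc (fst p) (fst p')) (snd p)"

lemma coslice_comp:
  assumes c: "c \<in> obj C" and J': "a \<in> J" "b \<in> J" "d \<in> J" and r: "rel a b" "rel b d" and f: "f \<in> mor C c a"
  shows "cmp C c b d (inc b d) (cmp C c a b (inc a b) f) = cmp C c a d (inc a d) f"
  using small_categoryD(5)[OF C c J_obj[OF J'(1)] J_obj[OF J'(2)] J_obj[OF J'(3)] f inc_mor[OF J'(1,2)
      r(1)] inc_mor[OF J'(2,3) r(2)]]
    inc_comp[OF J' r] by simp

lemma coslice_comp_mor:
  assumes c: "c \<in> obj C" and J': "a \<in> J" "b \<in> J" and r: "rel a b" and f: "f \<in> mor C c a"
  shows "cmp C c a b (inc a b) f \<in> mor C c b"
  by (rule small_categoryD(2)[OF C c J_obj[OF J'(1)] J_obj[OF J'(2)] f inc_mor[OF J' r]])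

text \<open>Two elements above \<open>(Q, f)\<close> both carry transports of \<open>f\<close>, so
  transporting \<open>f\<close> to an upper bound of their objects in \<open>J\<close> bounds both.
  Directedness itself may fail, since different arrows from \<open>c\<close> need not become equal
  in the diagram.\<close>

lemma coslice_exact:
  assumes c: "c \<in> obj C" and G: "comm_group G" and x: "\<And>\<sigma>. x \<sigma> \<in> carrier G"
    "\<And>\<sigma>. \<sigma> \<in> chains (coslice_rel c) (coslice c) (Suc (Suc (Suc n))) \<Longrightarrow> alt G x \<sigma> = \<one>\<^bsub>G\<^esub>"
  shows "\<exists>y. (\<forall>\<sigma>. y \<sigma> \<in> carrier G) \<and> (\<forall>\<sigma>\<in>chains (coslice_rel c) (coslice c) (Suc (Suc n)). alt G y \<sigma> = x \<sigma>)"
proof (rule comm_group.confluent_chains_exact[OF G])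
  show "coslice_rel c p r" if "p \<in> coslice c" "q \<in> coslice c" "r \<in> coslice c" "coslice_rel c p q"
      "coslice_rel c q r" for p q r
    using that coslice_comp[OF c, of "fst p" "fst q" "fst r" "snd p"] rel_trans[of "fst p" "fst q" "fst r"]
    by (auto simp: coslice_def coslice_rel_def)
  show "coslice_rel c p p" if "p \<in> coslice c" for p
    using that rel_refl inc_refl small_categoryD(4)[OF C c J_obj]
        by (auto simp: coslice_def coslice_rel_def)
  show "\<exists>d\<in>coslice c. coslice_rel c q d \<and> coslice_rel c r d"
    if h: "p \<in> coslice c" "q \<in> coslice c" "r \<in> coslice c" "coslice_rel c p q" "coslice_rel c p r" for p q r
  proof -
    have pqr: "fst p \<in> J" "fst q \<in> J" "fst r \<in> J" "snd p \<in> mor C c (fst p)" using h(1-3)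
        by (auto simp: coslice_def)
    have pr: "rel (fst p) (fst q)" "rel (fst p) (fst r)" using h(4,5) by (simp_all add: coslice_rel_def)
    obtain d where d: "d \<in> J" "rel (fst q) d" "rel (fst r) d" using directed[OF pqr(2,3)] by blast
    let ?d = "(d, cmp C c (fst p) d (inc (fst p) d) (snd p))"
    have pd: "rel (fst p) d" by (rule rel_trans[OF pqr(1,2) d(1) pr(1) d(2)])
    have "?d \<in> coslice c" using coslice_comp_mor[OF c pqr(1) d(1) pd pqr(4)] d(1) by (simp add: coslice_def)
    moreover have "coslice_rel c q ?d"
      using coslice_comp[OF c pqr(1,2) d(1) pr(1) d(2) pqr(4)] h(4) d(2) by (simp add: coslice_rel_def)
    moreover have "coslice_rel c r ?d"
      using coslice_comp[OF c pqr(1,3) d(1) pr(2) d(3) pqr(4)] h(5) d(3) by (simp add: coslice_rel_def)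
    ultimately show ?thesis by blast
  qed
qed (rule x; assumption)+

lemma map_fst_chains:
  "\<omega> \<in> chains (coslice_rel c) (coslice c) n \<Longrightarrow> map fst \<omega> \<in> chains rel J n"
  by (auto simp: chains_def coslice_def coslice_rel_def sorted_wrt_map elim: sorted_wrt_mono_rel[rotated])

text \<open>By the retraction it suffices to bound the image of \<open>x\<close> under the unit, in
  the Godement module. There a cochain splits into one family for each \<open>c\<close>, indexed by
  a chain and an arrow from \<open>c\<close> to its last vertex, that is by a chain of the coslice
  of \<open>c\<close>; this reduces the claim to \<open>coslice_exact\<close> with constant
  coefficients \<open>val I c\<close>.\<close>

lemma rows_exact:
  fixes I :: "('o, 'r, 'u) cmod" and e :: "('o \<times> 'r \<Rightarrow> 'u) \<Rightarrow> 'u"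
  assumes I: "injective_cmodule C I" and e: "inj e" and x: "x \<in> cochains I (Suc (Suc n))"
    and dx: "\<And>\<sigma>. \<sigma> \<in> chains rel J (Suc (Suc (Suc n))) \<Longrightarrow> cobd I x \<sigma> = \<one>\<^bsub>val I (last \<sigma>)\<^esub>"
  shows "\<exists>w\<in>cochains I (Suc n). \<forall>\<sigma>\<in>chains rel J (Suc (Suc n)). cobd I w \<sigma> = x \<sigma>"
proof -
  note Ic = injective_cmodule_cmodule[OF I]
  obtain r where r: "r \<in> cmod_hom C (godement C I) I"
    "\<And>a x. a \<in> obj C \<Longrightarrow> x \<in> carrier (val I a) \<Longrightarrow> r a (godement_unit C I a x) = x"
    using godement_retraction[OF C I e] by blast
  have cg: "comm_group (val I c)" if "c \<in> obj C" for c by (rule cmodule_comm_group[OF Ic that])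
  \<comment> \<open>The part at \<open>c\<close> of the unit applied to \<open>x\<close>, read as a
    function on chains of the coslice. The default is one because \<open>coslice_exact\<close> asks
    for group elements at all lists.\<close>
  define \<xi> where "\<xi> c \<omega> = (if \<omega> \<in> chains (coslice_rel c) (coslice c) (Suc (Suc n))
    then arr I c (fst (last \<omega>)) (snd (last \<omega>)) (x (map fst \<omega>)) else \<one>\<^bsub>val I c\<^esub>)" for c \<omega>
  have last_coslice: "last \<omega> \<in> coslice c" if "\<omega> \<in> chains (coslice_rel c) (coslice c) (Suc m)" for \<omega> c m
    using that by (cases "\<omega> = []") (auto simp: chains_def)
  have last_fst: "last (map fst \<omega>) = fst (last \<omega>)" if "\<omega> \<in> chains (coslice_rel c) (coslice c) (Suc m)" for
      \<omega> c m
    using that by (cases "\<omega> = []") (auto simp: chains_def last_map)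
  have xm: "x (map fst \<omega>) \<in> carrier (val I (fst (last \<omega>)))" if w: "\<omega> \<in> chains (coslice_rel c) (coslice c)
      (Suc (Suc n))" for \<omega> c
    using x map_fst_chains[OF w] last_fst[OF w] by (auto simp: cochains_def)
  have ah: "arr I c (fst p) (snd p) \<in> hom (val I (fst p)) (val I c)" if "c \<in> obj C" "p \<in> coslice c" for c p
    by (rule cmodule_arr_hom[OF Ic]) (use that J_obj in \<open>auto simp: coslice_def\<close>)
  have \<xi>_closed: "\<xi> c \<omega> \<in> carrier (val I c)" if c: "c \<in> obj C" for c \<omega>
    using hom_in_carrier[OF ah[OF c last_coslice] xm] comm_groupE(2)[OF cg[OF c]] by (simp add: \<xi>_def)
  have \<xi>_cocycle: "alt (val I c) (\<xi> c) \<omega> = \<one>\<^bsub>val I c\<^esub>"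
    if c: "c \<in> obj C" and w: "\<omega> \<in> chains (coslice_rel c) (coslice c) (Suc (Suc (Suc n)))" for c \<omega>
  proof -
    let ?q = "fst (last \<omega>)" and ?f = "snd (last \<omega>)"
    let ?h = "arr I c ?q ?f" and ?s = "map fst \<omega>"
    note lo = last_coslice[OF w] and ms = map_fst_chains[OF w] and lf = last_fst[OF w]
    have q: "?q \<in> J" "?f \<in> mor C c ?q" using lo by (auto simp: coslice_def)
    interpret q: comm_group "val I ?q" by (rule cg[OF J_obj[OF q(1)]])
    have refl: "coslice_rel c p p" if "p \<in> coslice c" for p
      using that rel_refl inc_refl small_categoryD(4)[OF C c J_obj]
          by (auto simp: coslice_def coslice_rel_def)
    have "alt (val I c) (\<xi> c) \<omega> = alt (val I c) (\<lambda>\<tau>. ?h (pull I ?q x (map fst \<tau>))) \<omega>"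
    proof (rule alt_cong)
      fix \<tau> assume f: "face \<tau> \<omega>"
      have t: "\<tau> \<in> chains (coslice_rel c) (coslice c) (Suc (Suc n))" by (rule chains_face[OF f w])
      have ne: "\<tau> \<noteq> []" using t by (auto simp: chains_def)
      have "last \<tau> \<in> set \<omega>" using f set_subseq[of \<tau> \<omega>] ne by (auto simp: face_def)
      then have r: "coslice_rel c (last \<omega>) (last \<tau>)" by (rule chains_last_le[OF w _ refl])
      have l: "fst (last \<tau>) \<in> J" using last_coslice[OF t] by (auto simp: coslice_def)
      have rr: "rel ?q (fst (last \<tau>))" and sl: "snd (last \<tau>) = cmp C c ?q (fst (last \<tau>)) (inc ?q (fst (last
          \<tau>))) ?f"
        using r by (simp_all add: coslice_rel_def)
      have "\<xi> c \<tau> = ?h (arr I ?q (fst (last \<tau>)) (inc ?q (fst (last \<tau>))) (x (map fst \<tau>)))"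
        using cmodule_arr_comp[OF Ic c J_obj[OF q(1)] J_obj[OF l] q(2) inc_mor[OF q(1) l rr] xm[OF t]] t sl
        by (simp add: \<xi>_def)
      then show "\<xi> c \<tau> = ?h (pull I ?q x (map fst \<tau>))" using ne by (simp add: pull_def last_fst[OF t])
    qed
    also have "\<dots> = alt (val I c) (\<lambda>\<tau>. ?h (pull I ?q x \<tau>)) ?s" by (rule alt_map)
    also have "\<dots> = ?h (alt (val I ?q) (pull I ?q x) ?s)"
      by (rule q.alt_hom[OF ah[OF c lo] cg[OF c], symmetric]) (use pull_face_closed[OF Ic x ms] lf in simp)
    also have "alt (val I ?q) (pull I ?q x) ?s = \<one>\<^bsub>val I ?q\<^esub>" using dx[OF ms] lf by (simp add: cobd_def)
    also have "?h \<one>\<^bsub>val I ?q\<^esub> = \<one>\<^bsub>val I c\<^esub>" by (rule hom_one_comm[OF ah[OF c lo] q.comm_group_axioms cg[OF c]])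
    finally show ?thesis .
  qed
  have "\<forall>c\<in>obj C. \<exists>y. (\<forall>\<sigma>. y \<sigma> \<in> carrier (val I c)) \<and>
      (\<forall>\<sigma>\<in>chains (coslice_rel c) (coslice c) (Suc (Suc n)). alt (val I c) y \<sigma> = \<xi> c \<sigma>)"
    by (intro ballI coslice_exact cg \<xi>_closed \<xi>_cocycle)
  then obtain \<zeta> where "\<forall>c\<in>obj C. (\<forall>\<sigma>. \<zeta> c \<sigma> \<in> carrier (val I c)) \<and>
      (\<forall>\<sigma>\<in>chains (coslice_rel c) (coslice c) (Suc (Suc n)). alt (val I c) (\<zeta> c) \<sigma> = \<xi> c \<sigma>)"
    by (rule bchoice[THEN exE])
  then have \<zeta>: "\<zeta> c \<sigma> \<in> carrier (val I c)"
    "\<sigma> \<in> chains (coslice_rel c) (coslice c) (Suc (Suc n)) \<Longrightarrow> alt (val I c) (\<zeta> c) \<sigma> = \<xi> c \<sigma>" if "c \<in> obj C"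
        for c \<sigma>
    using that by simp_all
  \<comment> \<open>The inverse identification: an arrow \<open>f\<close> from \<open>c\<close> to
    the smallest vertex \<open>q\<close> determines the arrows to all other vertices.\<close>
  define lift where "lift c q f = map (\<lambda>Q. (Q, cmp C c q Q (inc q Q) f))" for c q f
  define w where "w \<sigma> = (\<lambda>p\<in>incoming C (last \<sigma>). \<zeta> (fst p) (lift (fst p) (last \<sigma>) (snd p) \<sigma>))" for \<sigma>
  have wc: "w \<in> cochains (godement C I) (Suc n)"
    by (auto simp: cochains_def w_def val_godement \<zeta>(1) incoming_def)
  have "cobd (godement C I) w \<sigma> = godement_unit C I (last \<sigma>) (x \<sigma>)" if s: "\<sigma> \<in> chains rel J (Suc (Suc n))"
      for \<sigma>
  proof (rule extensionalityI)
    let ?q = "last \<sigma>" and ?N = "godement C I"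
    have q: "?q \<in> J" by (rule last_chain[OF s])
    note qo = J_obj[OF q] and Nc = cmodule_godement[OF C Ic]
    interpret Nq: comm_group "val ?N ?q" by (rule cmodule_comm_group[OF Nc qo])
    have "cobd ?N w \<sigma> \<in> carrier (val ?N ?q)" using cobd_closed[OF Nc wc] s by (simp add: cochains_def)
    then show "cobd ?N w \<sigma> \<in> extensional (incoming C ?q)" by (auto simp: val_godement PiE_def)
    show "godement_unit C I ?q (x \<sigma>) \<in> extensional (incoming C ?q)" by (simp add: godement_unit_def)
    fix p assume p: "p \<in> incoming C ?q"
    obtain c f where pcf: "p = (c, f)" by (cases p)
    have c: "c \<in> obj C" and f: "f \<in> mor C c ?q" using p by (auto simp: pcf incoming_def)
    have ph: "(\<lambda>y. y p) \<in> hom (val ?N ?q) (val I c)"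
      using p by (auto simp: hom_def val_godement pcf PiE_def Pi_def)
    have lc: "lift c ?q f \<sigma> \<in> chains (coslice_rel c) (coslice c) (Suc (Suc n))"
    proof -
      have "sorted_wrt (\<lambda>a b. coslice_rel c (b, cmp C c ?q b (inc ?q b) f) (a, cmp C c ?q a (inc ?q a) f))
          \<sigma>"
      proof (rule sorted_wrt_mono_rel)
        show "sorted_wrt (\<lambda>a b. rel b a) \<sigma>" using s by (simp add: chains_def)
        fix a b assume ab: "a \<in> set \<sigma>" "b \<in> set \<sigma>" "rel b a"
        have "a \<in> J" "b \<in> J" using ab s by (auto simp: chains_def)
        then show "coslice_rel c (b, cmp C c ?q b (inc ?q b) f) (a, cmp C c ?q a (inc ?q a) f)"
          using coslice_comp[OF c q _ _ chains_last_le[OF s ab(2) rel_refl] ab(3) f] ab(3)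
              by (simp add: coslice_rel_def)
      qed
      moreover have "(Q, cmp C c ?q Q (inc ?q Q) f) \<in> coslice c" if Q: "Q \<in> set \<sigma>" for Q
      proof -
        have QJ: "Q \<in> J" using Q s by (auto simp: chains_def)
        show ?thesis using coslice_comp_mor[OF c q QJ chains_last_le[OF s Q rel_refl] f] QJ
            by (simp add: coslice_def)
      qed
      ultimately show ?thesis
        using s by (auto simp: lift_def chains_def sorted_wrt_map)
    qed
    have "cobd ?N w \<sigma> p = alt (val I c) (\<lambda>\<tau>. pull ?N ?q w \<tau> p) \<sigma>"
      unfolding cobd_def by (rule Nq.alt_hom[OF ph cg[OF c]]) (rule pull_face_closed[OF Nc wc s])
    also have "\<dots> = alt (val I c) (\<lambda>\<tau>. \<zeta> c (lift c ?q f \<tau>)) \<sigma>"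
    proof (rule alt_cong)
      fix \<tau> assume fa: "face \<tau> \<sigma>"
      have t: "\<tau> \<in> chains rel J (Suc n)" by (rule chains_face[OF fa s])
      have ne: "\<tau> \<noteq> []" using t by (auto simp: chains_def)
      have st: "subseq \<tau> \<sigma>" using fa by (simp add: face_def)
      note l = last_subseq[OF s st ne]
      let ?g = "cmp C c ?q (last \<tau>) (inc ?q (last \<tau>)) f"
      have g: "?g \<in> mor C c (last \<tau>)" by (rule coslice_comp_mor[OF c q l f])
      \<comment> \<open>Lifting a face with the transported arrow is the same as taking that face of
        the lifted chain; this turns \<open>cobd\<close> in the Godement module into
        \<open>alt\<close> over the coslice.\<close>
      have "lift c (last \<tau>) ?g \<tau> = lift c ?q f \<tau>"
        unfolding lift_def
      proof (rule map_cong[OF refl])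
        fix Q assume Q: "Q \<in> set \<tau>"
        have QJ: "Q \<in> J" using Q t by (auto simp: chains_def)
        have lQ: "rel (last \<tau>) Q" by (rule chains_last_le[OF t Q rel_refl])
        show "(Q, cmp C c (last \<tau>) Q (inc (last \<tau>) Q) ?g) = (Q, cmp C c ?q Q (inc ?q Q) f)"
          using coslice_comp[OF c q l(1) QJ l(2) lQ f] by simp
      qed
      moreover have "(c, ?g) \<in> incoming C (last \<tau>)" using c g by (simp add: incoming_def)
      ultimately show "pull ?N ?q w \<tau> p = \<zeta> c (lift c ?q f \<tau>)"
        using ne p by (simp add: pull_def arr_godement pcf w_def)
    qed
    also have "\<dots> = alt (val I c) (\<zeta> c) (lift c ?q f \<sigma>)" unfolding lift_def by (rule alt_map)
    also have "\<dots> = \<xi> c (lift c ?q f \<sigma>)" by (rule \<zeta>(2)[OF c lc])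
    also have "\<dots> = arr I c ?q f (x \<sigma>)"
    proof -
      have "\<sigma> \<noteq> []" using s by (auto simp: chains_def)
      then have "last (lift c ?q f \<sigma>) = (?q, f)"
        by (simp add: lift_def last_map inc_refl[OF q] small_categoryD(4)[OF C c qo f])
      moreover have "map fst (lift c ?q f \<sigma>) = \<sigma>" by (simp add: lift_def comp_def)
      ultimately show ?thesis using lc by (simp add: \<xi>_def)
    qed
    finally show "cobd ?N w \<sigma> p = godement_unit C I ?q (x \<sigma>) p" using p by (simp add: godement_unit_def pcf)
  qed
  then have "cobd I (\<lambda>\<tau>. r (last \<tau>) (w \<tau>)) \<sigma> = x \<sigma>" if s: "\<sigma> \<in> chains rel J (Suc (Suc n))" for \<sigma>
    using cobd_natural[OF cmodule_godement[OF C Ic] Ic r(1) wc s] r(2)[OF J_obj[OF last_chain[OF s]]] x s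
    by (simp add: cochains_def)
  then show ?thesis using cochains_map[OF r(1) wc] by blast
qed

end

text \<open>A complex of injective modules over all of \<open>C\<close> that is exact at the objects
  of \<open>J\<close>, also in degree 0. For a resolution the latter means that the resolved module
  vanishes on \<open>J\<close>.\<close>

locale directed_resolution = directed_diagram C J rel inc
  for C :: "('o, 'r) cat" and J :: "'o set" and rel :: "'o \<Rightarrow> 'o \<Rightarrow> bool" and inc :: "'o \<Rightarrow> 'o \<Rightarrow> 'r" +
  fixes W :: "nat \<Rightarrow> ('o, 'r, 'u) cmod" and d :: "nat \<Rightarrow> 'o \<Rightarrow> 'u \<Rightarrow> 'u" and e :: "('o \<times> 'r \<Rightarrow> 'u) \<Rightarrow> 'u"
  assumes injective: "injective_cmodule C (W n)" and e: "inj e"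
    and d: "d n \<in> cmod_hom C (W n) (W (Suc n))"
    and dd: "\<lbrakk>a \<in> obj C; x \<in> carrier (val (W n) a)\<rbrakk> \<Longrightarrow> d (Suc n) a (d n a x) = \<one>\<^bsub>val (W (Suc (Suc n))) a\<^esub>"
    and exact0: "\<lbrakk>a \<in> J; x \<in> carrier (val (W 0) a); d 0 a x = \<one>\<^bsub>val (W 1) a\<^esub>\<rbrakk> \<Longrightarrow> x = \<one>\<^bsub>val (W 0) a\<^esub>"
    and exact: "\<lbrakk>a \<in> J; x \<in> carrier (val (W (Suc n)) a); d (Suc n) a x = \<one>\<^bsub>val (W (Suc (Suc n))) a\<^esub>\<rbrakk> \<Longrightarrow>
      \<exists>y\<in>carrier (val (W n) a). d n a y = x"
begin

lemma cmodule_W: "cmodule C (W n)"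
  by (rule injective_cmodule_cmodule[OF injective])

lemma cobd_d:
  "x \<in> cochains (W t) n \<Longrightarrow> \<sigma> \<in> chains rel J (Suc n) \<Longrightarrow>
    cobd (W (Suc t)) (\<lambda>\<tau>. d t (last \<tau>) (x \<tau>)) \<sigma> = d t (last \<sigma>) (cobd (W t) x \<sigma>)"
  by (rule cobd_natural[OF cmodule_W cmodule_W d, symmetric])

lemma chain_closed: "x \<in> cochains \<Phi> n \<Longrightarrow> \<sigma> \<in> chains rel J n \<Longrightarrow> x \<sigma> \<in> carrier (val \<Phi> (last \<sigma>))"
  by (simp add: cochains_def)

lemma chain_comm_group: "\<sigma> \<in> chains rel J (Suc n) \<Longrightarrow> comm_group (val (W t) (last \<sigma>))"
  by (rule cmodule_comm_group[OF cmodule_W J_obj[OF last_chain]])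

text \<open>Diagram chase by induction on \<open>t\<close>. Exactness along \<open>d\<close> writes
  the coboundary of \<open>x\<close> as \<open>d m\<close> of some \<open>w\<close>. The coboundary
  of \<open>w\<close> is killed by \<open>d m\<close>, so the induction hypothesis, with one vertex
  more, corrects \<open>w\<close> by an image of \<open>d\<close> into a cocycle with the same image
  under \<open>d m\<close>. By \<open>rows_exact\<close> this cocycle is the coboundary of some
  \<open>v\<close>, and \<open>d m\<close> of \<open>v\<close> has the same coboundary as
  \<open>x\<close>. At \<open>t = 0\<close> injectivity of \<open>d 0\<close> ends the
  descent.\<close>

lemma double_complex:
  assumes "x \<in> cochains (W t) (Suc n)"
    and "\<And>\<sigma>. \<sigma> \<in> chains rel J (Suc (Suc n)) \<Longrightarrow> d t (last \<sigma>) (cobd (W t) x \<sigma>) = \<one>\<^bsub>val (W (Suc t)) (last \<sigma>)\<^esub>"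
  shows "case t of 0 \<Rightarrow> \<forall>\<sigma>\<in>chains rel J (Suc (Suc n)). cobd (W t) x \<sigma> = \<one>\<^bsub>val (W t) (last \<sigma>)\<^esub>
    | Suc m \<Rightarrow> \<exists>u\<in>cochains (W m) (Suc n). \<forall>\<sigma>\<in>chains rel J (Suc (Suc n)).
        cobd (W t) x \<sigma> = cobd (W t) (\<lambda>\<tau>. d m (last \<tau>) (u \<tau>)) \<sigma>"
  using assms
proof (induction t arbitrary: n x)
  case 0
  show ?case using exact0[OF last_chain chain_closed[OF cobd_closed[OF cmodule_W 0(1)]]] 0(2) by simp
next
  case (Suc m)
  note x = Suc.prems(1) and dx = Suc.prems(2)
  note cx = cobd_closed[OF cmodule_W x]
  have "\<forall>\<sigma>\<in>chains rel J (Suc (Suc n)). \<exists>y. y \<in> carrier (val (W m) (last \<sigma>)) \<and> d m (last \<sigma>) y = cobd (W (Suc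
      m)) x \<sigma>"
    using exact[OF last_chain chain_closed[OF cx] dx] by blast
  then obtain w where "\<forall>\<sigma>\<in>chains rel J (Suc (Suc n)). w \<sigma> \<in> carrier (val (W m) (last \<sigma>)) \<and> d m (last \<sigma>) (w
      \<sigma>) = cobd (W (Suc m)) x \<sigma>"
    by (rule bchoice[THEN exE])
  then have w: "w \<in> cochains (W m) (Suc (Suc n))"
    and dw: "\<And>\<sigma>. \<sigma> \<in> chains rel J (Suc (Suc n)) \<Longrightarrow> d m (last \<sigma>) (w \<sigma>) = cobd (W (Suc m)) x \<sigma>"
    by (simp_all add: cochains_def)
  have dcw: "d m (last \<sigma>) (cobd (W m) w \<sigma>) = \<one>\<^bsub>val (W (Suc m)) (last \<sigma>)\<^esub>" if s: "\<sigma> \<in> chains rel J (Suc (Suc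
      (Suc n)))" for \<sigma>
    using cobd_d[OF w s] cobd_cong[where \<Phi> = "W (Suc m)", OF dw s] cobd_cobd[OF cmodule_W x s] by simp
  have "\<exists>w'\<in>cochains (W m) (Suc (Suc n)).
     (\<forall>\<sigma>\<in>chains rel J (Suc (Suc (Suc n))). cobd (W m) w' \<sigma> = \<one>\<^bsub>val (W m) (last \<sigma>)\<^esub>) \<and>
     (\<forall>\<sigma>\<in>chains rel J (Suc (Suc n)). d m (last \<sigma>) (w' \<sigma>) = cobd (W (Suc m)) x \<sigma>)"
  proof (cases m)
    case 0
    then have "\<forall>\<sigma>\<in>chains rel J (Suc (Suc (Suc n))). cobd (W m) w \<sigma> = \<one>\<^bsub>val (W m) (last \<sigma>)\<^esub>"
      using Suc.IH[OF w dcw] by simp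
    then show ?thesis using w dw by blast
  next
    case (Suc k)
    obtain u where u: "u \<in> cochains (W k) (Suc (Suc n))"
      "\<And>\<sigma>. \<sigma> \<in> chains rel J (Suc (Suc (Suc n))) \<Longrightarrow> cobd (W m) w \<sigma> = cobd (W m) (\<lambda>\<tau>. d k (last \<tau>) (u \<tau>)) \<sigma>"
      using Suc.IH[OF w dcw] by (auto simp: Suc)
    have du: "(\<lambda>\<tau>. d k (last \<tau>) (u \<tau>)) \<in> cochains (W m) (Suc (Suc n))"
      unfolding Suc by (rule cochains_map[OF d u(1)])
    let ?w = "\<lambda>\<sigma>. w \<sigma> \<div>\<^bsub>val (W m) (last \<sigma>)\<^esub> d k (last \<sigma>) (u \<sigma>)"
    have 1: "?w \<in> cochains (W m) (Suc (Suc n))" by (rule cochains_diff[OF cmodule_W w du])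
    have 2: "cobd (W m) ?w \<sigma> = \<one>\<^bsub>val (W m) (last \<sigma>)\<^esub>" if s: "\<sigma> \<in> chains rel J (Suc (Suc (Suc n)))" for \<sigma>
      using cobd_diff[OF cmodule_W w du s] u(2)[OF s] comm_group_diff_self[OF chain_comm_group[OF s]
          chain_closed[OF cobd_closed[OF cmodule_W du] s]]
      by simp
    have 3: "d m (last \<sigma>) (?w \<sigma>) = cobd (W (Suc m)) x \<sigma>" if s: "\<sigma> \<in> chains rel J (Suc (Suc n))" for \<sigma>
    proof -
      note l = J_obj[OF last_chain[OF s]]
      have "d m (last \<sigma>) (?w \<sigma>) = cobd (W (Suc m)) x \<sigma> \<div>\<^bsub>val (W (Suc m)) (last \<sigma>)\<^esub> d m (last \<sigma>) (d k (last \<sigma>)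
          (u \<sigma>))"
        using hom_diff[OF cmod_hom_hom[OF d l] chain_comm_group[OF s] chain_comm_group[OF s]
            chain_closed[OF w s] chain_closed[OF du s]] dw[OF s]
        by simp
      also have "d m (last \<sigma>) (d k (last \<sigma>) (u \<sigma>)) = \<one>\<^bsub>val (W (Suc m)) (last \<sigma>)\<^esub>"
        unfolding Suc by (rule dd[OF l chain_closed[OF u(1) s]])
      finally show ?thesis using comm_group_diff_one[OF chain_comm_group[OF s] chain_closed[OF cx s]] by
          simp
    qed
    show ?thesis by (rule bexI[OF _ 1]) (intro conjI ballI 2 3)
  qed
  then obtain w' where w': "w' \<in> cochains (W m) (Suc (Suc n))"
     "\<And>\<sigma>. \<sigma> \<in> chains rel J (Suc (Suc (Suc n))) \<Longrightarrow> cobd (W m) w' \<sigma> = \<one>\<^bsub>val (W m) (last \<sigma>)\<^esub>"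
     "\<And>\<sigma>. \<sigma> \<in> chains rel J (Suc (Suc n)) \<Longrightarrow> d m (last \<sigma>) (w' \<sigma>) = cobd (W (Suc m)) x \<sigma>"
    by blast
  obtain v where v: "v \<in> cochains (W m) (Suc n)" "\<And>\<sigma>. \<sigma> \<in> chains rel J (Suc (Suc n)) \<Longrightarrow> cobd (W m) v \<sigma> = w'
      \<sigma>"
    using rows_exact[OF injective e w'(1,2)] by blast
  have "cobd (W (Suc m)) x \<sigma> = cobd (W (Suc m)) (\<lambda>\<tau>. d m (last \<tau>) (v \<tau>)) \<sigma>" if s: "\<sigma> \<in> chains rel J (Suc
      (Suc n))" for \<sigma>
    using cobd_d[OF v(1) s] v(2)[OF s] w'(3)[OF s] by simp
  then show ?case using v(1) by auto
qed

text \<open>An element of the limit of \<open>\<Phi>\<close> over the directed diagram.\<close>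

definition compatible :: "('o, 'r, 'u) cmod \<Rightarrow> ('o \<Rightarrow> 'u) \<Rightarrow> bool" where
  "compatible \<Phi> y \<longleftrightarrow> (\<forall>a\<in>J. y a \<in> carrier (val \<Phi> a)) \<and>
     (\<forall>a\<in>J. \<forall>b\<in>J. rel a b \<longrightarrow> arr \<Phi> a b (inc a b) (y b) = y a)"

text \<open>The coboundary on two vertices measures the failure of a family to be compatible, which
  identifies the limit with the cocycles on single vertices.\<close>

lemma cobd_family:
  assumes \<Phi>: "cmodule C \<Phi>" and z: "\<And>a. a \<in> J \<Longrightarrow> z a \<in> carrier (val \<Phi> a)" and ab: "a \<in> J" "b \<in> J" "rel a b"
  shows "cobd \<Phi> (\<lambda>\<sigma>. z (last \<sigma>)) [b, a] = z a \<div>\<^bsub>val \<Phi> a\<^esub> arr \<Phi> a b (inc a b) (z b)"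
proof -
  interpret comm_group "val \<Phi> a" by (rule cmodule_comm_group[OF \<Phi> J_obj[OF ab(1)]])
  have "arr \<Phi> a b (inc a b) (z b) \<in> carrier (val \<Phi> a)"
    by (rule cmodule_arr_closed[OF \<Phi> J_obj[OF ab(1)] J_obj[OF ab(2)] inc_mor[OF ab] z[OF ab(2)]])
  then show ?thesis
    using cmodule_arr_id[OF \<Phi> J_obj[OF ab(1)] z[OF ab(1)]]
        by (simp add: cobd_def pull_def inc_refl[OF ab(1)])
qed

lemma chains_one: "chains rel J (Suc 0) = (\<lambda>a. [a]) ` J"
proof -
  have "\<sigma> \<in> chains rel J (Suc 0) \<Longrightarrow> \<exists>a\<in>J. \<sigma> = [a]" for \<sigma>
    by (cases \<sigma>) (auto simp: chains_def)
  then show ?thesis by (auto simp: chains_def)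
qed

lemma compatible_if_cocycle:
  assumes \<Phi>: "cmodule C \<Phi>" and z: "\<And>a. a \<in> J \<Longrightarrow> z a \<in> carrier (val \<Phi> a)"
    and c: "\<And>\<sigma>. \<sigma> \<in> chains rel J (Suc (Suc 0)) \<Longrightarrow> cobd \<Phi> (\<lambda>\<sigma>. z (last \<sigma>)) \<sigma> = \<one>\<^bsub>val \<Phi> (last \<sigma>)\<^esub>"
  shows "compatible \<Phi> z"
  unfolding compatible_def
proof (intro conjI ballI impI z)
  fix a b assume ab: "a \<in> J" "b \<in> J" "rel a b"
  have "[b, a] \<in> chains rel J (Suc (Suc 0))" using ab by (simp add: chains_def)
  from c[OF this] have "z a \<div>\<^bsub>val \<Phi> a\<^esub> arr \<Phi> a b (inc a b) (z b) = \<one>\<^bsub>val \<Phi> a\<^esub>"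
    using cobd_family[where z = z, OF \<Phi> z ab] by simp
  then show "arr \<Phi> a b (inc a b) (z b) = z a"
    using comm_group_diff_eq_one[OF cmodule_comm_group[OF \<Phi> J_obj[OF ab(1)]] z[OF ab(1)]
        cmodule_arr_closed[OF \<Phi> J_obj[OF ab(1)] J_obj[OF ab(2)] inc_mor[OF ab] z[OF ab(2)]]] by simp
qed

text \<open>The preimages \<open>z a\<close> are chosen independently, and their coboundary measures
  how far they are from being compatible. It is killed by \<open>d t\<close>, so
  \<open>double_complex\<close> yields \<open>u\<close> for which \<open>d m\<close> of
  \<open>u\<close> has the same coboundary; subtracting that makes \<open>z\<close> compatible and
  does not change its image under \<open>d t\<close>. For \<open>t = 0\<close> the coboundary is
  already trivial.\<close>

lemma compatible_exact:
  assumes y: "compatible (W (Suc t)) y" and dy: "\<And>a. a \<in> J \<Longrightarrow> d (Suc t) a (y a) = \<one>\<^bsub>val (W (Suc (Suc t))) a\<^esub>"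
  shows "\<exists>z. compatible (W t) z \<and> (\<forall>a\<in>J. d t a (z a) = y a)"
proof -
  have yc: "y a \<in> carrier (val (W (Suc t)) a)" if "a \<in> J" for a using y that by (simp add: compatible_def)
  have "\<forall>a\<in>J. \<exists>z. z \<in> carrier (val (W t) a) \<and> d t a z = y a"
    using exact[OF _ yc dy] by blast
  then obtain z where "\<forall>a\<in>J. z a \<in> carrier (val (W t) a) \<and> d t a (z a) = y a"
    by (rule bchoice[THEN exE])
  then have z: "\<And>a. a \<in> J \<Longrightarrow> z a \<in> carrier (val (W t) a)" "\<And>a. a \<in> J \<Longrightarrow> d t a (z a) = y a" by simp_all
  let ?x = "\<lambda>\<sigma>. z (last \<sigma>)"
  have x: "?x \<in> cochains (W t) (Suc 0)" using z(1) by (auto simp: cochains_def chains_one)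
  have dx: "d t (last \<sigma>) (cobd (W t) ?x \<sigma>) = \<one>\<^bsub>val (W (Suc t)) (last \<sigma>)\<^esub>" if s: "\<sigma> \<in> chains rel J (Suc (Suc
      0))" for \<sigma>
  proof -
    obtain b a where s': "\<sigma> = [b, a]" "a \<in> J" "b \<in> J" "rel a b"
      using s by (cases \<sigma>; cases "tl \<sigma>") (auto simp: chains_def)
    have "d t (last \<sigma>) (cobd (W t) ?x \<sigma>) = cobd (W (Suc t)) (\<lambda>\<tau>. d t (last \<tau>) (?x \<tau>)) \<sigma>"
      by (rule cobd_d[OF x s, symmetric])
    also have "\<dots> = cobd (W (Suc t)) (\<lambda>\<tau>. y (last \<tau>)) \<sigma>"
      by (rule cobd_cong[OF _ s]) (auto simp: chains_one z(2))
    also have "\<dots> = y a \<div>\<^bsub>val (W (Suc t)) a\<^esub> arr (W (Suc t)) a b (inc a b) (y b)"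
      unfolding s'(1) by (rule cobd_family[where z = y, OF cmodule_W yc s'(2-4)])
    also have "\<dots> = \<one>\<^bsub>val (W (Suc t)) a\<^esub>"
      using y s'(2-4) comm_group_diff_self[OF cmodule_comm_group[OF cmodule_W J_obj[OF s'(2)]] yc[OF
          s'(2)]] by (simp add: compatible_def)
    finally show ?thesis by (simp add: s'(1))
  qed
  note dc = double_complex[OF x dx]
  show ?thesis
  proof (cases t)
    case 0
    have "compatible (W t) z" by (rule compatible_if_cocycle[OF cmodule_W z(1)]) (use dc 0 in simp_all)
    then show ?thesis using z(2) by blast
  next
    case (Suc m)
    obtain u where u: "u \<in> cochains (W m) (Suc 0)"
      "\<And>\<sigma>. \<sigma> \<in> chains rel J (Suc (Suc 0)) \<Longrightarrow> cobd (W t) ?x \<sigma> = cobd (W t) (\<lambda>\<tau>. d m (last \<tau>) (u \<tau>)) \<sigma>"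
      using dc by (auto simp: Suc)
    have du: "(\<lambda>\<tau>. d m (last \<tau>) (u \<tau>)) \<in> cochains (W t) (Suc 0)"
      unfolding Suc by (rule cochains_map[OF d u(1)])
    have ua: "u [a] \<in> carrier (val (W m) a)" if "a \<in> J" for a using u(1) that
        by (auto simp: cochains_def chains_one)
    have dua: "d m a (u [a]) \<in> carrier (val (W t) a)" if "a \<in> J" for a using du that
        by (auto simp: cochains_def chains_one)
    let ?z = "\<lambda>a. z a \<div>\<^bsub>val (W t) a\<^esub> d m a (u [a])"
    have cg: "comm_group (val (W k) a)" if "a \<in> J" for k a
        by (rule cmodule_comm_group[OF cmodule_W J_obj[OF that]])
    have "compatible (W t) ?z"
    proof (rule compatible_if_cocycle[OF cmodule_W])
      show "?z a \<in> carrier (val (W t) a)" if "a \<in> J" for a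
        by (rule comm_group_diff_closed[OF cg z(1) dua]) (rule that)+
      fix \<sigma> assume s: "\<sigma> \<in> chains rel J (Suc (Suc 0))"
      have "cobd (W t) (\<lambda>\<sigma>. ?z (last \<sigma>)) \<sigma> = cobd (W t) (\<lambda>\<sigma>. ?x \<sigma> \<div>\<^bsub>val (W t) (last \<sigma>)\<^esub> d m (last \<sigma>) (u \<sigma>)) \<sigma>"
        by (rule cobd_cong[OF _ s]) (auto simp: chains_one)
      also have "\<dots> = cobd (W t) ?x \<sigma> \<div>\<^bsub>val (W t) (last \<sigma>)\<^esub> cobd (W t) (\<lambda>\<tau>. d m (last \<tau>) (u \<tau>)) \<sigma>"
        by (rule cobd_diff[OF cmodule_W x du s])
      also have "\<dots> = \<one>\<^bsub>val (W t) (last \<sigma>)\<^esub>"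
        unfolding u(2)[OF s] by (rule comm_group_diff_self[OF chain_comm_group[OF s] chain_closed[OF
            cobd_closed[OF cmodule_W du] s]])
      finally show "cobd (W t) (\<lambda>\<sigma>. ?z (last \<sigma>)) \<sigma> = \<one>\<^bsub>val (W t) (last \<sigma>)\<^esub>" .
    qed
    moreover have "d t a (?z a) = y a" if a: "a \<in> J" for a
    proof -
      have "d t a (?z a) = y a \<div>\<^bsub>val (W (Suc t)) a\<^esub> d t a (d m a (u [a]))"
        using hom_diff[OF cmod_hom_hom[OF d J_obj[OF a]] cg[OF a] cg[OF a] z(1)[OF a] dua[OF a]] z(2)[OF a]
            by simp
      also have "d t a (d m a (u [a])) = \<one>\<^bsub>val (W (Suc t)) a\<^esub>"
        unfolding Suc by (rule dd[OF J_obj[OF a] ua[OF a]])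
      finally show ?thesis using comm_group_diff_one[OF cg[OF a] yc[OF a]] by simp
    qed
    ultimately show ?thesis by (intro exI[of _ ?z] conjI ballI)
  qed
qed

text \<open>\<open>k\<close> is a cocone from the diagram to \<open>P\<close>. The last assumption
  says that the colimit of the sets \<open>mor C c a\<close> over \<open>J\<close> injects into
  \<open>mor C c P\<close>: two factorisations of one arrow become equal at some stage of the
  diagram.\<close>

context
  fixes P :: 'o and k :: "'o \<Rightarrow> 'r"
  assumes P: "P \<in> obj C" and k: "\<And>a. a \<in> J \<Longrightarrow> k a \<in> mor C a P"
    and k_inc: "\<And>a b. \<lbrakk>a \<in> J; b \<in> J; rel a b\<rbrakk> \<Longrightarrow> cmp C a b P (k b) (inc a b) = k a"
    and k_mono: "\<And>c a b f g. \<lbrakk>c \<in> obj C; a \<in> J; b \<in> J; f \<in> mor C c a; g \<in> mor C c b; cmp C c a P (k a) f =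
        cmp C c b P (k b) g\<rbrakk> \<Longrightarrow> \<exists>q\<in>J. rel a q \<and> rel b q \<and> cmp C c a q (inc a q) f = cmp C c b q (inc b q) g"
begin

text \<open>The coordinates of the Godement module at \<open>P\<close> are indexed by the arrows
  into \<open>P\<close>. On those that factor through some \<open>a\<close> in \<open>J\<close> the
  value is forced by \<open>y a\<close>; the others are free and set to one. The retraction carries
  this element to the one required.\<close>

lemma compatible_extends:
  assumes I: "injective_cmodule C I" and y: "compatible I y"
  shows "\<exists>x\<in>carrier (val I P). \<forall>a\<in>J. arr I a P (k a) x = y a"
proof -
  note Ic = injective_cmodule_cmodule[OF I]
  obtain r where r: "r \<in> cmod_hom C (godement C I) I"
    "\<And>a x. a \<in> obj C \<Longrightarrow> x \<in> carrier (val I a) \<Longrightarrow> r a (godement_unit C I a x) = x"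
    using godement_retraction[OF C I e] by blast
  have yc: "y a \<in> carrier (val I a)" if "a \<in> J" for a using y that by (simp add: compatible_def)
  define V where "V c g v \<longleftrightarrow> (\<exists>a f. a \<in> J \<and> f \<in> mor C c a \<and> cmp C c a P (k a) f = g \<and> v = arr I c a f (y
      a))" for c g v
  \<comment> \<open>Two factorisations become equal at some \<open>q\<close> in \<open>J\<close>,
    and both \<open>y a\<close> and \<open>y b\<close> are restrictions of
    \<open>y q\<close>.\<close>
  have V_unique: "v = v'" if c: "c \<in> obj C" and V: "V c g v" "V c g v'" for c g v v'
  proof -
    obtain a f where a: "a \<in> J" "f \<in> mor C c a" "cmp C c a P (k a) f = g" "v = arr I c a f (y a)"
      using V(1) by (auto simp: V_def)
    obtain b h where b: "b \<in> J" "h \<in> mor C c b" "cmp C c b P (k b) h = g" "v' = arr I c b h (y b)"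
      using V(2) by (auto simp: V_def)
    obtain q where q: "q \<in> J" "rel a q" "rel b q" "cmp C c a q (inc a q) f = cmp C c b q (inc b q) h"
      using k_mono[OF c a(1) b(1) a(2) b(2) trans[OF a(3) b(3)[symmetric]]] by blast
    have "v = arr I c q (cmp C c a q (inc a q) f) (y q)"
      using cmodule_arr_comp[OF Ic c J_obj[OF a(1)] J_obj[OF q(1)] a(2) inc_mor[OF a(1) q(1,2)] yc[OF
          q(1)]] y a q
      by (simp add: compatible_def)
    also have "\<dots> = v'"
      unfolding q(4)
      using cmodule_arr_comp[OF Ic c J_obj[OF b(1)] J_obj[OF q(1)] b(2) inc_mor[OF b(1) q(1,3)] yc[OF
          q(1)]] y b q
      by (simp add: compatible_def)
    finally show ?thesis .
  qed
  define v where "v = (\<lambda>p\<in>incoming C P. if \<exists>v. V (fst p) (snd p) v then SOME v. V (fst p) (snd p) v else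
      \<one>\<^bsub>val I (fst p)\<^esub>)"
  have V_closed: "w \<in> carrier (val I c)" if "c \<in> obj C" "V c g w" for c g w
    using that cmodule_arr_closed[OF Ic _ J_obj _ yc] by (auto simp: V_def)
  have "v \<in> carrier (val (godement C I) P)"
    unfolding val_godement carrier_product_group v_def
  proof (rule restrict_PiE_iff[THEN iffD2], rule ballI)
    fix p assume "p \<in> incoming C P"
    then have c: "fst p \<in> obj C" by (auto simp: incoming_def)
    show "(if \<exists>v. V (fst p) (snd p) v then SOME v. V (fst p) (snd p) v else \<one>\<^bsub>val I (fst p)\<^esub>) \<in> carrier (val
        I (fst p))"
      using V_closed[OF c someI_ex[of "V (fst p) (snd p)"]] comm_groupE(2)[OF cmodule_comm_group[OF Ic c]]
          by simp
  qed
  then have vc: "v \<in> carrier (val (godement C I) P)" .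
  have "arr (godement C I) a P (k a) v = godement_unit C I a (y a)" if a: "a \<in> J" for a
  proof (rule extensionalityI)
    show "arr (godement C I) a P (k a) v \<in> extensional (incoming C a)" by (simp add: godement_def)
    show "godement_unit C I a (y a) \<in> extensional (incoming C a)" by (simp add: godement_unit_def)
    fix p assume p: "p \<in> incoming C a"
    then have c: "fst p \<in> obj C" "snd p \<in> mor C (fst p) a" by (auto simp: incoming_def)
    let ?g = "cmp C (fst p) a P (k a) (snd p)"
    have V: "V (fst p) ?g (arr I (fst p) a (snd p) (y a))" using a c by (auto simp: V_def)
    have "(fst p, ?g) \<in> incoming C P" by (rule incoming_comp[OF C J_obj[OF a] P k[OF a] p])
    then have "v (fst p, ?g) = (SOME v. V (fst p) ?g v)" using V by (auto simp: v_def)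
    also have "\<dots> = arr I (fst p) a (snd p) (y a)"
        by (rule V_unique[OF c(1) someI[of "V (fst p) ?g", OF V] V])
    finally show "arr (godement C I) a P (k a) v p = godement_unit C I a (y a) p"
      using p by (simp add: arr_godement godement_unit_def)
  qed
  then have "arr I a P (k a) (r P v) = y a" if a: "a \<in> J" for a
    using cmod_hom_natural[OF r(1) J_obj[OF a] P k[OF a] vc] r(2)[OF J_obj[OF a] yc[OF a]] a by simp
  then show ?thesis using cmod_hom_closed[OF r(1) P vc] by blast
qed

text \<open>An arbitrary preimage \<open>z\<close> of \<open>x\<close> is corrected. Its
  restrictions to \<open>J\<close> form a compatible family of cocycles, hence by
  \<open>compatible_exact\<close> the image of a compatible family, which extends to an element
  \<open>u'\<close> at \<open>P\<close>; subtracting the differential of \<open>u'\<close> from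
  \<open>z\<close> kills all restrictions. In degree 0 the restrictions of \<open>z\<close> are
  trivial from the start, because \<open>d 0\<close> is injective on \<open>J\<close>.\<close>

lemma vanishing_lift:
  assumes P_exact0: "\<And>x. x \<in> carrier (val (W 0) P) \<Longrightarrow> d 0 P x = \<one>\<^bsub>val (W 1) P\<^esub> \<Longrightarrow> x = \<one>\<^bsub>val (W 0) P\<^esub>"
    and P_exact: "\<And>n x. x \<in> carrier (val (W (Suc n)) P) \<Longrightarrow> d (Suc n) P x = \<one>\<^bsub>val (W (Suc (Suc n))) P\<^esub> \<Longrightarrow>
      \<exists>y\<in>carrier (val (W n) P). d n P y = x"
    and x: "x \<in> carrier (val (W (Suc n)) P)" "d (Suc n) P x = \<one>\<^bsub>val (W (Suc (Suc n))) P\<^esub>"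
      "\<And>a. a \<in> J \<Longrightarrow> arr (W (Suc n)) a P (k a) x = \<one>\<^bsub>val (W (Suc n)) a\<^esub>"
  shows "\<exists>y\<in>carrier (val (W n) P). d n P y = x \<and> (\<forall>a\<in>J. arr (W n) a P (k a) y = \<one>\<^bsub>val (W n) a\<^esub>)"
proof -
  obtain z where z: "z \<in> carrier (val (W n) P)" "d n P z = x" using P_exact[OF x(1,2)] by blast
  let ?z = "\<lambda>a. arr (W n) a P (k a) z"
  have zc: "?z a \<in> carrier (val (W n) a)" if a: "a \<in> J" for a
    by (rule cmodule_arr_closed[OF cmodule_W J_obj[OF a] P k[OF a] z(1)])
  have dz: "d n a (?z a) = \<one>\<^bsub>val (W (Suc n)) a\<^esub>" if a: "a \<in> J" for a
    using cmod_hom_natural[OF d J_obj[OF a] P k[OF a] z(1)] z(2) x(3)[OF a] by simp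
  show ?thesis
  proof (cases n)
    case 0
    then have "?z a = \<one>\<^bsub>val (W n) a\<^esub>" if a: "a \<in> J" for a using exact0[OF a] zc[OF a] dz[OF a] by simp
    then show ?thesis using z by blast
  next
    case (Suc m)
    have "compatible (W n) ?z"
      unfolding compatible_def
    proof (intro conjI ballI impI zc)
      fix a b assume ab: "a \<in> J" "b \<in> J" "rel a b"
      show "arr (W n) a b (inc a b) (?z b) = ?z a"
        using cmodule_arr_comp[OF cmodule_W J_obj[OF ab(1)] J_obj[OF ab(2)] P inc_mor[OF ab] k[OF ab(2)]
            z(1)] k_inc[OF ab] by simp
    qed
    then obtain u where u: "compatible (W m) u" "\<And>a. a \<in> J \<Longrightarrow> d m a (u a) = ?z a"
      using compatible_exact[of m ?z] dz by (auto simp: Suc)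
    obtain u' where u': "u' \<in> carrier (val (W m) P)" "\<And>a. a \<in> J \<Longrightarrow> arr (W m) a P (k a) u' = u a"
      using compatible_extends[OF injective u(1)] by blast
    have du: "d m P u' \<in> carrier (val (W n) P)" unfolding Suc by (rule cmod_hom_closed[OF d P u'(1)])
    have ddu: "d n P (d m P u') = \<one>\<^bsub>val (W (Suc n)) P\<^esub>" unfolding Suc by (rule dd[OF P u'(1)])
    note cg = cmodule_comm_group[OF cmodule_W]
    let ?y = "z \<div>\<^bsub>val (W n) P\<^esub> d m P u'"
    have "?y \<in> carrier (val (W n) P)" by (rule comm_group_diff_closed[OF cg[OF P] z(1) du])
    moreover have "d n P ?y = x"
      using hom_diff[OF cmod_hom_hom[OF d P] cg[OF P] cg[OF P] z(1) du] comm_group_diff_one[OF cg[OF P]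
          x(1)]
      by (simp add: ddu z(2))
    moreover have "arr (W n) a P (k a) ?y = \<one>\<^bsub>val (W n) a\<^esub>" if a: "a \<in> J" for a
    proof -
      have "arr (W n) a P (k a) (d m P u') = ?z a"
        using cmod_hom_natural[OF d J_obj[OF a] P k[OF a] u'(1)] u'(2)[OF a] u(2)[OF a] by (simp add: Suc)
      then show ?thesis
        using hom_diff[OF cmodule_arr_hom[OF cmodule_W J_obj[OF a] P k[OF a]] cg[OF P] cg[OF J_obj[OF a]]
            z(1) du]
          comm_group_diff_self[OF cg[OF J_obj[OF a]] zc[OF a]] by simp
    qed
    ultimately show ?thesis by blast
  qed
qed

end

end

section \<open>Restriction to a sieve\<close>

text \<open>The largest submodule of \<open>\<Phi>\<close> that is trivial on \<open>S\<close>: for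
  \<open>a\<close> in \<open>S\<close> the identity of \<open>a\<close> is among the arrows
  tested.\<close>

definition vanishing :: "('o, 'r) cat \<Rightarrow> 'o set \<Rightarrow> ('o, 'r, 'u) cmod \<Rightarrow> ('o, 'r, 'u) cmod" where
  "vanishing C S \<Phi> = \<lparr>
     val = (\<lambda>a. (val \<Phi> a)\<lparr>carrier := {x \<in> carrier (val \<Phi> a). \<forall>b\<in>S. \<forall>f\<in>mor C b a. arr \<Phi> b a f x =
         \<one>\<^bsub>val \<Phi> b\<^esub>}\<rparr>),
     arr = arr \<Phi>\<rparr>"

lemma vanishing_simps [simp]:
  "x \<in> carrier (val (vanishing C S \<Phi>) a) \<longleftrightarrow>
     x \<in> carrier (val \<Phi> a) \<and> (\<forall>b\<in>S. \<forall>f\<in>mor C b a. arr \<Phi> b a f x = \<one>\<^bsub>val \<Phi> b\<^esub>)"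
  "\<one>\<^bsub>val (vanishing C S \<Phi>) a\<^esub> = \<one>\<^bsub>val \<Phi> a\<^esub>"
  "x \<otimes>\<^bsub>val (vanishing C S \<Phi>) a\<^esub> y = x \<otimes>\<^bsub>val \<Phi> a\<^esub> y"
  "arr (vanishing C S \<Phi>) = arr \<Phi>"
  by (simp_all add: vanishing_def)

lemma comm_group_inv_one: "comm_group G \<Longrightarrow> inv\<^bsub>G\<^esub> \<one>\<^bsub>G\<^esub> = \<one>\<^bsub>G\<^esub>"
  by (simp add: comm_group_def comm_monoid_def monoid.inv_one)

lemma cmodule_vanishing:
  assumes C: "small_category C" and \<Phi>: "cmodule C \<Phi>" and S: "S \<subseteq> obj C"
  shows "cmodule C (vanishing C S \<Phi>)"
proof (rule cmoduleI)
  note cg = cmodule_comm_group[OF \<Phi>]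
  fix a assume a: "a \<in> obj C"
  have ah: "arr \<Phi> b a f \<in> hom (val \<Phi> a) (val \<Phi> b)" "comm_group (val \<Phi> b)" if "b \<in> S" "f \<in> mor C b a" for b f
    using cmodule_arr_hom[OF \<Phi> _ a] cg that S by auto
  interpret a: comm_group "val \<Phi> a" by (rule cg[OF a])
  have "subgroup {x \<in> carrier (val \<Phi> a). \<forall>b\<in>S. \<forall>f\<in>mor C b a. arr \<Phi> b a f x = \<one>\<^bsub>val \<Phi> b\<^esub>} (val \<Phi> a)"
  proof (rule a.subgroupI)
    show "{x \<in> carrier (val \<Phi> a). \<forall>b\<in>S. \<forall>f\<in>mor C b a. arr \<Phi> b a f x = \<one>\<^bsub>val \<Phi> b\<^esub>} \<noteq> {}"
      using hom_one_comm[OF ah(1) a.comm_group_axioms ah(2)] by blast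
  qed (auto simp: hom_inv_comm[OF ah(1) a.comm_group_axioms ah(2)] hom_mult[OF ah(1)] comm_groupE(2)[OF
      ah(2)]
      comm_groupE(5)[OF ah(2)] comm_group_inv_one[OF ah(2)])
  then show "comm_group (val (vanishing C S \<Phi>) a)"
    using comm_group_subgroup[OF a.comm_group_axioms] by (simp add: vanishing_def)
next
  fix a b f assume h: "a \<in> obj C" "b \<in> obj C" "f \<in> mor C a b"
  have "arr \<Phi> c a g (arr \<Phi> a b f x) = \<one>\<^bsub>val \<Phi> c\<^esub>"
    if "c \<in> S" "g \<in> mor C c a" "x \<in> carrier (val (vanishing C S \<Phi>) b)" for c g x
  proof -
    have c: "c \<in> obj C" using that(1) S by blast
    have "cmp C c a b f g \<in> mor C c b" by (rule small_categoryD(2)[OF C c h(1,2) that(2) h(3)])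
    then show ?thesis using cmodule_arr_comp[OF \<Phi> c h(1,2) that(2) h(3)] that by simp
  qed
  then show "arr (vanishing C S \<Phi>) a b f \<in> hom (val (vanishing C S \<Phi>) b) (val (vanishing C S \<Phi>) a)"
    using cmodule_arr_hom[OF \<Phi> h] by (auto simp: hom_def)
qed (use cmodule_arr_id[OF \<Phi>] cmodule_arr_comp[OF \<Phi>] in auto)

lemma vanishing_map:
  assumes "cmodule C \<Phi>" "cmodule C \<Psi>" "\<eta> \<in> cmod_hom C \<Phi> \<Psi>" "S \<subseteq> obj C"
  shows "\<eta> \<in> cmod_hom C (vanishing C S \<Phi>) (vanishing C S \<Psi>)"
proof (rule cmod_homI)
  fix a assume a: "a \<in> obj C"
  have "arr \<Psi> b a f (\<eta> a x) = \<one>\<^bsub>val \<Psi> b\<^esub>"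
    if "b \<in> S" "f \<in> mor C b a" "x \<in> carrier (val (vanishing C S \<Phi>) a)" for b f x
    using cmod_hom_natural[OF assms(3) _ a that(2), symmetric, of x] cmod_hom_one[OF assms(3,1,2)] that
        assms(4) by auto
  then show "\<eta> a \<in> hom (val (vanishing C S \<Phi>) a) (val (vanishing C S \<Psi>) a)"
    using cmod_hom_hom[OF assms(3) a] by (auto simp: hom_def)
qed (use cmod_hom_natural[OF assms(3)] in simp)

lemma lim_restrict_hom:
  assumes "S \<subseteq> obj C"
  shows "lim_restrict (full_subcat C S) \<in> hom (cat_lim C \<Phi>) (cat_lim (full_subcat C S) \<Phi>)"
proof (rule homI)
  fix x assume x: "x \<in> carrier (cat_lim C \<Phi>)"
  show "lim_restrict (full_subcat C S) x \<in> carrier (cat_lim (full_subcat C S) \<Phi>)"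
    unfolding lim_restrict_def
    by (rule restrict_in_cat_lim) (simp_all add: cat_lim_closed[OF x] cat_lim_compat[OF x] subsetD[OF
        assms])
next
  fix x y
  show "lim_restrict (full_subcat C S) (x \<otimes>\<^bsub>cat_lim C \<Phi>\<^esub> y)
    = lim_restrict (full_subcat C S) x \<otimes>\<^bsub>cat_lim (full_subcat C S) \<Phi>\<^esub> lim_restrict (full_subcat C S) y"
    unfolding mult_cat_lim lim_restrict_def by (rule restrict_ext) (use assms in auto)
qed

lemma lim_restrict_lim_map:
  "S \<subseteq> obj C \<Longrightarrow> lim_restrict (full_subcat C S) (lim_map C \<eta> x) = lim_map (full_subcat C S) \<eta> (lim_restrict
      (full_subcat C S) x)"
  by (auto simp: lim_restrict_def lim_map_def restrict_def fun_eq_iff)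

text \<open>The vanishing submodules form an exact complex and \<open>W\<close> consists of
  injectives, so the inclusion of the former into \<open>W\<close> is null-homotopic; a homotopy
  with values in \<open>W\<close> is enough. This makes the kernel of the restriction of limits
  acyclic. As restriction is surjective, the rest is the argument of the long exact sequence,
  carried out on elements.\<close>

lemma quasi_iso_lim_restrict:
  fixes C :: "('o, 'r) cat" and W :: "nat \<Rightarrow> ('o, 'r, 'u) cmod" and e :: "('o \<times> 'r \<Rightarrow> 'u) \<Rightarrow> 'u"
  assumes C: "small_category C" and W: "\<And>n. injective_cmodule C (W n)" and e: "inj e"
    and d: "\<And>n. d n \<in> cmod_hom C (W n) (W (Suc n))"
    and dd: "\<And>n a x. a \<in> obj C \<Longrightarrow> x \<in> carrier (val (W n) a) \<Longrightarrow> d (Suc n) a (d n a x) =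
        \<one>\<^bsub>val (W (Suc (Suc n))) a\<^esub>"
    and S: "S \<subseteq> obj C" and sieve: "\<And>a b f. \<lbrakk>a \<in> obj C; b \<in> S; f \<in> mor C a b\<rbrakk> \<Longrightarrow> a \<in> S"
    and exact0: "\<And>a x. \<lbrakk>a \<in> obj C; x \<in> carrier (val (vanishing C S (W 0)) a); d 0 a x = \<one>\<^bsub>val (W 1) a\<^esub>\<rbrakk> \<Longrightarrow> x =
        \<one>\<^bsub>val (W 0) a\<^esub>"
    and exact: "\<And>n a x. \<lbrakk>a \<in> obj C; x \<in> carrier (val (vanishing C S (W (Suc n))) a); d (Suc n) a x =
        \<one>\<^bsub>val (W (Suc (Suc n))) a\<^esub>\<rbrakk> \<Longrightarrow> \<exists>y\<in>carrier (val (vanishing C S (W n)) a). d n a y = x"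
  shows "quasi_iso (\<lambda>n. cat_lim C (W n)) (\<lambda>n. lim_map C (d n))
    (\<lambda>n. cat_lim (full_subcat C S) (W n)) (\<lambda>n. lim_map (full_subcat C S) (d n)) (\<lambda>n. lim_restrict
        (full_subcat C S))"
proof -
  let ?D = "full_subcat C S"
  let ?K = "\<lambda>n. cat_lim C (W n)" and ?dK = "\<lambda>n. lim_map C (d n)"
  let ?L = "\<lambda>n. cat_lim ?D (W n)" and ?dL = "\<lambda>n. lim_map ?D (d n)" and ?\<rho> = "lim_restrict ?D"
  note Wc = injective_cmodule_cmodule[OF W]
  note WD = cmodule_full_subcat[OF Wc S] and dD = cmod_hom_full_subcat[OF d S]
  have K: "cochain_complex ?K ?dK" 
    by (rule cochain_complex_lim, rule Wc, rule d) (rule dd)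
  have L: "cochain_complex ?L ?dL" 
    by (rule cochain_complex_lim, rule WD, rule dD) (simp add: dd subsetD[OF S])
  have \<rho>: "?\<rho> \<in> hom (?K n) (?L n)" for n by (rule lim_restrict_hom[OF S])
  have \<rho>d: "?\<rho> (?dK n x) = ?dL n (?\<rho> x)" for n x by (rule lim_restrict_lim_map[OF S])
  have map: "cochain_map ?K ?dK ?L ?dL (\<lambda>n. ?\<rho>)" using \<rho> \<rho>d by (simp add: cochain_map_def)
  let ?V = "\<lambda>n. vanishing C S (W n)"
  note Vc = cmodule_vanishing[OF C Wc S]
  note Vd = vanishing_map[OF Wc Wc d S]
  have inc: "(\<lambda>a x. x) \<in> cmod_hom C (?V n) (W n)" for n by (rule cmod_homI, rule homI) simp_all
  have "\<exists>h. (\<forall>n. h n \<in> cmod_hom C (?V (Suc n)) (W n)) \<and>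
    (\<forall>a\<in>obj C. \<forall>x\<in>carrier (val (?V 0) a). (\<lambda>a x. x) a x = h 0 a (d 0 a x)) \<and>
    (\<forall>n. \<forall>a\<in>obj C. \<forall>x\<in>carrier (val (?V (Suc n)) a).
      (\<lambda>a x. x) a x = h (Suc n) a (d (Suc n) a x) \<otimes>\<^bsub>val (W (Suc n)) a\<^esub> d n a (h n a x))"
    by (rule null_homotopy_exists[where W = ?V and Y = W and dW = d and dY = d and f = "\<lambda>n a x. x", OF Vc W
        Vd d inc _ dd])
      (use exact0 exact in \<open>simp_all del: vanishing_simps(1)\<close>)
  then obtain h where h': "\<forall>n. h n \<in> cmod_hom C (?V (Suc n)) (W n)"
    "\<forall>a\<in>obj C. \<forall>x\<in>carrier (val (?V 0) a). x = h 0 a (d 0 a x)"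
    "\<forall>n. \<forall>a\<in>obj C. \<forall>x\<in>carrier (val (?V (Suc n)) a).
      x = h (Suc n) a (d (Suc n) a x) \<otimes>\<^bsub>val (W (Suc n)) a\<^esub> d n a (h n a x)"
    by (elim exE conjE) (rule that)
  note h = h'(1)[THEN spec] h'(2)[THEN bspec, THEN bspec] h'(3)[THEN spec, THEN bspec, THEN bspec]
  \<comment> \<open>A cocycle that restricts trivially lies in the limit of \<open>?V\<close>, so
    the homotopy bounds it. The bounding element also restricts trivially: on \<open>S\<close> it is
    the image of a trivial element under \<open>h m\<close>.\<close>
  have key: "(n = 0 \<longrightarrow> x = \<one>\<^bsub>?K n\<^esub>) \<and> (\<forall>m. n = Suc m \<longrightarrow> (\<exists>y\<in>carrier (?K m). ?dK m y = x \<and> ?\<rho> y = \<one>\<^bsub>?L m\<^esub>))"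
    if x: "x \<in> cocycles ?K ?dK n" and \<rho>x: "?\<rho> x = \<one>\<^bsub>?L n\<^esub>" for n x
  proof -
    have xl: "x \<in> carrier (?K n)" using x by (simp add: in_cocycles_lim)
    have xS: "x b = \<one>\<^bsub>val (W n) b\<^esub>" if "b \<in> S" for b
      using fun_cong[OF \<rho>x, of b] that by (simp add: lim_restrict_def one_cat_lim)
    have xV: "x a \<in> carrier (val (?V n) a)" if a: "a \<in> obj C" for a
      using cat_lim_closed[OF xl a] cat_lim_compat[OF xl _ a] xS S by auto
    have "x = (\<lambda>a\<in>obj C. x a)" using xl by (auto simp: in_cat_lim PiE_def extensional_restrict)
    moreover have "(\<lambda>a\<in>obj C. x a) \<in> carrier (cat_lim C (?V n))"
      by (rule restrict_in_cat_lim[OF xV]) (simp_all add: cat_lim_compat[OF xl])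
    ultimately have xV': "x \<in> carrier (cat_lim C (?V n))" by simp
    then have xz: "x \<in> cocycles (\<lambda>n. cat_lim C (?V n)) ?dK n" using x by (simp add: in_cocycles_lim)
    have id: "lim_map C (\<lambda>a x. x) x = x" using xl
        by (auto simp: lim_map_def in_cat_lim PiE_def extensional_restrict)
    have nh0: "x = \<one>\<^bsub>?K 0\<^esub>" if "n = 0"
      by (rule lim_null_homotopic(1)[where W = ?V and Y = W and dW = d and dY = d and f = "\<lambda>n a x. x" and h
          = h,
        OF Vc Wc Vd d h xz that, unfolded id])
    have nh: "x = ?dK m (lim_map C (h m) x)" if "n = Suc m" for m
      by (rule lim_null_homotopic(2)[where W = ?V and Y = W and dW = d and dY = d and f = "\<lambda>n a x. x" and h
          = h,
        OF Vc Wc Vd d h xz that, unfolded id])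
    have "\<exists>y\<in>carrier (?K m). ?dK m y = x \<and> ?\<rho> y = \<one>\<^bsub>?L m\<^esub>" if n: "n = Suc m" for m
    proof (intro bexI conjI)
      show "?dK m (lim_map C (h m) x) = x" by (rule nh[OF n, symmetric])
      show "lim_map C (h m) x \<in> carrier (?K m)" using lim_map_in_cat_lim[OF h(1)] xV' n by blast
      show "?\<rho> (lim_map C (h m) x) = \<one>\<^bsub>?L m\<^esub>"
        unfolding one_cat_lim lim_restrict_def
      proof (rule restrict_ext)
        fix b assume "b \<in> obj ?D"
        then have b: "b \<in> S" "b \<in> obj C" using S by auto
        show "lim_map C (h m) x b = \<one>\<^bsub>val (W m) b\<^esub>"
          using cmod_hom_one[OF h(1) Vc Wc b(2), of m] xS[OF b(1)] by (simp add: lim_map_apply[OF b(2)] n)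
      qed
    qed
    then show ?thesis using nh0 by blast
  qed
  have surj: "\<exists>x\<in>carrier (?K n). ?\<rho> x = y" if "y \<in> carrier (?L n)" for n y
    by (rule lim_restrict_surj[OF C W e S sieve that])
  show ?thesis
    unfolding quasi_iso_def
  proof (intro conjI allI ballI impI map)
    fix n x assume x: "x \<in> cocycles ?K ?dK n" and \<rho>x: "?\<rho> x \<in> coboundaries ?L ?dL n"
    show "x \<in> coboundaries ?K ?dK n"
    proof (cases n)
      case 0
      then show ?thesis using key[OF x] \<rho>x by (simp add: coboundaries_def)
    next
      case (Suc m)
      then obtain b where b: "b \<in> carrier (?L m)" "?\<rho> x = ?dL m b" using \<rho>x by (auto simp: coboundaries_def)
      obtain a where a: "a \<in> carrier (?K m)" "?\<rho> a = b" using surj[OF b(1)] by blast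
      interpret Kn: comm_group "?K n" by (rule cochain_complexD(1)[OF K])
      have xc: "x \<in> carrier (?K n)" using x by (simp add: in_cocycles_lim)
      have da: "?dK m a \<in> coboundaries ?K ?dK n" using a(1) by (simp add: Suc coboundaries_def)
      note daz = subsetD[OF coboundaries_subset_cocycles[OF K] da]
      have dac: "?dK m a \<in> carrier (?K n)" using daz by (simp add: in_cocycles_lim)
      let ?x = "x \<div>\<^bsub>?K n\<^esub> ?dK m a"
      note s = subgroup_cocycles[OF K, of n] and t = subgroup_coboundaries[OF K, of n]
      have x': "?x \<in> cocycles ?K ?dK n" by (rule subgroup.m_closed[OF s x subgroup.m_inv_closed[OF s daz]])
      have "?\<rho> ?x = ?\<rho> x \<div>\<^bsub>?L n\<^esub> ?\<rho> (?dK m a)"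
        by (rule hom_diff[OF \<rho> Kn.comm_group_axioms cochain_complexD(1)[OF L] xc dac])
      also have "?\<rho> (?dK m a) = ?\<rho> x" by (simp add: \<rho>d a(2) b(2))
      also have "?\<rho> x \<div>\<^bsub>?L n\<^esub> ?\<rho> x = \<one>\<^bsub>?L n\<^esub>"
        by (rule comm_group_diff_self[OF cochain_complexD(1)[OF L] hom_in_carrier[OF \<rho> xc]])
      finally obtain w where w: "w \<in> carrier (?K m)" "?dK m w = ?x" using key[OF x'] Suc by blast
      have "?x \<in> coboundaries ?K ?dK n"
        unfolding w(2)[symmetric] using w(1) by (simp add: Suc coboundaries_def)
      from subgroup.m_closed[OF t this da] show ?thesis
        using comm_group_diff_mult[OF Kn.comm_group_axioms xc dac] by simp
    qed
  next
    fix n y assume y: "y \<in> cocycles ?L ?dL n"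
    then have yc: "y \<in> carrier (?L n)" by (simp add: in_cocycles_lim)
    obtain a where a: "a \<in> carrier (?K n)" "?\<rho> a = y" using surj[OF yc] by blast
    \<comment> \<open>A lift \<open>a\<close> of a cocycle need not be a cocycle, but its
      differential restricts trivially and is by \<open>key\<close> the differential of some
      \<open>a'\<close> with trivial restriction; the difference of \<open>a\<close> and
      \<open>a'\<close> is the cocycle sought.\<close>
    have da: "?dK n a \<in> cocycles ?K ?dK (Suc n)"
      using a(1) by (intro subsetD[OF coboundaries_subset_cocycles[OF K]]) (simp add: coboundaries_def)
    have "?\<rho> (?dK n a) = \<one>\<^bsub>?L (Suc n)\<^esub>" using y by (simp add: \<rho>d a(2) cocycles_def kernel_def)
    then obtain a' where a': "a' \<in> carrier (?K n)" "?dK n a' = ?dK n a" "?\<rho> a' = \<one>\<^bsub>?L n\<^esub>"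
      using key[OF da] by blast
    interpret Kn: comm_group "?K n" by (rule cochain_complexD(1)[OF K])
    note cL = cochain_complexD(1)[OF L] and cK = cochain_complexD(1)[OF K]
    let ?x = "a \<div>\<^bsub>?K n\<^esub> a'"
    have "?dK n ?x = \<one>\<^bsub>?K (Suc n)\<^esub>"
      using hom_diff[OF cochain_complexD(2)[OF K] cK cK a(1) a'(1)]
        comm_group_diff_self[OF cK hom_in_carrier[OF cochain_complexD(2)[OF K] a(1)]] by (simp add: a'(2))
    then have "?x \<in> cocycles ?K ?dK n" using a(1) a'(1) by (simp add: cocycles_def kernel_def)
    moreover have "?\<rho> ?x = y"
      using hom_diff[OF \<rho> cK cL a(1) a'(1)] comm_group_diff_one[OF cL yc] by (simp add: a(2) a'(3))
    moreover have "y \<div>\<^bsub>?L n\<^esub> y \<in> coboundaries ?L ?dL n"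
      using comm_group_diff_self[OF cL yc] subgroup.one_closed[OF subgroup_coboundaries[OF L]] by simp
    ultimately show "\<exists>x\<in>cocycles ?K ?dK n. ?\<rho> x \<div>\<^bsub>?L n\<^esub> y \<in> coboundaries ?L ?dL n"
      by (intro bexI[of _ ?x]) simp_all
  qed
qed

text \<open>The difference of the two chain maps is trivial on the kernel of \<open>dW 0\<close>, so
  it has a null homotopy, whose limit exhibits the difference as a coboundary on cocycles.\<close>

lemma homotopic_lim:
  fixes W Y :: "nat \<Rightarrow> ('o, 'r, 'u) cmod"
  assumes W: "\<And>n. cmodule C (W n)" and Y: "\<And>n. injective_cmodule C (Y n)"
    and dW: "\<And>n. dW n \<in> cmod_hom C (W n) (W (Suc n))" and dY: "\<And>n. dY n \<in> cmod_hom C (Y n) (Y (Suc n))"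
    and dYdY: "\<And>n a y. a \<in> obj C \<Longrightarrow> y \<in> carrier (val (Y n) a) \<Longrightarrow>
      dY (Suc n) a (dY n a y) = \<one>\<^bsub>val (Y (Suc (Suc n))) a\<^esub>"
    and exact: "\<And>n a x. \<lbrakk>a \<in> obj C; x \<in> carrier (val (W (Suc n)) a); dW (Suc n) a x =
        \<one>\<^bsub>val (W (Suc (Suc n))) a\<^esub>\<rbrakk> \<Longrightarrow> \<exists>y\<in>carrier (val (W n) a). dW n a y = x"
    and f: "\<And>n. f n \<in> cmod_hom C (W n) (Y n)" and g: "\<And>n. g n \<in> cmod_hom C (W n) (Y n)"
    and fd: "\<And>n a x. a \<in> obj C \<Longrightarrow> x \<in> carrier (val (W n) a) \<Longrightarrow> f (Suc n) a (dW n a x) = dY n a (f n a x)"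
    and gd: "\<And>n a x. a \<in> obj C \<Longrightarrow> x \<in> carrier (val (W n) a) \<Longrightarrow> g (Suc n) a (dW n a x) = dY n a (g n a x)"
    and ker0: "\<And>a x. \<lbrakk>a \<in> obj C; x \<in> carrier (val (W 0) a); dW 0 a x = \<one>\<^bsub>val (W 1) a\<^esub>\<rbrakk> \<Longrightarrow> f 0 a x = g 0 a x"
    and x: "x \<in> cocycles (\<lambda>n. cat_lim C (W n)) (\<lambda>n. lim_map C (dW n)) n"
  shows "lim_map C (f n) x \<div>\<^bsub>cat_lim C (Y n)\<^esub> lim_map C (g n) x
    \<in> coboundaries (\<lambda>n. cat_lim C (Y n)) (\<lambda>n. lim_map C (dY n)) n"
proof -
  note Yc = injective_cmodule_cmodule[OF Y]
  note cg = cmodule_comm_group[OF Yc]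
  define F where "F n a x = f n a x \<div>\<^bsub>val (Y n) a\<^esub> g n a x" for n a x
  have F: "F n \<in> cmod_hom C (W n) (Y n)" for n
    using cmod_hom_diff[OF f g Yc, of n] by (simp add: F_def[abs_def])
  have Fd: "F (Suc n) a (dW n a x) = dY n a (F n a x)" if h: "a \<in> obj C" "x \<in> carrier (val (W n) a)" for n
      a x
    using hom_diff[OF cmod_hom_hom[OF dY h(1)] cg[OF h(1)] cg[OF h(1)] cmod_hom_closed[OF f h]
        cmod_hom_closed[OF g h]]
    by (simp add: F_def fd[OF h] gd[OF h])
  have F0: "F 0 a x = \<one>\<^bsub>val (Y 0) a\<^esub>" if h: "a \<in> obj C" "x \<in> carrier (val (W 0) a)" "dW 0 a x = \<one>\<^bsub>val (W 1) a\<^esub>"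
      for a x
    using comm_group_diff_self[OF cg[OF h(1)] cmod_hom_closed[OF g h(1,2)]] ker0[OF h] by (simp add: F_def)
  have "\<exists>h. (\<forall>n. h n \<in> cmod_hom C (W (Suc n)) (Y n)) \<and>
    (\<forall>a\<in>obj C. \<forall>x\<in>carrier (val (W 0) a). F 0 a x = h 0 a (dW 0 a x)) \<and>
    (\<forall>n. \<forall>a\<in>obj C. \<forall>x\<in>carrier (val (W (Suc n)) a).
      F (Suc n) a x = h (Suc n) a (dW (Suc n) a x) \<otimes>\<^bsub>val (Y (Suc n)) a\<^esub> dY n a (h n a x))"
    by (rule null_homotopy_exists[where W = W and Y = Y and dW = dW and dY = dY and f = F, OF W Y dW dY F
        Fd dYdY F0 exact])
  then obtain h where h': "\<forall>n. h n \<in> cmod_hom C (W (Suc n)) (Y n)"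
    "\<forall>a\<in>obj C. \<forall>x\<in>carrier (val (W 0) a). F 0 a x = h 0 a (dW 0 a x)"
    "\<forall>n. \<forall>a\<in>obj C. \<forall>x\<in>carrier (val (W (Suc n)) a).
      F (Suc n) a x = h (Suc n) a (dW (Suc n) a x) \<otimes>\<^bsub>val (Y (Suc n)) a\<^esub> dY n a (h n a x)"
    by (elim exE conjE) (rule that)
  note h = h'(1)[THEN spec] h'(2)[THEN bspec, THEN bspec] h'(3)[THEN spec, THEN bspec, THEN bspec]
  have nh0: "lim_map C (F n) x = \<one>\<^bsub>cat_lim C (Y 0)\<^esub>" if "n = 0"
    by (rule lim_null_homotopic(1)[where W = W and Y = Y and dW = dW and dY = dY and f = F and h = h,
        OF W Yc dW dY h x that])
  have nh: "lim_map C (F n) x = lim_map C (dY m) (lim_map C (h m) x)" if "n = Suc m" for m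
    by (rule lim_null_homotopic(2)[where W = W and Y = Y and dW = dW and dY = dY and f = F and h = h,
        OF W Yc dW dY h x that])
  have xc: "x \<in> carrier (cat_lim C (W n))" using x by (simp add: in_cocycles_lim)
  note fx = lim_map_in_cat_lim[OF f xc] and gx = lim_map_in_cat_lim[OF g xc]
  have "lim_map C (f n) x \<div>\<^bsub>cat_lim C (Y n)\<^esub> lim_map C (g n) x = lim_map C (F n) x"
    unfolding mult_cat_lim lim_map_def[of C "F n"]
    by (rule restrict_ext) (simp add: inv_cat_lim[OF Yc gx] lim_map_apply F_def)
  moreover have "lim_map C (F n) x \<in> coboundaries (\<lambda>n. cat_lim C (Y n)) (\<lambda>n. lim_map C (dY n)) n"
  proof (cases n)
    case 0
    then show ?thesis using nh0 by (simp add: coboundaries_def)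
  next
    case (Suc m)
    have "lim_map C (h m) x \<in> carrier (cat_lim C (Y m))"
      using lim_map_in_cat_lim[of "h m" C "W (Suc m)" "Y m" x] h(1) xc by (simp add: Suc)
    then show ?thesis using nh[OF Suc] by (simp add: coboundaries_def Suc)
  qed
  ultimately show ?thesis by simp
qed

section \<open>Orbit categories\<close>

lemma injective_resolutionD:
  assumes "injective_resolution C \<Phi> R"
  shows "injective_cmodule C (term_at R n)" "augm R \<in> cmod_hom C \<Phi> (term_at R 0)"
    "diff_at R n \<in> cmod_hom C (term_at R n) (term_at R (Suc n))"
    "\<lbrakk>a \<in> obj C; x \<in> carrier (val \<Phi> a)\<rbrakk> \<Longrightarrow> diff_at R 0 a (augm R a x) = \<one>\<^bsub>val (term_at R 1) a\<^esub>"
    "\<lbrakk>a \<in> obj C; y \<in> carrier (val (term_at R 0) a); diff_at R 0 a y = \<one>\<^bsub>val (term_at R 1) a\<^esub>\<rbrakk> \<Longrightarrow>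
      \<exists>x\<in>carrier (val \<Phi> a). augm R a x = y"
    "\<lbrakk>a \<in> obj C; y \<in> carrier (val (term_at R n) a)\<rbrakk> \<Longrightarrow>
      diff_at R (Suc n) a (diff_at R n a y) = \<one>\<^bsub>val (term_at R (Suc (Suc n))) a\<^esub>"
    "\<lbrakk>a \<in> obj C; y \<in> carrier (val (term_at R (Suc n)) a); diff_at R (Suc n) a y =
        \<one>\<^bsub>val (term_at R (Suc (Suc n))) a\<^esub>\<rbrakk> \<Longrightarrow>
      \<exists>x\<in>carrier (val (term_at R n) a). diff_at R n a x = y"
    "\<lbrakk>a \<in> obj C; x \<in> carrier (val \<Phi> a); z \<in> carrier (val \<Phi> a); augm R a x = augm R a z\<rbrakk> \<Longrightarrow> x = z"
proof -
  note r = assms[unfolded injective_resolution_def]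
  show "injective_cmodule C (term_at R n)" "augm R \<in> cmod_hom C \<Phi> (term_at R 0)"
    "diff_at R n \<in> cmod_hom C (term_at R n) (term_at R (Suc n))"
    using r by blast+
  have k0: "augm R a ` carrier (val \<Phi> a) = kernel (val (term_at R 0) a) (val (term_at R 1) a) (diff_at R 0
      a)"
    and k: "diff_at R n a ` carrier (val (term_at R n) a) =
      kernel (val (term_at R (Suc n)) a) (val (term_at R (Suc (Suc n))) a) (diff_at R (Suc n) a)"
    and i: "inj_on (augm R a) (carrier (val \<Phi> a))" if "a \<in> obj C" for a n
    using r that by blast+
  show "diff_at R 0 a (augm R a x) = \<one>\<^bsub>val (term_at R 1) a\<^esub>" if "a \<in> obj C" "x \<in> carrier (val \<Phi> a)"
    using equalityD1[OF k0[OF that(1)]] that(2) by (auto simp: kernel_def)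
  show "\<exists>x\<in>carrier (val \<Phi> a). augm R a x = y"
    if "a \<in> obj C" "y \<in> carrier (val (term_at R 0) a)" "diff_at R 0 a y = \<one>\<^bsub>val (term_at R 1) a\<^esub>"
    using equalityD2[OF k0[OF that(1)]] that(2,3) by (auto simp: kernel_def)
  show "diff_at R (Suc n) a (diff_at R n a y) = \<one>\<^bsub>val (term_at R (Suc (Suc n))) a\<^esub>"
    if "a \<in> obj C" "y \<in> carrier (val (term_at R n) a)"
    using equalityD1[OF k[OF that(1)]] that(2) by (auto simp: kernel_def)
  show "\<exists>x\<in>carrier (val (term_at R n) a). diff_at R n a x = y"
    if "a \<in> obj C" "y \<in> carrier (val (term_at R (Suc n)) a)" "diff_at R (Suc n) a y =
        \<one>\<^bsub>val (term_at R (Suc (Suc n))) a\<^esub>"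
    using equalityD2[OF k[OF that(1)]] that(2,3) by (auto simp: kernel_def)
  show "x = z" if "a \<in> obj C" "x \<in> carrier (val \<Phi> a)" "z \<in> carrier (val \<Phi> a)" "augm R a x = augm R a z"
    using i[OF that(1)] that(2-4) by (auto dest: inj_onD)
qed

text \<open>The kernel of the first differential is the image of the augmentation, on which
  \<open>f 0\<close> is the identity; so \<open>homotopic_lim\<close> applies to \<open>f\<close>
  and the identity.\<close>

lemma lim_augmented_self_map:
  assumes R: "injective_resolution D \<Phi> R"
    and f: "\<And>n. f n \<in> cmod_hom D (term_at R n) (term_at R n)"
    and fd: "\<And>n a x. a \<in> obj D \<Longrightarrow> x \<in> carrier (val (term_at R n) a) \<Longrightarrow> f (Suc n) a (diff_at R n a x) =
        diff_at R n a (f n a x)"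
    and f_augm: "\<And>a x. a \<in> obj D \<Longrightarrow> x \<in> carrier (val \<Phi> a) \<Longrightarrow> f 0 a (augm R a x) = augm R a x"
    and x: "x \<in> cocycles (lim_terms D R) (lim_diffs D R) n"
  shows "lim_map D (f n) x \<div>\<^bsub>cat_lim D (term_at R n)\<^esub> x \<in> coboundaries (lim_terms D R) (lim_diffs D R) n"
proof -
  note RD = injective_resolutionD[OF R]
  have id: "(\<lambda>a x. x) \<in> cmod_hom D (term_at R n) (term_at R n)" for n
    by (rule cmod_homI, rule homI) simp_all
  have "lim_map D (\<lambda>a x. x) x = x"
    using x by (auto simp: in_cocycles_lim lim_map_def in_cat_lim PiE_def extensional_restrict)
  moreover have "lim_map D (f n) x \<div>\<^bsub>cat_lim D (term_at R n)\<^esub> lim_map D (\<lambda>a x. x) x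
    \<in> coboundaries (lim_terms D R) (lim_diffs D R) n"
  proof (rule homotopic_lim[where W = "term_at R" and Y = "term_at R" and dW = "diff_at R" and dY =
      "diff_at R"
        and f = f and g = "\<lambda>n a x. x",
        OF injective_cmodule_cmodule[OF RD(1)] RD(1) RD(3) RD(3) RD(6) RD(7) f id fd refl _ x])
    show "f 0 a x = x"
      if "a \<in> obj D" "x \<in> carrier (val (term_at R 0) a)" "diff_at R 0 a x = \<one>\<^bsub>val (term_at R 1) a\<^esub>" for a x
      using RD(5)[OF that] f_augm[OF that(1)] by auto
  qed
  ultimately show ?thesis by simp
qed

text \<open>Since \<open>R\<close> is injective over \<open>D\<close> as well, a map
  \<open>\<phi>\<close> back from \<open>S\<close> to \<open>R\<close> exists, and both composites
  lift the identity of \<open>\<Phi>\<close>.\<close>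

lemma quasi_iso_comparison:
  fixes D :: "('o, 'r) cat" and R S :: "('o, 'r, 'a) resolution" and \<Phi> :: "('o, 'r, 'a) cmod"
  assumes \<Phi>: "cmodule D \<Phi>" and R: "injective_resolution D \<Phi> R" and S: "injective_resolution D \<Phi> S"
    and \<theta>: "comparison D \<Phi> R S \<theta>"
  shows "quasi_iso (lim_terms D R) (lim_diffs D R) (lim_terms D S) (lim_diffs D S) (\<lambda>n. lim_map D (\<theta> n))"
proof -
  note RD = injective_resolutionD[OF R] and SD = injective_resolutionD[OF S]
  note Rc = injective_cmodule_cmodule[OF RD(1)] and Sc = injective_cmodule_cmodule[OF SD(1)]
  have \<theta>D: "\<theta> n \<in> cmod_hom D (term_at R n) (term_at S n)"
    "a \<in> obj D \<Longrightarrow> x \<in> carrier (val \<Phi> a) \<Longrightarrow> \<theta> 0 a (augm R a x) = augm S a x"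
    "a \<in> obj D \<Longrightarrow> y \<in> carrier (val (term_at R n) a) \<Longrightarrow> \<theta> (Suc n) a (diff_at R n a y) = diff_at S n a (\<theta> n a
        y)"
    for n a x y
    using \<theta> by (simp_all add: comparison_def)
  have "\<exists>f. (\<forall>n. f n \<in> cmod_hom D (term_at S n) (term_at R n)) \<and>
    (\<forall>a\<in>obj D. \<forall>x\<in>carrier (val \<Phi> a). f 0 a (augm S a x) = augm R a x) \<and>
    (\<forall>n. \<forall>a\<in>obj D. \<forall>x\<in>carrier (val (term_at S n) a). f (Suc n) a (diff_at S n a x) = diff_at R n a (f n a
        x))"
  proof (rule chain_map_extension_exists[where W = "term_at S" and Y = "term_at R" and dW = "diff_at S" and
      dY = "diff_at R",
        OF \<Phi> Sc RD(1) SD(3) RD(3) SD(2) RD(2) RD(6) RD(4) _ SD(5) SD(7)])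
    fix a x assume h: "a \<in> obj D" "x \<in> carrier (val \<Phi> a)" "augm S a x = \<one>\<^bsub>val (term_at S 0) a\<^esub>"
    have "\<one>\<^bsub>val \<Phi> a\<^esub> \<in> carrier (val \<Phi> a)" by (rule comm_groupE(2)[OF cmodule_comm_group[OF \<Phi> h(1)]])
    then have "x = \<one>\<^bsub>val \<Phi> a\<^esub>" using SD(8)[OF h(1,2)] h(3) cmod_hom_one[OF SD(2) \<Phi> Sc h(1)] by simp
    then show "augm R a x = \<one>\<^bsub>val (term_at R 0) a\<^esub>" using cmod_hom_one[OF RD(2) \<Phi> Rc h(1)] by simp
  qed
  then obtain \<phi> where \<phi>': "\<forall>n. \<phi> n \<in> cmod_hom D (term_at S n) (term_at R n)"
    "\<forall>a\<in>obj D. \<forall>x\<in>carrier (val \<Phi> a). \<phi> 0 a (augm S a x) = augm R a x"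
    "\<forall>n. \<forall>a\<in>obj D. \<forall>x\<in>carrier (val (term_at S n) a). \<phi> (Suc n) a (diff_at S n a x) = diff_at R n a (\<phi> n a
        x)"
    by (elim exE conjE) (rule that)
  note \<phi> = \<phi>'(1)[THEN spec] \<phi>'(2)[THEN bspec, THEN bspec] \<phi>'(3)[THEN spec, THEN bspec, THEN bspec]
  have lim_comp: "lim_map D \<zeta> (lim_map D \<eta> x) = lim_map D (\<lambda>a x. \<zeta> a (\<eta> a x)) x" for \<zeta> \<eta> :: "'o \<Rightarrow> ('o, 'r,
      'a) univ \<Rightarrow> ('o, 'r, 'a) univ" and x
    by (auto simp: lim_map_def intro!: restrict_ext)
  show ?thesis
  proof (rule quasi_isoI_homotopy_inverse)
    show "cochain_complex (lim_terms D R) (lim_diffs D R)"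
      by (rule cochain_complex_lim, rule Rc, rule RD(3)) (rule RD(6))
    show "cochain_complex (lim_terms D S) (lim_diffs D S)"
      by (rule cochain_complex_lim, rule Sc, rule SD(3)) (rule SD(6))
    show "cochain_map (lim_terms D R) (lim_diffs D R) (lim_terms D S) (lim_diffs D S) (\<lambda>n. lim_map D (\<theta> n))"
      by (rule cochain_map_lim, rule \<theta>D(1)) (rule \<theta>D(3))
    show "cochain_map (lim_terms D S) (lim_diffs D S) (lim_terms D R) (lim_diffs D R) (\<lambda>n. lim_map D (\<phi> n))"
      by (rule cochain_map_lim, rule \<phi>(1)) (rule \<phi>(3))
  next
    fix n x assume x: "x \<in> cocycles (lim_terms D R) (lim_diffs D R) n"
    show "lim_map D (\<phi> n) (lim_map D (\<theta> n) x) \<div>\<^bsub>cat_lim D (term_at R n)\<^esub> x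
      \<in> coboundaries (lim_terms D R) (lim_diffs D R) n"
      unfolding lim_comp
    proof (rule lim_augmented_self_map[where f = "\<lambda>n a x. \<phi> n a (\<theta> n a x)", OF R cmod_hom_comp[OF \<theta>D(1)
        \<phi>(1)] _ _ x])
      show "\<phi> (Suc n) a (\<theta> (Suc n) a (diff_at R n a x)) = diff_at R n a (\<phi> n a (\<theta> n a x))"
        if "a \<in> obj D" "x \<in> carrier (val (term_at R n) a)" for n a x
        using \<theta>D(3)[OF that] \<phi>(3)[OF that(1) cmod_hom_closed[OF \<theta>D(1) that]] by simp
    qed (simp add: \<theta>D(2) \<phi>(2))
  next
    fix n x assume x: "x \<in> cocycles (lim_terms D S) (lim_diffs D S) n"
    show "lim_map D (\<theta> n) (lim_map D (\<phi> n) x) \<div>\<^bsub>cat_lim D (term_at S n)\<^esub> x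
      \<in> coboundaries (lim_terms D S) (lim_diffs D S) n"
      unfolding lim_comp
    proof (rule lim_augmented_self_map[where f = "\<lambda>n a x. \<theta> n a (\<phi> n a x)", OF S cmod_hom_comp[OF \<phi>(1)
        \<theta>D(1)] _ _ x])
      show "\<theta> (Suc n) a (\<phi> (Suc n) a (diff_at S n a x)) = diff_at S n a (\<theta> n a (\<phi> n a x))"
        if "a \<in> obj D" "x \<in> carrier (val (term_at S n) a)" for n a x
        using \<phi>(3)[OF that] \<theta>D(3)[OF that(1) cmod_hom_closed[OF \<phi>(1) that]] by simp
    qed (simp add: \<theta>D(2) \<phi>(2))
  qed
qed

lemma injective_resolution_full_subcat:
  assumes C: "small_category C" and R: "injective_resolution C \<Phi> R" and S: "S \<subseteq> obj C"
    and sieve: "\<And>a b f. \<lbrakk>a \<in> obj C; b \<in> S; f \<in> mor C a b\<rbrakk> \<Longrightarrow> a \<in> S"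
  shows "injective_resolution (full_subcat C S) \<Phi> R"
proof -
  note r = R[unfolded injective_resolution_def]
  have "injective_cmodule (full_subcat C S) (term_at R n)" for n
    by (rule injective_full_subcat[OF C injective_resolutionD(1)[OF R] S sieve])
  moreover have "\<forall>a\<in>S. a \<in> obj C" using S by blast
  moreover note cmod_hom_full_subcat[OF injective_resolutionD(2)[OF R] S] cmod_hom_full_subcat[OF
      injective_resolutionD(3)[OF R] S]
  ultimately show ?thesis
    unfolding injective_resolution_def using r by simp
qed

section \<open>Finite and arbitrary p-subgroups in the orbit category\<close>

context group begin

lemma orbit_cat_p_simps [simp]:
  "obj (orbit_cat_p p G) = p_subgroups p G" "idt (orbit_cat_p p G) H = H #> \<one>"
  "cmp (orbit_cat_p p G) H K L \<beta> \<alpha> = \<beta> <#> \<alpha>"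
  by (simp_all add: orbit_cat_p_def orbit_cat_def)

lemma mor_orbit_cat_p:
  "\<alpha> \<in> mor (orbit_cat_p p G) H K \<longleftrightarrow> (\<exists>g\<in>carrier G. \<alpha> = K #> g \<and> (\<lambda>h. g \<otimes> h \<otimes> inv g) ` H \<subseteq> K)"
  by (auto simp: orbit_cat_p_def orbit_cat_def)

lemma orbit_cat_pf_eq: "orbit_cat_pf p G = full_subcat (orbit_cat_p p G) (finite_p_subgroups p G)"
  by (simp add: orbit_cat_pf_def orbit_cat_p_def full_subcat_def)

lemma finite_p_subgroups_subset: "finite_p_subgroups p G \<subseteq> p_subgroups p G"
  by (auto simp: finite_p_subgroups_def)

lemma finite_p_subgroups_sieve:
  assumes "H \<in> p_subgroups p G" "K \<in> finite_p_subgroups p G" "\<alpha> \<in> mor (orbit_cat_p p G) H K"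
  shows "H \<in> finite_p_subgroups p G"
proof -
  obtain g where g: "g \<in> carrier G" "(\<lambda>h. g \<otimes> h \<otimes> inv g) ` H \<subseteq> K"
    using assms(3) by (auto simp: mor_orbit_cat_p)
  have "inj_on (\<lambda>h. g \<otimes> h \<otimes> inv g) H"
    using subgroup.mem_carrier[OF p_subgroup_D(1)[OF assms(1)]] g(1) by (auto simp: inj_on_def)
  moreover have "finite K" using assms(2) by (simp add: finite_p_subgroups_def)
  ultimately have "finite H" using g(2) by (meson finite_imageD finite_subset)
  then show ?thesis using assms(1) by (simp add: finite_p_subgroups_def)
qed

lemma p_subgroups_mono:
  assumes P: "P \<in> p_subgroups p G" and Q: "subgroup Q G" "Q \<subseteq> P"
  shows "Q \<in> p_subgroups p G"
proof -
  note gP = subgroup.subgroup_is_group[OF p_subgroup_D(1)[OF P] is_group]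
    and gQ = subgroup.subgroup_is_group[OF Q(1) is_group]
  \<comment> \<open>Powers in either subgroup are powers in \<open>G\<close>, so the orders
    agree.\<close>
  have "group.ord (G\<lparr>carrier := Q\<rparr>) x = group.ord (G\<lparr>carrier := P\<rparr>) x" for x
    by (simp add: group.ord_def[OF gP] group.ord_def[OF gQ] nat_pow_consistent[symmetric])
  then show ?thesis using P Q gQ by (auto simp: p_subgroups_def p_group_def)
qed

lemma generate_finite_p_subgroup:
  assumes P: "P \<in> p_subgroups p G" "locally_finite (G\<lparr>carrier := P\<rparr>)" and F: "F \<subseteq> P" "finite F"
  shows "generate G F \<in> finite_p_subgroups p G" "generate G F \<subseteq> P" "F \<subseteq> generate G F"
proof -
  note sP = p_subgroup_D(1)[OF P(1)]
  have Fc: "F \<subseteq> carrier G" using F(1) subgroup.subset[OF sP] by blast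
  show sub: "generate G F \<subseteq> P" by (rule generate_subgroup_incl[OF F(1) sP])
  show "F \<subseteq> generate G F" by (auto intro: generate.incl)
  have "finite (generate G F)"
    using P(2) F generate_consistent[OF F(1) sP] by (auto simp: locally_finite_def)
  then show "generate G F \<in> finite_p_subgroups p G"
    using p_subgroups_mono[OF P(1) generate_is_subgroup[OF Fc] sub] by (simp add: finite_p_subgroups_def)
qed

text \<open>The inclusion of \<open>H\<close> into \<open>K\<close> is the coset
  \<open>K #> \<one>\<close>, which is \<open>K\<close> itself. For this reason \<open>inc\<close>
  is instantiated below by the function returning the target.\<close>

lemma subset_orbit_mor:
  assumes "subgroup H G" "H \<subseteq> K" "subgroup K G"
  shows "K \<in> mor (orbit_cat_p p G) H K"
proof -
  have "(\<lambda>h. \<one> \<otimes> h \<otimes> inv \<one>) ` H \<subseteq> K" using assms(2) subgroup.mem_carrier[OF assms(1)] by auto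
  moreover have "K #> \<one> = K" by (rule coset_mult_one[OF subgroup.subset[OF assms(3)]])
  ultimately show ?thesis unfolding mor_orbit_cat_p by (intro bexI[of _ \<one>]) auto
qed

lemma subset_orbit_comp:
  assumes "subgroup H G" "H \<subseteq> K" "subgroup K G" "g \<in> carrier G"
  shows "K <#> (H #> g) = K #> g"
proof -
  have "(\<lambda>h. \<one> \<otimes> h \<otimes> inv \<one>) ` H \<subseteq> K" using assms(2) subgroup.mem_carrier[OF assms(1)] by auto
  from orbit_comp[OF assms(1,3) one_closed this assms(4)]
  show ?thesis using assms(4) coset_mult_one[OF subgroup.subset[OF assms(3)]] by simp
qed

end

context ZG_module begin

lemma atomic_functor_nontrivial:
  "P \<noteq> {\<one>} \<Longrightarrow> carrier (val (atomic_functor G M act) P) = {\<one>\<^bsub>M\<^esub>}"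
  "P \<noteq> {\<one>} \<Longrightarrow> \<one>\<^bsub>val (atomic_functor G M act) P\<^esub> = \<one>\<^bsub>M\<^esub>"
  by (simp_all add: atomic_functor_def)

text \<open>The kernel of the first differential is the image of the augmentation, whose source is
  trivial at a nontrivial subgroup.\<close>

lemma resolution_exact_nontrivial:
  assumes R: "injective_resolution (orbit_cat_p p G) (atomic_functor G M act) R"
    and P: "P \<in> p_subgroups p G" "P \<noteq> {\<one>}"
    and x: "x \<in> carrier (val (term_at R 0) P)" "diff_at R 0 P x = \<one>\<^bsub>val (term_at R 1) P\<^esub>"
  shows "x = \<one>\<^bsub>val (term_at R 0) P\<^esub>"
proof -
  note RD = injective_resolutionD[OF R]
  have "P \<in> obj (orbit_cat_p p G)" using P by simp
  from RD(5)[OF this x] cmod_hom_one[OF RD(2) cmodule_atomic_functor_p injective_cmodule_cmodule[OF RD(1)]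
      this]
  show ?thesis using P(2) by (auto simp: atomic_functor_nontrivial)
qed

text \<open>The one case with content, an instance of \<open>vanishing_lift\<close> for the
  inclusions into \<open>P\<close> of its nontrivial finite subgroups; local finiteness makes these
  directed.\<close>

lemma vanishing_infinite:
  fixes R :: "('g set, 'g set, 'm) resolution"
  assumes R: "injective_resolution (orbit_cat_p p G) (atomic_functor G M act) R"
    and P: "P \<in> p_subgroups p G" "locally_finite (G\<lparr>carrier := P\<rparr>)" "infinite P"
    and x: "x \<in> carrier (val (vanishing (orbit_cat_p p G) (finite_p_subgroups p G) (term_at R (Suc n))) P)"
      "diff_at R (Suc n) P x = \<one>\<^bsub>val (term_at R (Suc (Suc n))) P\<^esub>"
  shows "\<exists>y\<in>carrier (val (vanishing (orbit_cat_p p G) (finite_p_subgroups p G) (term_at R n)) P). diff_at R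
      n P y = x"
proof -
  let ?C = "orbit_cat_p p G"
  note RD = injective_resolutionD[OF R]
  note Rc = injective_cmodule_cmodule[OF RD(1)]
  note sP = p_subgroup_D(1)[OF P(1)]
  define J where "J = {Q \<in> finite_p_subgroups p G. Q \<subseteq> P \<and> Q \<noteq> {\<one>}}"
  have JD: "Q \<in> finite_p_subgroups p G" "Q \<in> p_subgroups p G" "subgroup Q G" "Q \<subseteq> P" "Q \<noteq> {\<one>}" if "Q \<in> J"
      for Q
    using that finite_p_subgroups_subset p_subgroup_D by (auto simp: J_def)
  have finJ: "finite Q" if "Q \<in> J" for Q using JD(1)[OF that] by (simp add: finite_p_subgroups_def)
  have hull: "\<exists>Q\<in>J. F \<subseteq> Q" if F: "F \<subseteq> P" "finite F" for F
  proof -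
    \<comment> \<open>A nontrivial element \<open>u\<close> is adjoined to \<open>F\<close> so that
      the generated subgroup is nontrivial even when \<open>F\<close> is not enough for
      that.\<close>
    have "\<not> P \<subseteq> {\<one>}" using P(3) finite_subset by blast
    then obtain u where u: "u \<in> P" "u \<noteq> \<one>" by blast
    have "insert u F \<subseteq> P" "finite (insert u F)" using F u by auto
    note g = generate_finite_p_subgroup[OF P(1,2) this]
    show ?thesis using g u by (intro bexI[of _ "generate G (insert u F)"]) (auto simp: J_def)
  qed
  obtain e :: "('g set \<times> 'g set \<Rightarrow> ('g set, 'g set, 'm) univ) \<Rightarrow> ('g set, 'g set, 'm) univ" where e: "inj e"
    using ex_inj_univ by blast
  interpret directed_resolution ?C J "(\<subseteq>)" "\<lambda>a b. b" "term_at R" "diff_at R" e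
  proof
    show "small_category ?C" by (rule small_category_orbit_p)
    show "J \<subseteq> obj ?C" using JD(2) by auto
    show "\<exists>d\<in>J. a \<subseteq> d \<and> b \<subseteq> d" if "a \<in> J" "b \<in> J" for a b
      using hull[of "a \<union> b"] JD(4) finJ that by auto
    show "b \<in> mor ?C a b" if "a \<in> J" "b \<in> J" "a \<subseteq> b" for a b
      by (rule subset_orbit_mor[OF JD(3)[OF that(1)] that(3) JD(3)[OF that(2)]])
    show "a = idt ?C a" if "a \<in> J" for a
      using coset_mult_one[OF subgroup.subset[OF JD(3)[OF that]]] by simp
    show "cmp ?C a b c c b = c" if "a \<in> J" "b \<in> J" "c \<in> J" "a \<subseteq> b" "b \<subseteq> c" for a b c
      using subset_orbit_comp[OF JD(3)[OF that(2)] that(5) JD(3)[OF that(3)] one_closed]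
        coset_mult_one[OF subgroup.subset[OF JD(3)[OF that(2)]]] coset_mult_one[OF subgroup.subset[OF
            JD(3)[OF that(3)]]]
      by simp
    show "x = \<one>\<^bsub>val (term_at R 0) a\<^esub>"
      if "a \<in> J" "x \<in> carrier (val (term_at R 0) a)" "diff_at R 0 a x = \<one>\<^bsub>val (term_at R 1) a\<^esub>" for a x
      by (rule resolution_exact_nontrivial[OF R JD(2)[OF that(1)] JD(5)[OF that(1)] that(2,3)])
    show "\<exists>y\<in>carrier (val (term_at R n) a). diff_at R n a y = x"
      if "a \<in> J" "x \<in> carrier (val (term_at R (Suc n)) a)" "diff_at R (Suc n) a x =
          \<one>\<^bsub>val (term_at R (Suc (Suc n))) a\<^esub>" for a x n
      using RD(7)[OF _ that(2,3)] JD(2)[OF that(1)] by simp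
  qed (use RD e in auto)
  have Po: "P \<in> obj ?C" using P(1) by simp
  have k: "P \<in> mor ?C a P" if "a \<in> J" for a
    by (rule subset_orbit_mor[OF JD(3)[OF that] JD(4)[OF that] sP])
  have P1: "P \<noteq> {\<one>}" using P(3) by auto
  have "\<exists>y\<in>carrier (val (term_at R n) P). diff_at R n P y = x \<and>
      (\<forall>a\<in>J. arr (term_at R n) a P P y = \<one>\<^bsub>val (term_at R n) a\<^esub>)"
  proof (rule vanishing_lift[OF Po k])
    show "cmp ?C a b P P b = P" if "a \<in> J" "b \<in> J" "a \<subseteq> b" for a b
      using subset_orbit_comp[OF JD(3)[OF that(2)] JD(4)[OF that(2)] sP one_closed]
        coset_mult_one[OF subgroup.subset[OF JD(3)[OF that(2)]]] coset_mult_one[OF subgroup.subset[OF sP]]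
      by simp
    show "\<exists>q\<in>J. a \<subseteq> q \<and> b \<subseteq> q \<and> cmp ?C c a q q f = cmp ?C c b q q g"
      if h: "c \<in> obj ?C" "a \<in> J" "b \<in> J" "f \<in> mor ?C c a" "g \<in> mor ?C c b" "cmp ?C c a P P f = cmp ?C c b P
          P g" for a b c f g
    proof -
      obtain s where s: "s \<in> carrier G" "f = a #> s" using h(4) by (auto simp: mor_orbit_cat_p)
      obtain t where t: "t \<in> carrier G" "g = b #> t" using h(5) by (auto simp: mor_orbit_cat_p)
      have "P #> s = P #> t"
        using h(6) subset_orbit_comp[OF JD(3)[OF h(2)] JD(4)[OF h(2)] sP s(1)]
          subset_orbit_comp[OF JD(3)[OF h(3)] JD(4)[OF h(3)] sP t(1)] by (simp add: s(2) t(2))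
      \<comment> \<open>The equality of the two cosets of \<open>P\<close> is witnessed by this
        single element, so a finite subgroup \<open>q\<close> containing it along with
        \<open>a\<close> and \<open>b\<close> already identifies the two arrows.\<close>
      then have u: "s \<otimes> inv t \<in> P" using rcoset_eq_iff[OF is_group sP s(1) t(1)] by simp
      obtain q where q: "q \<in> J" "insert (s \<otimes> inv t) (a \<union> b) \<subseteq> q"
        using hull[of "insert (s \<otimes> inv t) (a \<union> b)"] u JD(4)[OF h(2)] JD(4)[OF h(3)] finJ h(2,3) by auto
      have "q #> s = q #> t" using rcoset_eq_iff[OF is_group JD(3)[OF q(1)] s(1) t(1)] q(2) by simp
      then have "cmp ?C c a q q f = cmp ?C c b q q g"
        using subset_orbit_comp[OF JD(3)[OF h(2)] _ JD(3)[OF q(1)] s(1)] subset_orbit_comp[OF JD(3)[OF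
            h(3)] _ JD(3)[OF q(1)] t(1)] q(2)
        by (simp add: s(2) t(2))
      then show ?thesis using q by blast
    qed
    show "x = \<one>\<^bsub>val (term_at R 0) P\<^esub>"
      if "x \<in> carrier (val (term_at R 0) P)" "diff_at R 0 P x = \<one>\<^bsub>val (term_at R 1) P\<^esub>" for x
      by (rule resolution_exact_nontrivial[OF R P(1) P1 that])
    show "\<exists>y\<in>carrier (val (term_at R n) P). diff_at R n P y = x"
      if "x \<in> carrier (val (term_at R (Suc n)) P)" "diff_at R (Suc n) P x =
          \<one>\<^bsub>val (term_at R (Suc (Suc n))) P\<^esub>" for n x
      by (rule RD(7)[OF Po that])
    show "x \<in> carrier (val (term_at R (Suc n)) P)" using x(1) by simp
    show "diff_at R (Suc n) P x = \<one>\<^bsub>val (term_at R (Suc (Suc n))) P\<^esub>" by (rule x(2))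
    show "arr (term_at R (Suc n)) a P P x = \<one>\<^bsub>val (term_at R (Suc n)) a\<^esub>" if "a \<in> J" for a
      using x(1) k[OF that] JD(1)[OF that] by simp
  qed
  then obtain y where y: "y \<in> carrier (val (term_at R n) P)" "diff_at R n P y = x"
    "\<And>a. a \<in> J \<Longrightarrow> arr (term_at R n) a P P y = \<one>\<^bsub>val (term_at R n) a\<^esub>" by blast
  \<comment> \<open>So far \<open>y\<close> restricts trivially only along inclusions from
    \<open>J\<close>. A general arrow \<open>P #> g\<close> from a finite \<open>b\<close> factors
    through any \<open>a\<close> in \<open>J\<close> that contains the conjugate of \<open>b\<close>
    by \<open>g\<close>.\<close>
  have "arr (term_at R n) b P f y = \<one>\<^bsub>val (term_at R n) b\<^esub>"
    if b: "b \<in> finite_p_subgroups p G" and f: "f \<in> mor ?C b P" for b f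
  proof -
    obtain g where g: "g \<in> carrier G" "f = P #> g" "(\<lambda>h. g \<otimes> h \<otimes> inv g) ` b \<subseteq> P"
      using f by (auto simp: mor_orbit_cat_p)
    have "finite ((\<lambda>h. g \<otimes> h \<otimes> inv g) ` b)" using b by (simp add: finite_p_subgroups_def)
    then obtain a where a: "a \<in> J" "(\<lambda>h. g \<otimes> h \<otimes> inv g) ` b \<subseteq> a" using hull[OF g(3)] by blast
    have bo: "b \<in> obj ?C" using b finite_p_subgroups_subset by auto
    have ga: "a #> g \<in> mor ?C b a" using g(1) a(2) by (auto simp: mor_orbit_cat_p)
    have "cmp ?C b a P P (a #> g) = f"
      using subset_orbit_comp[OF JD(3)[OF a(1)] JD(4)[OF a(1)] sP g(1)] by (simp add: g(2))
    then show ?thesis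
      using cmodule_arr_comp[OF Rc bo J_obj[OF a(1)] Po ga k[OF a(1)] y(1)] y(3)[OF a(1)]
        cmodule_arr_one[OF Rc bo J_obj[OF a(1)] ga] by simp
  qed
  then show ?thesis using y(1,2) by (intro bexI[of _ y]) simp_all
qed

text \<open>The exactness hypotheses of \<open>quasi_iso_lim_restrict\<close> hold object by object:
  at a finite subgroup the vanishing submodule is trivial, in degree 0 a nontrivial subgroup is
  covered by \<open>resolution_exact_nontrivial\<close>, and in positive degrees an infinite one by
  \<open>vanishing_infinite\<close>.\<close>

lemma quasi_iso_restrict_finite:
  fixes R :: "('g set, 'g set, 'm) resolution"
  assumes lf: "\<And>P. P \<in> p_subgroups p G \<Longrightarrow> locally_finite (G\<lparr>carrier := P\<rparr>)"
    and R: "injective_resolution (orbit_cat_p p G) (atomic_functor G M act) R"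
  shows "quasi_iso (lim_terms (orbit_cat_p p G) R) (lim_diffs (orbit_cat_p p G) R)
    (lim_terms (orbit_cat_pf p G) R) (lim_diffs (orbit_cat_pf p G) R) (\<lambda>n. lim_restrict (orbit_cat_pf p G))"
proof -
  let ?C = "orbit_cat_p p G" and ?S = "finite_p_subgroups p G"
  note RD = injective_resolutionD[OF R]
  note Rc = injective_cmodule_cmodule[OF RD(1)]
  obtain e :: "('g set \<times> 'g set \<Rightarrow> ('g set, 'g set, 'm) univ) \<Rightarrow> ('g set, 'g set, 'm) univ" where e: "inj e"
    using ex_inj_univ by blast
  have C: "small_category ?C" by (rule small_category_orbit_p)
  \<comment> \<open>The identity of \<open>P\<close> is among the arrows along which
    \<open>x\<close> has to vanish.\<close>
  have fin: "x = \<one>\<^bsub>val (term_at R n) P\<^esub>"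
    if "P \<in> ?S" "x \<in> carrier (val (vanishing ?C ?S (term_at R n)) P)" for P n x
  proof -
    have Po: "P \<in> obj ?C" using that(1) finite_p_subgroups_subset by auto
    have "arr (term_at R n) P P (idt ?C P) x = \<one>\<^bsub>val (term_at R n) P\<^esub>"
      using that small_categoryD(1)[OF C Po] unfolding vanishing_simps by blast
    then show ?thesis using cmodule_arr_id[OF Rc Po, of x n] that(2) by simp
  qed
  show ?thesis
    unfolding orbit_cat_pf_eq
  proof (rule quasi_iso_lim_restrict[where W = "term_at R" and d = "diff_at R", OF C RD(1) e RD(3) RD(6)])
    show "?S \<subseteq> obj ?C" using finite_p_subgroups_subset by simp
    show "a \<in> ?S" if "a \<in> obj ?C" "b \<in> ?S" "f \<in> mor ?C a b" for a b f
      by (rule finite_p_subgroups_sieve[OF _ that(2,3)]) (use that(1) in simp)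
  next
    fix P x assume P: "P \<in> obj ?C" and x: "x \<in> carrier (val (vanishing ?C ?S (term_at R 0)) P)"
      and dx: "diff_at R 0 P x = \<one>\<^bsub>val (term_at R 1) P\<^esub>"
    show "x = \<one>\<^bsub>val (term_at R 0) P\<^esub>"
    proof (cases "P = {\<one>}")
      case True
      have "P \<in> ?S" using P by (simp add: finite_p_subgroups_def True)
      then show ?thesis by (rule fin[OF _ x])
    next
      case False
      show ?thesis by (rule resolution_exact_nontrivial[OF R _ False _ dx]) (use P x in simp_all)
    qed
  next
    fix n P x assume P: "P \<in> obj ?C" and x: "x \<in> carrier (val (vanishing ?C ?S (term_at R (Suc n))) P)"
      and dx: "diff_at R (Suc n) P x = \<one>\<^bsub>val (term_at R (Suc (Suc n))) P\<^esub>"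
    have Pp: "P \<in> p_subgroups p G" using P by simp
    show "\<exists>y\<in>carrier (val (vanishing ?C ?S (term_at R n)) P). diff_at R n P y = x"
    proof (cases "finite P")
      case True
      then have "P \<in> ?S" using Pp by (simp add: finite_p_subgroups_def)
      then have x1: "x = \<one>\<^bsub>val (term_at R (Suc n)) P\<^esub>" by (rule fin[OF _ x])
      have V: "comm_group (val (vanishing ?C ?S (term_at R n)) P)"
        by (rule cmodule_comm_group[OF cmodule_vanishing[OF C Rc] P]) (simp add: finite_p_subgroups_subset)
      show ?thesis
        using comm_groupE(2)[OF V] cmod_hom_one[OF RD(3) Rc Rc P, of n] x1
        by (intro bexI[of _ "\<one>\<^bsub>val (vanishing ?C ?S (term_at R n)) P\<^esub>"]) simp_all
    next
      case False
      show ?thesis by (rule vanishing_infinite[OF R Pp lf[OF Pp] False x dx])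
    qed
  qed
qed

end

theorem theorem3p6:
  fixes p n :: nat
    and G :: "('g, 'b) monoid_scheme"
    and M :: "'m monoid"
    and act :: "'g \<Rightarrow> 'm \<Rightarrow> 'm"
    and R S :: "('g set, 'g set, 'm) resolution"
    and \<theta> :: "nat \<Rightarrow> 'g set \<Rightarrow> ('g set, 'g set, 'm) univ \<Rightarrow> ('g set, 'g set, 'm) univ"
  assumes "Factorial_Ring.prime p"
    and "group G"
    and "\<And>P. P \<in> p_subgroups p G \<Longrightarrow> locally_finite (G\<lparr>carrier := P\<rparr>)"
    and "ZG_module G M act"
    and "injective_resolution (orbit_cat_p p G) (atomic_functor G M act) R"
    and "injective_resolution (orbit_cat_pf p G) (atomic_functor G M act) S"
    and "comparison (orbit_cat_pf p G) (atomic_functor G M act) R S \<theta>"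
  shows "restriction_hom (orbit_cat_pf p G) S \<theta> n
           \<in> iso (higher_lim (orbit_cat_p p G) R n) (higher_lim (orbit_cat_pf p G) S n)"
proof -
  interpret ZG_module G M act by fact
  let ?C = "orbit_cat_p p G" and ?D = "orbit_cat_pf p G"
  \<comment> \<open>With \<open>R\<close> a resolution over the subcategory too, the natural map
    factors on cochains as the restriction of the limits of \<open>R\<close> followed by the
    comparison from \<open>R\<close> to \<open>S\<close>, both of them quasi-isomorphisms.\<close>
  have RD: "injective_resolution ?D (atomic_functor G M act) R"
    unfolding orbit_cat_pf_eq
    by (rule injective_resolution_full_subcat[OF small_category_orbit_p assms(5)])
      (use finite_p_subgroups_subset finite_p_subgroups_sieve in auto)
  have cc: "cochain_complex (lim_terms E T) (lim_diffs E T)"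
    if "injective_resolution E (atomic_functor G M act) T" for E and T :: "('g set, 'g set, 'm) resolution"
    by (rule cochain_complex_lim, rule injective_cmodule_cmodule, rule injective_resolutionD(1)[OF that],
        rule injective_resolutionD(3)[OF that]) (rule injective_resolutionD(6)[OF that])
  have "quasi_iso (lim_terms ?C R) (lim_diffs ?C R) (lim_terms ?D S) (lim_diffs ?D S)
      (\<lambda>n. lim_map ?D (\<theta> n) \<circ> lim_restrict ?D)"
    by (rule quasi_iso_comp[OF cc[OF assms(5)] cc[OF RD] cc[OF assms(6)]
          quasi_iso_restrict_finite[OF assms(3,5)] quasi_iso_comparison[OF cmodule_atomic_functor_pf RD
              assms(6,7)]])
  from quasi_iso_cohomology[OF cc[OF assms(5)] cc[OF assms(6)] this]
  show ?thesis by (simp add: restriction_hom_def higher_lim_def)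
qed

end
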